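(* Let $a>0$, $b\in\mathbb{R}\setminus\{0,-a\}$, $\mu>0$ and $0<I_1<I_2<I_3$. Consider the rubber rolling (no slip, no twist) of the dynamically asymmetric balanced sphere $S_b$ over the fixed sphere $S_a$, with configuration coordinates $(q,R)\in S_a\times SO(3)$, where $q$ is the contact point on $S_a$ and $R$ is the attitude matrix of the moving sphere. Let $\gamma=R^{-1}(q/a)=-Q/b\in S^2$ be the Poisson vector, where $Q$ is the contact point on the moving sphere seen in the body frame. Use sphero-conical coordinates $I_1<\lambda_1<I_2<\lambda_2<I_3$ for $\gamma$. Put $$F(\gamma)=\Big(1+\frac ba\Big)^2(\lambda_1+\mu b^2)(\lambda_2+\mu b^2)$$ and introduce a new time $\tau$ by $d\tau/dt=F(\gamma)^{\frac{b-a}{2a}}$. Then the equations of motion for $\gamma$ are governed, in the time $\tau$, by the Hamiltonian system $$\frac{d\lambda_i}{d\tau}=\frac{\partial H}{\partial P_i},\qquad \frac{dP_i}{d\tau}=-\frac{\partial H}{\partial\lambda_i}\qquad(i=1,2),$$ $$2H=\frac{P_1^2}{[(\lambda_1+\mu b^2)(\lambda_2+\mu b^2)]^{\frac{b-a}{a}}\,c_1}+\frac{P_2^2}{[(\lambda_1+\mu b^2)(\lambda_2+\mu b^2)]^{\frac{b-a}{a}}\,c_2},$$ where $$c_1=\frac14\Big(1+\frac ba\Big)^2(\lambda_2-\lambda_1)\frac{\lambda_2+\mu b^2}{(\lambda_1-I_1)(I_2-\lambda_1)(I_3-\lambda_1)},\qquad c_2=\frac14\Big(1+\frac ba\Big)^2(\lambda_2-\lambda_1)\frac{\lambda_1+\mu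 b^2}{(\lambda_2-I_1)(\lambda_2-I_2)(I_3-\lambda_2)}.$$ That is, for suitable fibrewise linear momentum coordinates $P_1,P_2$ over the sphero-conical chart, the reduced nonholonomic vector field (describing the motion of $\gamma$ in time $t$) is $X_{nh}=F(\gamma)^{\frac{b-a}{2a}}X_H$, where $X_H$ is the Hamiltonian vector field of $H$ in the canonical coordinates $(\lambda,P)$.
   Context: $S_a$ is the sphere of radius $a$ centred at the origin of $\mathbb{R}^3$. The moving sphere $S_b$ has radius $|b|$ ($b>0$: external rolling; $b<0$: one sphere contains the other), mass $\mu$, center of mass at its geometric center, and inertia matrix $A=\mathrm{diag}(I_1,I_2,I_3)$ in the body frame. For $R\in SO(3)$ the body angular velocity $\Omega\in\mathbb{R}^3$ and space angular velocity $\omega$ are defined by $R^{-1}\dot R=[\Omega]$, $\dot RR^{-1}=[\omega]$, where $[v]w=v\times w$; thus $\omega=R\Omega$. The center of the moving sphere is $(1+b/a)q$, and the Lagrangian on $S_a\times SO(3)$ is $$T=\tfrac12\big[\mu(1+b/a)^2|\dot q|^2+(A\Omega,\Omega)\big].$$ The no-slip and no-twist constraints are $(1+\frac ba)\dot q=\frac ba\,\omega\times q$ and $\omega\cdot q=0$. The dynamics is given by the Lagrange–d'Alembert principle. Lagrangian and constraints are invariant under the diagonal action $S\cdot(q,R)=(Sq,SR)$ of $SO(3)$; the quotient map is $(q,R)\mapsto\gamma=R^{-1}q/a\in S^2$ (unit sphere), and the motion of $\gamma$ is a closed second-order system on $S^2$, i.e. a vector field $X_{nh}$ on $TS^2$ (equivalently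 on $T^*S^2$). Sphero-conical coordinates: $\lambda_1<\lambda_2$ are the roots of $\sum_j\gamma_j^2/(I_j-\lambda)=0$, so that $$\gamma_1^2=\tfrac{(I_1-\lambda_1)(I_1-\lambda_2)}{(I_1-I_3)(I_1-I_2)},\quad \gamma_2^2=\tfrac{(I_2-\lambda_1)(I_2-\lambda_2)}{(I_2-I_3)(I_2-I_1)},\quad \gamma_3^2=\tfrac{(I_3-\lambda_1)(I_3-\lambda_2)}{(I_3-I_1)(I_3-I_2)}.$$ They are local coordinates on each open octant of $S^2$ (all $\gamma_j\ne0$). *)

theory Defs
  imports "HOL-Analysis.Analysis"
begin

text \<open>Differentiability class C^k on an open subset of a Euclidean space.\<close>

primrec Ck_on :: "nat \<Rightarrow> ('a::euclidean_space \<Rightarrow> 'b::real_normed_vector) \<Rightarrow> 'a set \<Rightarrow> bool" where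
  "Ck_on 0 f S \<longleftrightarrow> continuous_on S f"
| "Ck_on (Suc k) f S \<longleftrightarrow>
     (\<exists>D. (\<forall>x\<in>S. (f has_derivative D x) (at x)) \<and> (\<forall>v. Ck_on k (\<lambda>x. D x v) S))"

definition smooth_on :: "('a::euclidean_space \<Rightarrow> 'b::real_normed_vector) \<Rightarrow> 'a set \<Rightarrow> bool" where
  "smooth_on f S \<longleftrightarrow> (\<forall>k. Ck_on k f S)"

definition integral_curve :: "('a::real_normed_vector \<Rightarrow> 'a) \<Rightarrow> (real \<Rightarrow> 'a) \<Rightarrow> real set \<Rightarrow> bool" where
  "integral_curve X z J \<longleftrightarrow> (\<forall>t\<in>J. (z has_vector_derivative X (z t)) (at t))"


section \<open>Rubber rolling of a sphere over a sphere\<close>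

definition hat :: "real^3 \<Rightarrow> real^3^3" where
  "hat v = matrix (cross3 v)"

text \<open>Angular velocities of a rotation matrix \<open>R\<close> with velocity \<open>R'\<close>.
  The descriptions are proper when \<open>R'\<close> is tangent to the rotation group at \<open>R\<close>.\<close>

definition body_angvel :: "real^3^3 \<Rightarrow> real^3^3 \<Rightarrow> real^3" where
  "body_angvel R R' = (THE \<Omega>. matrix_inv R ** R' = hat \<Omega>)"

definition space_angvel :: "real^3^3 \<Rightarrow> real^3^3 \<Rightarrow> real^3" where
  "space_angvel R R' = (THE \<omega>. R' ** matrix_inv R = hat \<omega>)"

definition inertia :: "real^3 \<Rightarrow> real^3^3" where
  "inertia I = (\<chi> i j. if i = j then I $ i else 0)"

definition rubber_lagrangian ::
  "real \<Rightarrow> real \<Rightarrow> real \<Rightarrow> real^3 \<Rightarrow> real^3 \<Rightarrow> real^3^3 \<Rightarrow> real^3 \<Rightarrow> real^3^3 \<Rightarrow> real" where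
  "rubber_lagrangian a b \<mu> I q R q' R' =
     (let \<Omega> = body_angvel R R'
      in 1/2 * (\<mu> * (1 + b/a)^2 * (norm q')^2 + (inertia I *v \<Omega>) \<bullet> \<Omega>))"

definition config :: "real \<Rightarrow> real^3 \<Rightarrow> real^3^3 \<Rightarrow> bool" where
  "config a q R \<longleftrightarrow> q \<in> sphere 0 a \<and> rotation_matrix R"

definition rubber_constraints ::
  "real \<Rightarrow> real \<Rightarrow> real^3 \<Rightarrow> real^3^3 \<Rightarrow> real^3 \<Rightarrow> real^3^3 \<Rightarrow> bool" where
  "rubber_constraints a b q R q' R' \<longleftrightarrow>
     (let \<omega> = space_angvel R R'
      in (1 + b/a) *\<^sub>R q' = (b/a) *\<^sub>R cross3 \<omega> q \<and> \<omega> \<bullet> q = 0)"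

text \<open>The first argument of \<open>Q\<close> and \<open>S\<close> is the variation parameter, the second is time.
  As usual in the Lagrange--d'Alembert principle, only the infinitesimal variation at
  parameter 0 has to satisfy the constraints, not the varied curves.\<close>

definition admissible_variation ::
  "real \<Rightarrow> real \<Rightarrow> real set \<Rightarrow> (real \<Rightarrow> real^3) \<Rightarrow> (real \<Rightarrow> real^3^3) \<Rightarrow> real \<Rightarrow> real
     \<Rightarrow> real \<Rightarrow> (real \<Rightarrow> real \<Rightarrow> real^3) \<Rightarrow> (real \<Rightarrow> real \<Rightarrow> real^3^3) \<Rightarrow> bool" where
  "admissible_variation a b J q R t0 t1 \<epsilon> Q S \<longleftrightarrow>
     Ck_on 2 (\<lambda>(s, t). Q s t) ({-\<epsilon><..<\<epsilon>} \<times> J) \<and>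
     Ck_on 2 (\<lambda>(s, t). S s t) ({-\<epsilon><..<\<epsilon>} \<times> J) \<and>
     (\<forall>s\<in>{-\<epsilon><..<\<epsilon>}. \<forall>t\<in>J. config a (Q s t) (S s t)) \<and>
     (\<forall>t\<in>J. Q 0 t = q t \<and> S 0 t = R t) \<and>
     (\<forall>s\<in>{-\<epsilon><..<\<epsilon>}. \<forall>t\<in>{t0, t1}. Q s t = q t \<and> S s t = R t) \<and>
     (\<forall>t\<in>{t0..t1}. rubber_constraints a b (q t) (R t)
        (vector_derivative (\<lambda>s. Q s t) (at 0)) (vector_derivative (\<lambda>s. S s t) (at 0)))"

definition rubber_action ::
  "real \<Rightarrow> real \<Rightarrow> real \<Rightarrow> real^3 \<Rightarrow> real \<Rightarrow> real \<Rightarrow> (real \<Rightarrow> real^3) \<Rightarrow> (real \<Rightarrow> real^3^3) \<Rightarrow> real" where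
  "rubber_action a b \<mu> I t0 t1 q R =
     integral {t0..t1} (\<lambda>t. rubber_lagrangian a b \<mu> I (q t) (R t)
       (vector_derivative q (at t)) (vector_derivative R (at t)))"

definition lagrange_dalembert ::
  "real \<Rightarrow> real \<Rightarrow> real \<Rightarrow> real^3 \<Rightarrow> real set \<Rightarrow> (real \<Rightarrow> real^3) \<Rightarrow> (real \<Rightarrow> real^3^3) \<Rightarrow> bool" where
  "lagrange_dalembert a b \<mu> I J q R \<longleftrightarrow>
     (\<forall>t0\<in>J. \<forall>t1\<in>J. \<forall>\<epsilon>>0. \<forall>Q S. t0 < t1 \<longrightarrow> admissible_variation a b J q R t0 t1 \<epsilon> Q S \<longrightarrow>
        ((\<lambda>s. rubber_action a b \<mu> I t0 t1 (Q s) (S s)) has_real_derivative 0) (at 0))"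

definition rubber_motion ::
  "real \<Rightarrow> real \<Rightarrow> real \<Rightarrow> real^3 \<Rightarrow> real set \<Rightarrow> (real \<Rightarrow> real^3) \<Rightarrow> (real \<Rightarrow> real^3^3) \<Rightarrow> bool" where
  "rubber_motion a b \<mu> I J q R \<longleftrightarrow>
     Ck_on 2 q J \<and> Ck_on 2 R J \<and>
     (\<forall>t\<in>J. config a (q t) (R t) \<and>
        rubber_constraints a b (q t) (R t) (vector_derivative q (at t)) (vector_derivative R (at t))) \<and>
     lagrange_dalembert a b \<mu> I J q R"

definition poisson :: "real \<Rightarrow> real^3 \<Rightarrow> real^3^3 \<Rightarrow> real^3" where
  "poisson a q R = matrix_inv R *v (q /\<^sub>R a)"

text \<open>The contact point on the moving sphere, relative to its centre and in the body frame.\<close>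

definition body_contact :: "real \<Rightarrow> real \<Rightarrow> real^3 \<Rightarrow> real^3^3 \<Rightarrow> real^3" where
  "body_contact a b q R = matrix_inv R *v (q - (1 + b/a) *\<^sub>R q)"

lemma poisson_eq_body_contact:
  assumes "b \<noteq> 0"
  shows "poisson a q R = - (body_contact a b q R /\<^sub>R b)"
proof -
  have "q - (1 + b/a) *\<^sub>R q = (- b) *\<^sub>R (q /\<^sub>R a)"
    by (simp add: algebra_simps divide_inverse)
  then show ?thesis
    using assms by (simp only: poisson_def body_contact_def matrix_vector_mult_scaleR) simp
qed


section \<open>Sphero-conical coordinates and the Hamiltonian\<close>

definition sphero_conical_chart :: "real^3 \<Rightarrow> (real \<times> real) set" where
  "sphero_conical_chart I = {I $ 1<..<I $ 2} \<times> {I $ 2<..<I $ 3}"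

definition open_octants :: "(real^3) set" where
  "open_octants = {\<gamma> \<in> sphere 0 1. \<forall>j. \<gamma> $ j \<noteq> 0}"

text \<open>For \<open>\<gamma>\<close> in an open octant the two roots exist, one in each interval. Restricting to the
  chart also excludes the poles of the summands, where Isabelle's division would yield 0.\<close>

definition sphero_conical :: "real^3 \<Rightarrow> real^3 \<Rightarrow> real \<times> real" where
  "sphero_conical I \<gamma> = (THE (l1, l2). (l1, l2) \<in> sphero_conical_chart I \<and>
     (\<Sum>j\<in>UNIV. (\<gamma> $ j)^2 / (I $ j - l1)) = 0 \<and> (\<Sum>j\<in>UNIV. (\<gamma> $ j)^2 / (I $ j - l2)) = 0)"

definition conformal_F :: "real \<Rightarrow> real \<Rightarrow> real \<Rightarrow> real \<times> real \<Rightarrow> real" where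
  "conformal_F a b \<mu> = (\<lambda>(l1, l2). (1 + b/a)^2 * (l1 + \<mu> * b^2) * (l2 + \<mu> * b^2))"

definition rubber_hamiltonian ::
  "real \<Rightarrow> real \<Rightarrow> real \<Rightarrow> real^3 \<Rightarrow> (real \<times> real) \<times> (real \<times> real) \<Rightarrow> real" where
  "rubber_hamiltonian a b \<mu> I = (\<lambda>((l1, l2), (P1, P2)).
     let G = ((l1 + \<mu> * b^2) * (l2 + \<mu> * b^2)) powr ((b - a) / a);
         c1 = 1/4 * (1 + b/a)^2 * (l2 - l1) *
                ((l2 + \<mu> * b^2) / ((l1 - I $ 1) * (I $ 2 - l1) * (I $ 3 - l1)));
         c2 = 1/4 * (1 + b/a)^2 * (l2 - l1) *
                ((l1 + \<mu> * b^2) / ((l2 - I $ 1) * (l2 - I $ 2) * (I $ 3 - l2)))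
     in 1/2 * (P1^2 / (G * c1) + P2^2 / (G * c2)))"

definition hamiltonian_vf ::
  "((real \<times> real) \<times> (real \<times> real) \<Rightarrow> real) \<Rightarrow> (real \<times> real) \<times> (real \<times> real)
     \<Rightarrow> (real \<times> real) \<times> (real \<times> real)" where
  "hamiltonian_vf H = (\<lambda>((x1, x2), (p1, p2)).
     ((deriv (\<lambda>p. H ((x1, x2), (p, p2))) p1, deriv (\<lambda>p. H ((x1, x2), (p1, p))) p2),
      (- deriv (\<lambda>x. H ((x, x2), (p1, p2))) x1, - deriv (\<lambda>x. H ((x1, x), (p1, p2))) x2)))"

text \<open>Fibrewise linear coordinates over the sphero-conical chart. The tangent vector at \<open>l\<close> with
  components \<open>v\<close> in the coordinates \<open>l\<close> has momenta \<open>P l v\<close>.\<close>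

definition momentum_coordinates :: "real^3 \<Rightarrow> (real \<times> real \<Rightarrow> real \<times> real \<Rightarrow> real \<times> real) \<Rightarrow> bool" where
  "momentum_coordinates I P \<longleftrightarrow>
     (\<forall>l\<in>sphero_conical_chart I. linear (P l) \<and> bij (P l)) \<and>
     (\<forall>v. smooth_on (\<lambda>l. P l v) (sphero_conical_chart I))"

text \<open>The phase curve of \<open>\<gamma>\<close> in the coordinates; velocities are taken in the original time.\<close>

definition phase_curve ::
  "real^3 \<Rightarrow> (real \<times> real \<Rightarrow> real \<times> real \<Rightarrow> real \<times> real) \<Rightarrow> (real \<Rightarrow> real^3)
     \<Rightarrow> real \<Rightarrow> (real \<times> real) \<times> (real \<times> real)" where
  "phase_curve I P \<gamma> t =
     (sphero_conical I (\<gamma> t),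
      P (sphero_conical I (\<gamma> t)) (vector_derivative (\<lambda>t. sphero_conical I (\<gamma> t)) (at t)))"

end

theory Submission
  imports Defs
begin

text \<open>
  Put \<open>p = 1 + b/a\<close>, \<open>m = \<mu> b\<^sup>2\<close> and \<open>W = \<gamma>' \<times> \<gamma>\<close>, and let \<open>A\<close> be the inertia matrix.

  In the body frame the constraints say that \<open>\<Omega> \<bullet> \<gamma> = 0\<close> and \<open>p \<gamma>' = \<gamma> \<times> \<Omega>\<close>, that is,
  \<open>\<Omega> = p W\<close>. So \<open>\<gamma>\<close> determines the motion up to a rotation: the attitude solves the linear equation
  \<open>R' = R [\<Omega>]\<close> (\<open>linear_ode_exists\<close>) and \<open>q = a R \<gamma>\<close>. The first variation of the action
  (\<open>first_variation\<close>) shows that the Lagrange--d'Alembert principle asks for the torque to be parallel to \<open>\<gamma>\<close>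
  (\<open>lagrange_dalembert_iff\<close>). Substituting \<open>\<Omega> = p W\<close>, this becomes the closed equation
  \<open>\<gamma> \<times> ((A + m) W' + p W \<times> A W) = 0\<close> (\<open>rubber_motion_iff\<close>).

  For the energy \<open>p\<^sup>2/2 (A + m) W \<bullet> W\<close> this is the equation of Euler and Lagrange with an additional
  gyroscopic force proportional to \<open>2 - p = 1 - b/a\<close>. Sphero-conical coordinates diagonalise the energy, with the
  coefficients \<open>c1\<close> and \<open>c2\<close> of the statement. All the terms are rational functions with poles at the moments of
  inertia, and Lagrange interpolation evaluates the sums of the inertial ones (\<open>conical_equation_of_motion\<close>,
  \<open>reduced_equation_iff\<close>).

  Let \<open>K = (\<lambda>\<^sub>1 + m) (\<lambda>\<^sub>2 + m)\<close>. Multiplying the metric by \<open>K powr (p - 2)\<close> and dividing the velocities by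
  a constant multiple \<open>N\<close> of \<open>K powr ((p - 2) / 2)\<close> leaves the energy unchanged up to a constant factor and
  adds to the geodesic equation the derivative of \<open>ln N\<close> along the curve and its gradient. As
  \<open>c1\<close> contains \<open>\<lambda>\<^sub>2 + m\<close> and \<open>c2\<close> contains \<open>\<lambda>\<^sub>1 + m\<close>, these terms cancel the gyroscopic force
  (\<open>momentum_equation_iff\<close>). In the time \<open>\<tau>\<close> the curves are thus the geodesics of the new metric, whose
  Hamiltonian is \<open>H\<close>; and \<open>integral_curve_time_change\<close> passes between the two times.
\<close>

section \<open>Continuously differentiable maps\<close>

lemma Ck_on_SucI:
  assumes "\<And>x. x \<in> S \<Longrightarrow> (f has_derivative D x) (at x)" and "\<And>v. Ck_on k (\<lambda>x. D x v) S"
  shows "Ck_on (Suc k) f S"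
  using assms by (auto intro!: exI[of _ D])

lemma Ck_on_SucE:
  assumes "Ck_on (Suc k) f S"
  obtains D where "\<And>x. x \<in> S \<Longrightarrow> (f has_derivative D x) (at x)" "\<And>v. Ck_on k (\<lambda>x. D x v) S"
  using assms unfolding Ck_on.simps by blast

lemma Ck_on_imp_continuous_on: "Ck_on k f S \<Longrightarrow> continuous_on S f"
proof (cases k)
  case (Suc j)
  assume "Ck_on k f S"
  then show ?thesis
    unfolding Suc by (auto intro!: continuous_at_imp_continuous_on dest: has_derivative_continuous)
qed simp

lemma Ck_on_pred: "Ck_on (Suc k) f S \<Longrightarrow> Ck_on k f S"
proof (induction k arbitrary: f)
  case 0
  then show ?case using Ck_on_imp_continuous_on[OF 0] by simp
next
  case (Suc k)
  then obtain D where "\<forall>x\<in>S. (f has_derivative D x) (at x)" "\<forall>v. Ck_on (Suc k) (\<lambda>x. D x v) S"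
    by auto
  with Suc.IH show ?case
    by (intro Ck_on_SucI[where D=D]) auto
qed

lemma Ck_on_cong_open:
  assumes "open S" and "\<And>x. x \<in> S \<Longrightarrow> f x = g x" and "Ck_on k f S"
  shows "Ck_on k g S"
proof (cases k)
  case 0
  then show ?thesis using assms by (auto cong: continuous_on_cong)
next
  case (Suc j)
  then obtain D where "\<forall>x\<in>S. (f has_derivative D x) (at x)" "\<forall>v. Ck_on j (\<lambda>x. D x v) S"
    using assms(3) by auto
  then show ?thesis
    unfolding Suc using assms(1,2)
    by (intro Ck_on_SucI[where D=D]) (auto intro: has_derivative_transform_within_open)
qed

lemma Ck_on_const: "Ck_on k (\<lambda>x. c) S"
proof (induction k arbitrary: c)
  case (Suc k)
  show ?case by (rule Ck_on_SucI[where D="\<lambda>x h. 0"]) (auto intro: Suc)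
qed simp

lemma Ck_on_linear_comp:
  assumes "bounded_linear L"
  shows "Ck_on k f S \<Longrightarrow> Ck_on k (\<lambda>x. L (f x)) S"
proof (induction k arbitrary: f)
  case 0
  then show ?case
    using assms by (auto intro: bounded_linear.continuous_on)
next
  case (Suc k)
  then obtain D where D: "\<And>x. x\<in>S \<Longrightarrow> (f has_derivative D x) (at x)"
    "\<And>v. Ck_on k (\<lambda>x. D x v) S" by auto
  show ?case
    by (rule Ck_on_SucI[where D="\<lambda>x v. L (D x v)"])
      (use D Suc.IH in \<open>auto intro: bounded_linear.has_derivative[OF assms]\<close>)
qed

lemma Ck_on_add:
  "Ck_on k f S \<Longrightarrow> Ck_on k g S \<Longrightarrow> Ck_on k (\<lambda>x. f x + g x) S"
proof (induction k arbitrary: f g)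
  case 0
  then show ?case by (auto intro: continuous_on_add)
next
  case (Suc k)
  obtain D where D: "\<And>x. x\<in>S \<Longrightarrow> (f has_derivative D x) (at x)"
    "\<And>v. Ck_on k (\<lambda>x. D x v) S" using Suc.prems(1) by auto
  obtain E where E: "\<And>x. x\<in>S \<Longrightarrow> (g has_derivative E x) (at x)"
    "\<And>v. Ck_on k (\<lambda>x. E x v) S" using Suc.prems(2) by auto
  show ?case
    by (rule Ck_on_SucI[where D="\<lambda>x v. D x v + E x v"])
      (use D E Suc.IH in \<open>auto intro: has_derivative_add\<close>)
qed

lemma Ck_on_bilinear_comp:
  assumes "bounded_bilinear B"
  shows "Ck_on k f S \<Longrightarrow> Ck_on k g S \<Longrightarrow> Ck_on k (\<lambda>x. B (f x) (g x)) S"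
proof (induction k arbitrary: f g)
  case 0
  then show ?case
    using assms by (auto intro: bounded_bilinear.continuous_on)
next
  case (Suc k)
  obtain D where D: "\<And>x. x\<in>S \<Longrightarrow> (f has_derivative D x) (at x)"
    "\<And>v. Ck_on k (\<lambda>x. D x v) S" using Suc.prems(1) by auto
  obtain E where E: "\<And>x. x\<in>S \<Longrightarrow> (g has_derivative E x) (at x)"
    "\<And>v. Ck_on k (\<lambda>x. E x v) S" using Suc.prems(2) by auto
  show ?case
  proof (rule Ck_on_SucI[where D="\<lambda>x v. B (f x) (E x v) + B (D x v) (g x)"])
    show "((\<lambda>x. B (f x) (g x)) has_derivative (\<lambda>v. B (f x) (E x v) + B (D x v) (g x))) (at x)"
      if "x \<in> S" for x
      using D(1)[OF that] E(1)[OF that] by (rule bounded_bilinear.FDERIV[OF assms])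
    show "Ck_on k (\<lambda>x. B (f x) (E x v) + B (D x v) (g x)) S" for v
      by (intro Ck_on_add Suc.IH Ck_on_pred[OF Suc.prems(1)] Ck_on_pred[OF Suc.prems(2)] D E)
  qed
qed

lemma Ck_on_compose_linear:
  assumes L: "bounded_linear L" and sub: "L ` S \<subseteq> T"
  shows "Ck_on k f T \<Longrightarrow> Ck_on k (\<lambda>x. f (L x)) S"
proof (induction k arbitrary: f)
  case 0
  then have "continuous_on T f" by simp
  from continuous_on_compose2[OF this bounded_linear.continuous_on[OF L continuous_on_id] sub]
  show ?case by simp
next
  case (Suc k)
  then obtain D where D: "\<And>x. x\<in>T \<Longrightarrow> (f has_derivative D x) (at x)"
    "\<And>v. Ck_on k (\<lambda>x. D x v) T" by auto
  show ?case
  proof (rule Ck_on_SucI[where D="\<lambda>x v. D (L x) (L v)"])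
    show "((\<lambda>x. f (L x)) has_derivative (\<lambda>v. D (L x) (L v))) (at x)" if "x \<in> S" for x
      using has_derivative_compose[OF bounded_linear_imp_has_derivative[OF L] D(1)] that sub
      by auto
    show "Ck_on k (\<lambda>x. D (L x) (L v)) S" for v
      by (rule Suc.IH[OF D(2)])
  qed
qed

lemmas Ck_on_scaleR = Ck_on_bilinear_comp[OF bounded_bilinear_scaleR]
lemmas Ck_on_inner = Ck_on_bilinear_comp[OF bounded_bilinear_inner]
lemmas Ck_on_nth = Ck_on_linear_comp[OF bounded_linear_vec_nth]

lemma Ck_on_mult:
  fixes f g :: "_ \<Rightarrow> real"
  shows "Ck_on k f S \<Longrightarrow> Ck_on k g S \<Longrightarrow> Ck_on k (\<lambda>x. f x * g x) S"
  by (rule Ck_on_bilinear_comp[OF bounded_bilinear_mult])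

lemma Ck_on_diff:
  "Ck_on k f S \<Longrightarrow> Ck_on k g S \<Longrightarrow> Ck_on k (\<lambda>x. f x - g x) S"
  using Ck_on_add[of k f S "\<lambda>x. - g x"] Ck_on_linear_comp[OF bounded_linear_minus[OF bounded_linear_ident], of k g S]
  by simp

lemma Ck_on_power2:
  fixes f :: "_ \<Rightarrow> real"
  shows "Ck_on k f S \<Longrightarrow> Ck_on k (\<lambda>x. (f x)\<^sup>2) S"
  unfolding power2_eq_square by (rule Ck_on_mult)

text \<open>The exponent varies in the induction, because each differentiation lowers it by one.\<close>

lemma Ck_on_powr:
  fixes f :: "_ \<Rightarrow> real"
  assumes "\<And>x. x \<in> S \<Longrightarrow> f x > 0"
  shows "Ck_on k f S \<Longrightarrow> Ck_on k (\<lambda>x. f x powr r) S"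
proof (induction k arbitrary: r)
  case 0
  have "\<forall>x\<in>S. f x \<noteq> 0" using assms by force
  then show ?case using 0 by (simp add: continuous_on_powr continuous_on_const)
next
  case (Suc k)
  obtain D where D: "\<And>x. x\<in>S \<Longrightarrow> (f has_derivative D x) (at x)"
    "\<And>v. Ck_on k (\<lambda>x. D x v) S" using Suc.prems by auto
  show ?case
  proof (rule Ck_on_SucI[where D="\<lambda>x v. r * f x powr (r - 1) * D x v"])
    show "((\<lambda>x. f x powr r) has_derivative (\<lambda>v. r * f x powr (r - 1) * D x v)) (at x)" if "x \<in> S" for x
    proof -
      have "((\<lambda>y. y powr r) has_derivative (\<lambda>h. r * f x powr (r - 1) * h)) (at (f x))"
        using has_real_derivative_powr[OF assms[OF that], of r]
        by (simp add: has_field_derivative_def)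
      from has_derivative_compose[OF D(1)[OF that] this] show ?thesis .
    qed
    show "Ck_on k (\<lambda>x. r * f x powr (r - 1) * D x v) S" for v
      by (intro Ck_on_mult Ck_on_const Suc.IH Ck_on_pred[OF Suc.prems] D)
  qed
qed

text \<open>Division is reduced to a power of the positive function \<open>(g x)\<^sup>2\<close>, so that denominators
  of either sign are covered by \<open>Ck_on_powr\<close>.\<close>

lemma Ck_on_divide:
  fixes f g :: "_ \<Rightarrow> real"
  assumes "open S" "\<And>x. x \<in> S \<Longrightarrow> g x \<noteq> 0" "Ck_on k f S" "Ck_on k g S"
  shows "Ck_on k (\<lambda>x. f x / g x) S"
proof (rule Ck_on_cong_open[OF assms(1)])
  show "Ck_on k (\<lambda>x. f x * g x * ((g x)\<^sup>2) powr (-1)) S"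
    by (intro Ck_on_mult Ck_on_powr Ck_on_power2 assms) (use assms(2) in auto)
  show "f x * g x * ((g x)\<^sup>2) powr (-1) = f x / g x" if "x \<in> S" for x
    using assms(2)[OF that] by (simp add: powr_minus powr_one power2_eq_square field_simps)
qed

lemma Ck_on_id: "Ck_on k (\<lambda>x. x) S"
proof (cases k)
  case (Suc j)
  show ?thesis unfolding Suc by (rule Ck_on_SucI[where D="\<lambda>x v. v"]) (auto intro: Ck_on_const)
qed simp

lemmas Ck_on_fst = Ck_on_linear_comp[OF bounded_linear_fst Ck_on_id]
lemmas Ck_on_snd = Ck_on_linear_comp[OF bounded_linear_snd Ck_on_id]

lemma Ck_on_Pair:
  fixes f :: "'a::euclidean_space \<Rightarrow> 'b::real_normed_vector"
    and g :: "'a \<Rightarrow> 'c::real_normed_vector"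
  assumes "Ck_on k f S" "Ck_on k g S" shows "Ck_on k (\<lambda>x. (f x, g x)) S"
proof -
  have "bounded_linear (\<lambda>x::'b. (x, 0::'c))" "bounded_linear (\<lambda>x::'c. (0::'b, x))"
    by (intro bounded_linear_Pair bounded_linear_ident bounded_linear_zero)+
  from Ck_on_add[OF Ck_on_linear_comp[OF this(1) assms(1)] Ck_on_linear_comp[OF this(2) assms(2)]]
  show ?thesis by simp
qed

lemma C2_curve_derivatives:
  fixes f :: "real \<Rightarrow> 'a::real_normed_vector"
  assumes "Ck_on 2 f J"
  obtains f1 f2 where "\<And>t. t \<in> J \<Longrightarrow> (f has_vector_derivative f1 t) (at t)"
    "\<And>t. t \<in> J \<Longrightarrow> (f1 has_vector_derivative f2 t) (at t)" "continuous_on J f2"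
proof -
  have lin: "(g has_vector_derivative D 1) F" if "(g has_derivative D) F" for g::"real \<Rightarrow> 'a" and D F
  proof -
    have "D = (\<lambda>h. h *\<^sub>R D 1)"
      using linear_scale[OF has_derivative_linear[OF that], of h 1 for h] by (intro ext) (metis mult.right_neutral real_scaleR_def)
    with that show ?thesis by (simp add: has_vector_derivative_def)
  qed
  obtain D where D: "\<And>t. t \<in> J \<Longrightarrow> (f has_derivative D t) (at t)" "\<And>v. Ck_on (Suc 0) (\<lambda>t. D t v) J"
    by (rule Ck_on_SucE[OF assms[unfolded numeral_2_eq_2]]) (rule that)
  obtain E where E: "\<And>t. t \<in> J \<Longrightarrow> ((\<lambda>t. D t 1) has_derivative E t) (at t)"
      "\<And>v. Ck_on 0 (\<lambda>t. E t v) J"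
    by (rule Ck_on_SucE[OF D(2)]) (rule that)
  show ?thesis
    by (rule that[OF lin[OF D(1)] lin[OF E(1)] E(2)[unfolded Ck_on.simps]])
qed

lemma C2_curveI:
  fixes f :: "real \<Rightarrow> 'a::real_normed_vector"
  assumes "\<And>t. t \<in> J \<Longrightarrow> (f has_vector_derivative f1 t) (at t)"
    "\<And>t. t \<in> J \<Longrightarrow> (f1 has_vector_derivative f2 t) (at t)" "continuous_on J f2"
  shows "Ck_on 2 f J"
  unfolding numeral_2_eq_2
proof (rule Ck_on_SucI[where D="\<lambda>t h. h *\<^sub>R f1 t"])
  show "Ck_on (Suc 0) (\<lambda>x. v *\<^sub>R f1 x) J" for v
  proof (rule Ck_on_SucI[where D="\<lambda>t h. h *\<^sub>R v *\<^sub>R f2 t"])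
    show "((\<lambda>x. v *\<^sub>R f1 x) has_derivative (\<lambda>h. h *\<^sub>R v *\<^sub>R f2 t)) (at t)" if "t \<in> J" for t
      using bounded_linear.has_vector_derivative[OF bounded_linear_scaleR_right assms(2)[OF that]]
      by (simp add: has_vector_derivative_def)
  qed (use assms(3) in \<open>auto intro!: continuous_intros\<close>)
qed (use assms in \<open>auto simp: has_vector_derivative_def\<close>)

section \<open>Symmetry of mixed partial derivatives\<close>

lemma continuous_on_slices:
  assumes "continuous_on (A \<times> J) (\<lambda>(s, t). g s t)"
  shows "B \<subseteq> A \<Longrightarrow> t \<in> J \<Longrightarrow> continuous_on B (\<lambda>s. g s t)"
    and "s \<in> A \<Longrightarrow> K \<subseteq> J \<Longrightarrow> continuous_on K (\<lambda>t. g s t)"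
    and "B \<subseteq> A \<Longrightarrow> K \<subseteq> J \<Longrightarrow> continuous_on (K \<times> B) (\<lambda>(t, s). g s t)"
    and "B \<subseteq> A \<Longrightarrow> K \<subseteq> J \<Longrightarrow> continuous_on (B \<times> K) (\<lambda>(s, t). g s t)"
proof -
  show "continuous_on B (\<lambda>s. g s t)" if "B \<subseteq> A" "t \<in> J"
    using continuous_on_compose2[OF assms, of B "\<lambda>s. (s, t)"] that
    by (simp add: continuous_on_Pair image_subset_iff subset_eq)
  show "continuous_on K (\<lambda>t. g s t)" if "s \<in> A" "K \<subseteq> J"
    using continuous_on_compose2[OF assms, of K "\<lambda>t. (s, t)"] that
    by (simp add: continuous_on_Pair image_subset_iff subset_eq)
  show "continuous_on (K \<times> B) (\<lambda>(t, s). g s t)" if "B \<subseteq> A" "K \<subseteq> J"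
  proof -
    have "prod.swap ` (K \<times> B) \<subseteq> A \<times> J" using that by auto
    from continuous_on_compose2[OF assms continuous_on_swap this]
    show ?thesis by (simp add: case_prod_beta')
  qed
  show "continuous_on (B \<times> K) (\<lambda>(s, t). g s t)" if "B \<subseteq> A" "K \<subseteq> J"
    by (rule continuous_on_subset[OF assms]) (use that in auto)
qed

text \<open>Both mixed derivatives are the same function. Indeed \<open>f x t - f (s - d) t\<close> is the integral of
  \<open>fs\<close> over \<open>{s - d..x}\<close>; differentiating first in \<open>t\<close> under the integral sign and then in the
  upper limit \<open>x\<close> gives the derivative of \<open>ft\<close> on one side and that of \<open>fs\<close> on the other.\<close>

lemma C2_partial_derivatives:
  fixes f :: "real \<Rightarrow> real \<Rightarrow> 'a::banach"
  assumes C2: "Ck_on 2 (\<lambda>(s, t). f s t) (A \<times> J)" and A: "open A" and J: "open J"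
  obtains fs ft fm where
    "\<And>s t. s \<in> A \<Longrightarrow> t \<in> J \<Longrightarrow> ((\<lambda>s. f s t) has_vector_derivative fs s t) (at s)"
    "\<And>s t. s \<in> A \<Longrightarrow> t \<in> J \<Longrightarrow> ((\<lambda>t. f s t) has_vector_derivative ft s t) (at t)"
    "\<And>s t. s \<in> A \<Longrightarrow> t \<in> J \<Longrightarrow> ((\<lambda>s. ft s t) has_vector_derivative fm s t) (at s)"
    "\<And>s t. s \<in> A \<Longrightarrow> t \<in> J \<Longrightarrow> ((\<lambda>t. fs s t) has_vector_derivative fm s t) (at t)"
    "continuous_on (A \<times> J) (\<lambda>(s, t). fs s t)"
    "continuous_on (A \<times> J) (\<lambda>(s, t). ft s t)"
    "continuous_on (A \<times> J) (\<lambda>(s, t). fm s t)"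
proof -
  have part1: "((\<lambda>s. g (s, t)) has_vector_derivative D (1, 0)) (at s)"
   and part2: "((\<lambda>t. g (s, t)) has_vector_derivative D (0, 1)) (at t)"
    if g: "(g has_derivative D) (at (s, t))" for g :: "real \<times> real \<Rightarrow> 'a" and D s t
  proof -
    have "((\<lambda>s. (s, t)) has_derivative (\<lambda>h. (h, 0))) (at s)"
      by (intro has_derivative_Pair has_derivative_ident has_derivative_const)
    from has_derivative_compose[OF this g]
    have "((\<lambda>s. g (s, t)) has_derivative (\<lambda>h. D (h, 0))) (at s)" .
    moreover have "(\<lambda>h. D (h, 0)) = (\<lambda>h. h *\<^sub>R D (1, 0))"
    proof
      show "D (h, 0) = h *\<^sub>R D (1, 0)" for h
        using linear_scale[OF has_derivative_linear[OF g], of h "(1, 0)"] by simp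
    qed
    ultimately show "((\<lambda>s. g (s, t)) has_vector_derivative D (1, 0)) (at s)"
      by (simp add: has_vector_derivative_def)
    have "((\<lambda>t. (s, t)) has_derivative (\<lambda>h. (0, h))) (at t)"
      by (intro has_derivative_Pair has_derivative_ident has_derivative_const)
    from has_derivative_compose[OF this g]
    have "((\<lambda>t. g (s, t)) has_derivative (\<lambda>h. D (0, h))) (at t)" .
    moreover have "(\<lambda>h. D (0, h)) = (\<lambda>h. h *\<^sub>R D (0, 1))"
    proof
      show "D (0, h) = h *\<^sub>R D (0, 1)" for h
        using linear_scale[OF has_derivative_linear[OF g], of h "(0, 1)"] by simp
    qed
    ultimately show "((\<lambda>t. g (s, t)) has_vector_derivative D (0, 1)) (at t)"
      by (simp add: has_vector_derivative_def)
  qed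
  obtain D where D: "\<And>x. x \<in> A \<times> J \<Longrightarrow> ((\<lambda>(s, t). f s t) has_derivative D x) (at x)"
      "\<And>v. Ck_on (Suc 0) (\<lambda>x. D x v) (A \<times> J)"
    by (rule Ck_on_SucE[OF C2[unfolded numeral_2_eq_2]]) (rule that)
  have "\<exists>E. (\<forall>x\<in>A \<times> J. ((\<lambda>x. D x v) has_derivative E x) (at x)) \<and>
      (\<forall>w. continuous_on (A \<times> J) (\<lambda>x. E x w))" for v
    using D(2)[of v] unfolding Ck_on.simps by blast
  then obtain E where E0: "\<And>v. (\<forall>x\<in>A \<times> J. ((\<lambda>x. D x v) has_derivative E v x) (at x)) \<and>
      (\<forall>w. continuous_on (A \<times> J) (\<lambda>x. E v x w))"
    by metis
  then have E: "\<And>v x. x \<in> A \<times> J \<Longrightarrow> ((\<lambda>x. D x v) has_derivative E v x) (at x)"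
      "\<And>v w. continuous_on (A \<times> J) (\<lambda>x. E v x w)"
    by blast+
  define fs where "fs s t = D (s, t) (1, 0)" for s t
  define ft where "ft s t = D (s, t) (0, 1)" for s t
  define fts where "fts s t = E (0, 1) (s, t) (1, 0)" for s t
  define fm where "fm s t = E (1, 0) (s, t) (0, 1)" for s t
  have d1: "((\<lambda>s. f s t) has_vector_derivative fs s t) (at s)"
   and d2: "((\<lambda>t. f s t) has_vector_derivative ft s t) (at t)"
   and d3: "((\<lambda>s. ft s t) has_vector_derivative fts s t) (at s)"
   and d4: "((\<lambda>t. fs s t) has_vector_derivative fm s t) (at t)" if "s \<in> A" "t \<in> J" for s t
    using part1[OF D(1), of s t] part2[OF D(1), of s t]
      part1[OF E(1), of s t] part2[OF E(1), of s t] that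
    unfolding fs_def ft_def fm_def fts_def by simp_all
  have Ecs: "continuous_on (A \<times> J) (\<lambda>(s, t). fs s t)" "continuous_on (A \<times> J) (\<lambda>(s, t). ft s t)"
    using Ck_on_imp_continuous_on[OF D(2)] by (auto simp: fs_def ft_def case_prod_beta')
  have Ec: "continuous_on (A \<times> J) (\<lambda>(s, t). fm s t)" "continuous_on (A \<times> J) (\<lambda>(s, t). fts s t)"
    using E(2) by (auto simp: fm_def fts_def case_prod_beta')
  have "fts s t = fm s t" if st: "s \<in> A" "t \<in> J" for s t
  proof -
    obtain d where d: "d > 0" "cball s d \<subseteq> A" using A st open_contains_cball by blast
    obtain e where e: "e > 0" "cball t e \<subseteq> J" using J st open_contains_cball by blast
    define U where "U = {t - e<..<t + e}"
    have I: "{s - d..s + d} \<subseteq> A" and V: "U \<subseteq> J"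
      using d e by (auto simp: U_def dist_real_def subset_eq)
    have FTC: "integral {s - d..x} (\<lambda>x. fs x y) = f x y - f (s - d) y"
      if "x \<in> {s - d..s + d}" "y \<in> U" for x y
    proof (rule integral_unique[OF fundamental_theorem_of_calculus])
      show "((\<lambda>x. f x y) has_vector_derivative fs r y) (at r within {s - d..x})"
        if "r \<in> {s - d..x}" for r
        by (rule has_vector_derivative_at_within, rule d1) (use that \<open>x \<in> _\<close> \<open>y \<in> U\<close> I V in auto)
    qed (use that in auto)
    have G: "((\<lambda>y. integral {s - d..x} (\<lambda>x. fs x y)) has_vector_derivative
            integral {s - d..x} (\<lambda>x. fm x t)) (at t)" if "x \<in> {s - d..s + d}" for x
    proof -
      have "((\<lambda>y. integral (cbox (s - d) x) (\<lambda>x. fs x y)) has_vector_derivative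
            integral (cbox (s - d) x) (\<lambda>x. fm x t)) (at t within U)"
      proof (rule leibniz_rule_vector_derivative[where U=U and fx="\<lambda>t x. fm x t"])
        show "((\<lambda>y. fs s' y) has_vector_derivative fm s' y) (at y within U)"
          if "y \<in> U" "s' \<in> cbox (s - d) x" for y s'
          by (rule has_vector_derivative_at_within, rule d4) (use that \<open>x \<in> _\<close> I V in auto)
        show "(\<lambda>x. fs x y) integrable_on cbox (s - d) x" if "y \<in> U" for y
          by (rule integrable_continuous, rule continuous_on_slices(1)[OF Ecs(1)])
            (use that \<open>x \<in> _\<close> I V in auto)
        show "continuous_on (U \<times> cbox (s - d) x) (\<lambda>(t, x). fm x t)"
          by (rule continuous_on_slices(3)[OF Ec(1) _ V]) (use \<open>x \<in> _\<close> I in auto)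
        show "t \<in> U" "convex U" using e by (auto simp: U_def)
      qed
      moreover have "at t within U = at t" by (rule at_within_open) (use e in \<open>auto simp: U_def\<close>)
      ultimately show ?thesis by simp
    qed
    have H: "integral {s - d..x} (\<lambda>x. fm x t) = ft x t - ft (s - d) t" if "x \<in> {s - d..s + d}" for x
    proof -
      have "((\<lambda>y. f x y - f (s - d) y) has_vector_derivative ft x t - ft (s - d) t) (at t)"
        by (intro has_vector_derivative_diff d2) (use that I st d in auto)
      moreover have "((\<lambda>y. f x y - f (s - d) y) has_vector_derivative
          integral {s - d..x} (\<lambda>x. fm x t)) (at t)"
      proof (rule has_vector_derivative_transform_within_open[OF G[OF that]])
        show "open U" "t \<in> U" using e by (auto simp: U_def)
      qed (use FTC[OF that] in auto)
      ultimately show ?thesis by (rule vector_derivative_unique_at[symmetric])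
    qed
    have "((\<lambda>x. integral {s - d..x} (\<lambda>x. fm x t)) has_vector_derivative fm s t) (at s within {s - d..s + d})"
    proof (rule integral_has_vector_derivative)
      show "continuous_on {s - d..s + d} (\<lambda>x. fm x t)"
        by (rule continuous_on_slices(1)[OF Ec(1) I st(2)])
    qed (use d in auto)
    then have "((\<lambda>x. ft x t - ft (s - d) t) has_vector_derivative fm s t) (at s within {s - d..s + d})"
      by (rule has_vector_derivative_transform[rotated 2]) (use H d in auto)
    moreover have "at s within {s - d..s + d} = at s"
      using d by (intro at_within_interior) auto
    ultimately have "((\<lambda>x. ft x t - ft (s - d) t) has_vector_derivative fm s t) (at s)" by simp
    moreover have "((\<lambda>x. ft x t - ft (s - d) t) has_vector_derivative fts s t) (at s)"
      using has_vector_derivative_diff[OF d3[OF st] has_vector_derivative_const] by simp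
    ultimately show ?thesis by (rule vector_derivative_unique_at[symmetric])
  qed
  then show ?thesis
    using that[of fs ft fm] d1 d2 d3 d4 Ecs Ec by simp
qed

section \<open>Rotations and angular velocities\<close>

text \<open>Transposes stay matrices, so that the rules for rotations keep applying to them.\<close>

declare transpose_matrix_vector [simp del]

lemma bounded_bilinear_matrix_mult:
  "bounded_bilinear ((**) :: real^'n^'m \<Rightarrow> real^'k^'n \<Rightarrow> real^'k^'m)"
  unfolding bilinear_conv_bounded_bilinear[symmetric] bilinear_def linear_iff
  by (simp add: vec_eq_iff matrix_matrix_mult_def sum.distrib algebra_simps sum_distrib_left)

lemma bounded_bilinear_matrix_vector:
  "bounded_bilinear ((*v) :: real^'n^'m \<Rightarrow> real^'n \<Rightarrow> real^'m)"
  unfolding bilinear_conv_bounded_bilinear[symmetric] bilinear_def linear_iff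
  by (simp add: vec_eq_iff matrix_vector_mult_def sum.distrib algebra_simps sum_distrib_left)

lemma matrix_vector_mult_minus [simp]: "A *v (- x) = - (A *v x)" for A :: "real^'n^'m"
  by (rule bounded_bilinear.minus_right[OF bounded_bilinear_matrix_vector])

lemma bounded_bilinear_cross3: "bounded_bilinear cross3"
  using bilinear_cross by (simp add: bilinear_conv_bounded_bilinear)

lemma bounded_linear_transpose: "bounded_linear (transpose :: real^'n^'m \<Rightarrow> real^'m^'n)"
  unfolding linear_conv_bounded_linear[symmetric] linear_iff
  by (simp add: vec_eq_iff transpose_def)

text \<open>The inverse of \<open>hat\<close>. On matrices that are not skew it reads off the skew part; being linear on the
  whole matrix space it commutes with differentiation.\<close>

definition vee :: "real^3^3 \<Rightarrow> real^3" where
  "vee M = (1/2) *\<^sub>R vector [M$3$2 - M$2$3, M$1$3 - M$3$1, M$2$1 - M$1$2]"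

lemma bounded_linear_vee: "bounded_linear vee"
  unfolding linear_conv_bounded_linear[symmetric] linear_iff
  by (simp add: vee_def vec_eq_iff forall_3 algebra_simps)

lemma hat_mult: "hat v *v w = cross3 v w"
proof -
  have "linear (cross3 v)"
    using bilinear_cross by (simp add: bilinear_def)
  then show ?thesis
    by (simp add: hat_def matrix_works)
qed

lemma hat_nth: "hat v $ i $ j = cross3 v (axis j 1) $ i"
  by (simp add: hat_def matrix_def)

lemma hat_components:
  "hat v $ 1 $ 1 = 0" "hat v $ 1 $ 2 = - v $ 3" "hat v $ 1 $ 3 = v $ 2"
  "hat v $ 2 $ 1 = v $ 3" "hat v $ 2 $ 2 = 0" "hat v $ 2 $ 3 = - v $ 1"
  "hat v $ 3 $ 1 = - v $ 2" "hat v $ 3 $ 2 = v $ 1" "hat v $ 3 $ 3 = 0"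
  by (simp_all add: hat_nth cross3_def axis_def)

lemma bounded_linear_hat: "bounded_linear hat"
  unfolding linear_conv_bounded_linear[symmetric] linear_iff
  by (simp add: vec_eq_iff forall_3 hat_components algebra_simps)

lemma vee_hat [simp]: "vee (hat v) = v"
  by (simp add: vee_def vec_eq_iff forall_3 hat_components)

lemma hat_inject: "hat v = hat w \<longleftrightarrow> v = w"
  by (metis vee_hat)

lemma hat_vee_skew:
  assumes "transpose M = - M"
  shows "hat (vee M) = M"
proof -
  have M: "M $ j $ i = - M $ i $ j" for i j
    using arg_cong[OF assms, of "\<lambda>A. A $ i $ j"] by (simp add: transpose_def)
  have "M $ 1 $ 1 = 0" "M $ 2 $ 2 = 0" "M $ 3 $ 3 = 0"
    using M[of 1 1] M[of 2 2] M[of 3 3] by auto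
  then show ?thesis
    using M[of 1 2] M[of 1 3] M[of 2 3]
    by (simp add: vec_eq_iff forall_3 hat_components vee_def)
qed

lemma transpose_hat: "transpose (hat v) = - hat v"
  by (simp add: vec_eq_iff forall_3 transpose_def hat_components)

text \<open>The Lie bracket of the rotation group is the cross product.\<close>

lemma vee_commutator: "vee (hat v ** hat w - hat w ** hat v) = cross3 v w"
  by (simp add: vec_eq_iff forall_3 vee_def matrix_matrix_mult_def sum_3 hat_components cross3_def)

lemma rotation_matrix_transpose:
  assumes "rotation_matrix R"
  shows "transpose R ** R = mat 1" "R ** transpose R = mat 1"
  using assms by (auto simp: rotation_matrix_def orthogonal_matrix_def)

lemma rotation_matrix_inv:
  assumes "rotation_matrix R"
  shows "matrix_inv R = transpose R"
  unfolding matrix_inv_def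
proof (rule some_equality)
  show "A' = transpose R" if "R ** A' = mat 1 \<and> A' ** R = mat 1" for A'
    by (metis rotation_matrix_transpose[OF assms] that matrix_mul_assoc matrix_mul_lid matrix_mul_rid)
qed (use rotation_matrix_transpose[OF assms] in auto)

lemma matrix_inner_left: "(A *v v) \<bullet> w = v \<bullet> (transpose A *v w)" for A :: "real^'n^'m"
  using dot_lmul_matrix[of v "transpose A" w] by simp

lemma rotation_transpose_vector [simp]:
  assumes "rotation_matrix R"
  shows "transpose R *v (R *v v) = v" "R *v (transpose R *v v) = v"
  by (simp_all add: matrix_vector_mul_assoc rotation_matrix_transpose[OF assms])

lemma rotation_inner:
  fixes R :: "real^'n^'n"
  assumes "rotation_matrix R"
  shows "(R *v v) \<bullet> (R *v w) = v \<bullet> w"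
  unfolding matrix_inner_left rotation_transpose_vector[OF assms] ..

lemma rotation_norm:
  fixes R :: "real^'n^'n"
  assumes "rotation_matrix R"
  shows "norm (R *v v) = norm v"
  by (simp add: norm_eq_sqrt_inner rotation_inner[OF assms])

lemma rotation_left_cancel:
  assumes "rotation_matrix R"
  shows "R ** A = R ** B \<longleftrightarrow> A = B"
proof
  assume "R ** A = R ** B"
  from arg_cong[OF this, of "(**) (transpose R)"] show "A = B"
    by (simp add: matrix_mul_assoc rotation_matrix_transpose[OF assms])
qed simp

lemma rotation_hat_conj:
  assumes "rotation_matrix R"
  shows "R ** hat v ** transpose R = hat (R *v v)"
proof -
  have "(R ** hat v ** transpose R) *v w = hat (R *v v) *v w" for w
    using cross_rotation_matrix[OF assms, of v "transpose R *v w"]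
    by (simp add: matrix_vector_mul_assoc[symmetric] hat_mult assms)
  then show ?thesis by (simp add: matrix_eq)
qed

text \<open>Since \<open>hat\<close> is injective, the descriptions that define the angular velocities are resolved as soon
  as the velocity is written in the form \<open>R ** hat v\<close>, which \<open>rotation_velocity\<close> below provides.\<close>

lemma body_angvel_eq:
  assumes "rotation_matrix R"
  shows "body_angvel R (R ** hat v) = v"
  unfolding body_angvel_def rotation_matrix_inv[OF assms]
  by (simp add: matrix_mul_assoc rotation_matrix_transpose[OF assms] hat_inject)

lemma space_angvel_eq:
  assumes "rotation_matrix R"
  shows "space_angvel R (R ** hat v) = R *v v"
  unfolding space_angvel_def rotation_matrix_inv[OF assms] rotation_hat_conj[OF assms]
  by (simp add: hat_inject)

lemma rubber_lagrangian_eq: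
  assumes "rotation_matrix R"
  shows "rubber_lagrangian a b \<mu> I q R q' (R ** hat v) =
    1/2 * (\<mu> * (1 + b/a)^2 * (q' \<bullet> q') + (inertia I *v v) \<bullet> v)"
  by (simp add: rubber_lagrangian_def body_angvel_eq[OF assms] dot_square_norm)

lemma rubber_constraints_eq:
  assumes "rotation_matrix R"
  shows "rubber_constraints a b q R q' (R ** hat v) \<longleftrightarrow>
    (1 + b/a) *\<^sub>R q' = (b/a) *\<^sub>R cross3 (R *v v) q \<and> (R *v v) \<bullet> q = 0"
  by (simp add: rubber_constraints_def space_angvel_eq[OF assms] Let_def)

lemma inertia_mult: "(inertia I *v v) $ i = I $ i * v $ i"
  by (simp add: inertia_def matrix_vector_mult_def if_distrib[of "\<lambda>x. x * _"] sum.delta cong: if_cong)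

lemma inertia_symmetric: "(inertia I *v v) \<bullet> w = v \<bullet> (inertia I *v w)"
  by (simp add: inner_vec_def inertia_mult mult.commute mult.left_commute)

lemmas has_vector_derivative_matrix_mult =
  bounded_bilinear.has_vector_derivative[OF bounded_bilinear_matrix_mult]
lemmas has_vector_derivative_matrix_vector =
  bounded_bilinear.has_vector_derivative[OF bounded_bilinear_matrix_vector]
lemmas has_vector_derivative_cross3 =
  bounded_bilinear.has_vector_derivative[OF bounded_bilinear_cross3]
lemmas has_vector_derivative_inner =
  bounded_bilinear.has_vector_derivative[OF bounded_bilinear_inner]
lemmas has_vector_derivative_transpose =
  bounded_linear.has_vector_derivative[OF bounded_linear_transpose]
lemmas has_vector_derivative_vee =
  bounded_linear.has_vector_derivative[OF bounded_linear_vee]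
lemmas has_vector_derivative_hat =
  bounded_linear.has_vector_derivative[OF bounded_linear_hat]

text \<open>Differentiating the constant \<open>transpose (R t) ** R t\<close> shows that \<open>transpose (R t) ** R'\<close> is skew.\<close>

lemma rotation_velocity:
  assumes "open J" "t \<in> J" and rot: "\<And>t. t \<in> J \<Longrightarrow> rotation_matrix (R t)"
    and R': "(R has_vector_derivative R') (at t)"
  shows "R' = R t ** hat (vee (transpose (R t) ** R'))"
proof -
  let ?M = "transpose (R t) ** R'"
  have "((\<lambda>t. transpose (R t) ** R t) has_vector_derivative ?M + transpose R' ** R t) (at t)"
    by (rule has_vector_derivative_matrix_mult[OF has_vector_derivative_transpose[OF R'] R'])
  moreover have "((\<lambda>t. transpose (R t) ** R t) has_vector_derivative 0) (at t)"
    by (rule has_vector_derivative_transform_within_open[OF has_vector_derivative_const[of "mat 1"] assms(1,2)])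
      (simp add: rotation_matrix_transpose[OF rot])
  ultimately have "?M + transpose R' ** R t = 0"
    by (rule vector_derivative_unique_at)
  then have "transpose ?M = - ?M"
    by (simp add: matrix_transpose_mul add_eq_0_iff)
  then have "hat (vee ?M) = ?M" by (rule hat_vee_skew)
  then show ?thesis
    using rotation_matrix_transpose(2)[OF rot[OF assms(2)]] by (simp add: matrix_mul_assoc)
qed

section \<open>The first variation of the action\<close>

lemma has_vector_derivative_const_on_open:
  assumes "open U" "x \<in> U" "\<And>y. y \<in> U \<Longrightarrow> f y = c" "(f has_vector_derivative d) (at x)"
  shows "d = 0"
proof -
  have "(f has_vector_derivative 0) (at x)"
    by (rule has_vector_derivative_transform_within_open[OF has_vector_derivative_const[of c] assms(1,2)])
      (simp add: assms(3))
  with assms(4) show ?thesis by (rule vector_derivative_unique_at)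
qed

lemma has_vector_derivative_cong_on_open:
  assumes "open U" "x \<in> U" "\<And>y. y \<in> U \<Longrightarrow> f y = g y"
    "(f has_vector_derivative d) (at x)" "(g has_vector_derivative e) (at x)"
  shows "d = e"
  using has_vector_derivative_transform_within_open[OF assms(4,1,2,3)] assms(5)
  by (rule vector_derivative_unique_at)

text \<open>With \<open>\<eta>\<close> and \<open>\<Omega>\<close> the body angular velocities in the directions of the variation parameter and of
  time, symmetry of the mixed derivatives of the attitude matrix becomes the zero curvature identity
  \<open>\<partial>\<^sub>s\<Omega> = \<partial>\<^sub>t\<eta> + \<Omega> \<times> \<eta>\<close>. It moves all derivatives of the variation into a total time derivative, which
  integrates to zero because the end points are fixed.\<close>

lemma first_variation:
  fixes Q :: "real \<Rightarrow> real \<Rightarrow> real^3" and S :: "real \<Rightarrow> real \<Rightarrow> real^3^3"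
  assumes J: "open J" "is_interval J" "t0 \<in> J" "t1 \<in> J" "t0 < t1" and e: "e > 0"
    and C2: "Ck_on 2 (\<lambda>(s, t). Q s t) ({-e<..<e} \<times> J)" "Ck_on 2 (\<lambda>(s, t). S s t) ({-e<..<e} \<times> J)"
    and rot: "\<And>s t. s \<in> {-e<..<e} \<Longrightarrow> t \<in> J \<Longrightarrow> rotation_matrix (S s t)"
    and base: "\<And>t. t \<in> J \<Longrightarrow> Q 0 t = q t \<and> S 0 t = R t"
    and ends: "\<And>s t. s \<in> {-e<..<e} \<Longrightarrow> t \<in> {t0, t1} \<Longrightarrow> Q s t = q t \<and> S s t = R t"
    and q1: "\<And>t. t \<in> J \<Longrightarrow> (q has_vector_derivative q1 t) (at t)"
    and q2: "\<And>t. t \<in> J \<Longrightarrow> (q1 has_vector_derivative q2 t) (at t)"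
    and R1: "\<And>t. t \<in> J \<Longrightarrow> (R has_vector_derivative R t ** hat (\<Omega> t)) (at t)"
    and \<Omega>1: "\<And>t. t \<in> J \<Longrightarrow> (\<Omega> has_vector_derivative \<Omega>1 t) (at t)"
  obtains \<xi> \<eta> where
    "\<And>t. t \<in> J \<Longrightarrow> ((\<lambda>s. Q s t) has_vector_derivative \<xi> t) (at 0)"
    "\<And>t. t \<in> J \<Longrightarrow> ((\<lambda>s. S s t) has_vector_derivative R t ** hat (\<eta> t)) (at 0)"
    "((\<lambda>s. rubber_action a b \<mu> I t0 t1 (Q s) (S s)) has_real_derivative
      - integral {t0..t1} (\<lambda>t. (\<mu> * (1 + b/a)^2) * (q2 t \<bullet> \<xi> t) +
          (inertia I *v \<Omega>1 t + cross3 (\<Omega> t) (inertia I *v \<Omega> t)) \<bullet> \<eta> t)) (at 0)"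
proof -
  define U where "U = {-e<..<e}"
  have U: "open U" "0 \<in> U" "convex U" using e by (auto simp: U_def)
  have T: "{t0..t1} \<subseteq> J" using J by (meson atLeastAtMost_iff mem_is_interval_1_I subsetI)
  note C2 = C2[folded U_def] and rot = rot[folded U_def] and ends = ends[folded U_def]
  obtain Qs Qt Qm where
    Qs: "\<And>s t. s \<in> U \<Longrightarrow> t \<in> J \<Longrightarrow> ((\<lambda>s. Q s t) has_vector_derivative Qs s t) (at s)" and
    Qt: "\<And>s t. s \<in> U \<Longrightarrow> t \<in> J \<Longrightarrow> ((\<lambda>t. Q s t) has_vector_derivative Qt s t) (at t)" and
    Qts: "\<And>s t. s \<in> U \<Longrightarrow> t \<in> J \<Longrightarrow> ((\<lambda>s. Qt s t) has_vector_derivative Qm s t) (at s)" and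
    Qst: "\<And>s t. s \<in> U \<Longrightarrow> t \<in> J \<Longrightarrow> ((\<lambda>t. Qs s t) has_vector_derivative Qm s t) (at t)" and
    Qc: "continuous_on (U \<times> J) (\<lambda>(s, t). Qs s t)" "continuous_on (U \<times> J) (\<lambda>(s, t). Qt s t)"
      "continuous_on (U \<times> J) (\<lambda>(s, t). Qm s t)"
    by (rule C2_partial_derivatives[OF C2(1) U(1) J(1)]) (rule that)
  obtain Ss St Sm where
    Ss: "\<And>s t. s \<in> U \<Longrightarrow> t \<in> J \<Longrightarrow> ((\<lambda>s. S s t) has_vector_derivative Ss s t) (at s)" and
    St: "\<And>s t. s \<in> U \<Longrightarrow> t \<in> J \<Longrightarrow> ((\<lambda>t. S s t) has_vector_derivative St s t) (at t)" and
    Sts: "\<And>s t. s \<in> U \<Longrightarrow> t \<in> J \<Longrightarrow> ((\<lambda>s. St s t) has_vector_derivative Sm s t) (at s)" and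
    Sst: "\<And>s t. s \<in> U \<Longrightarrow> t \<in> J \<Longrightarrow> ((\<lambda>t. Ss s t) has_vector_derivative Sm s t) (at t)" and
    Sc: "continuous_on (U \<times> J) (\<lambda>(s, t). Ss s t)" "continuous_on (U \<times> J) (\<lambda>(s, t). St s t)"
      "continuous_on (U \<times> J) (\<lambda>(s, t). Sm s t)"
    by (rule C2_partial_derivatives[OF C2(2) U(1) J(1)]) (rule that)
  have Sc0: "continuous_on (U \<times> J) (\<lambda>(s, t). S s t)"
    by (rule Ck_on_imp_continuous_on[OF C2(2)])
  define W where "W s t = vee (transpose (S s t) ** St s t)" for s t
  define N where "N s t = vee (transpose (S s t) ** Ss s t)" for s t
  define Ws where "Ws s t = vee (transpose (S s t) ** Sm s t + transpose (Ss s t) ** St s t)" for s t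
  define Nt where "Nt s t = vee (transpose (S s t) ** Sm s t + transpose (St s t) ** Ss s t)" for s t
  have St_eq: "St s t = S s t ** hat (W s t)" and Ss_eq: "Ss s t = S s t ** hat (N s t)"
    if "s \<in> U" "t \<in> J" for s t
    using rotation_velocity[OF J(1) that(2) _ St[OF that]] rotation_velocity[OF U(1) that(1) _ Ss[OF that]]
      rot that by (simp_all add: W_def N_def)
  have Ws: "((\<lambda>s. W s t) has_vector_derivative Ws s t) (at s)" if "s \<in> U" "t \<in> J" for s t
    unfolding W_def Ws_def
    by (intro has_vector_derivative_vee has_vector_derivative_matrix_mult has_vector_derivative_transpose
        Ss[OF that] Sts[OF that])
  have Nt: "((\<lambda>t. N s t) has_vector_derivative Nt s t) (at t)" if "s \<in> U" "t \<in> J" for s t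
    unfolding N_def Nt_def
    by (intro has_vector_derivative_vee has_vector_derivative_matrix_mult has_vector_derivative_transpose
        St[OF that] Sst[OF that])
  have zero_curvature: "Ws s t = Nt s t + cross3 (W s t) (N s t)" if "s \<in> U" "t \<in> J" for s t
  proof -
    have tr: "transpose (S s t ** hat v) ** (S s t ** hat w) = - (hat v ** hat w)" for v w
    proof -
      have "transpose (S s t ** hat v) ** (S s t ** hat w) =
          transpose (hat v) ** (transpose (S s t) ** S s t) ** hat w"
        by (simp add: matrix_transpose_mul matrix_mul_assoc)
      also have "\<dots> = (- hat v) ** hat w"
        by (simp add: rotation_matrix_transpose[OF rot[OF that]] transpose_hat)
      finally show ?thesis
        by (simp add: bounded_bilinear.minus_left[OF bounded_bilinear_matrix_mult])
    qed
    have "Ws s t - Nt s t = vee (transpose (Ss s t) ** St s t - transpose (St s t) ** Ss s t)"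
      unfolding Ws_def Nt_def linear_diff[OF bounded_linear.linear[OF bounded_linear_vee], symmetric] by simp
    also have "\<dots> = vee (hat (W s t) ** hat (N s t) - hat (N s t) ** hat (W s t))"
      unfolding St_eq[OF that] Ss_eq[OF that] tr by simp
    also have "\<dots> = cross3 (W s t) (N s t)" by (rule vee_commutator)
    finally show ?thesis by (simp add: algebra_simps)
  qed
  note cont_rules = bounded_bilinear.continuous_on[OF bounded_bilinear_matrix_mult]
    bounded_linear.continuous_on[OF bounded_linear_transpose] bounded_linear.continuous_on[OF bounded_linear_vee]
    bounded_linear.continuous_on[OF matrix_vector_mul_bounded_linear]
  have Wc: "continuous_on (U \<times> J) (\<lambda>(s, t). W s t)" "continuous_on (U \<times> J) (\<lambda>(s, t). Ws s t)"
    unfolding W_def Ws_def case_prod_beta'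
    by (intro cont_rules continuous_on_add Sc[unfolded case_prod_beta'] Sc0[unfolded case_prod_beta'])+
  define m where "m = \<mu> * (1 + b/a)^2"
  define L where "L s t = 1/2 * (m * (Qt s t \<bullet> Qt s t) + (inertia I *v W s t) \<bullet> W s t)" for s t
  define Ls where "Ls s t = m * (Qt s t \<bullet> Qm s t) + (inertia I *v W s t) \<bullet> Ws s t" for s t
  have Ls: "((\<lambda>s. L s t) has_vector_derivative Ls s t) (at s)" if "s \<in> U" "t \<in> J" for s t
  proof -
    note d = has_vector_derivative_inner[OF Qts[OF that] Qts[OF that]]
      has_vector_derivative_inner[OF
        bounded_linear.has_vector_derivative[OF matrix_vector_mul_bounded_linear Ws[OF that]] Ws[OF that], of "inertia I"]
    have "((\<lambda>s. L s t) has_vector_derivative 1/2 * (m * (Qt s t \<bullet> Qm s t + Qm s t \<bullet> Qt s t) +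
        ((inertia I *v W s t) \<bullet> Ws s t + (inertia I *v Ws s t) \<bullet> W s t))) (at s)"
      unfolding L_def
      by (intro has_vector_derivative_mult_right has_vector_derivative_add d)
    moreover have "1/2 * (m * (Qt s t \<bullet> Qm s t + Qm s t \<bullet> Qt s t) +
        ((inertia I *v W s t) \<bullet> Ws s t + (inertia I *v Ws s t) \<bullet> W s t)) = Ls s t"
      unfolding Ls_def using inertia_symmetric[of I "Ws s t" "W s t"]
      by (simp add: inner_commute algebra_simps)
    ultimately show ?thesis by simp
  qed
  have Lc: "continuous_on (U \<times> J) (\<lambda>(s, t). L s t)" "continuous_on (U \<times> J) (\<lambda>(s, t). Ls s t)"
    unfolding L_def Ls_def case_prod_beta'
    by (intro cont_rules continuous_on_add continuous_on_mult continuous_on_const continuous_on_inner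
        Qc[unfolded case_prod_beta'] Wc[unfolded case_prod_beta'])+
  have action: "rubber_action a b \<mu> I t0 t1 (Q s) (S s) = integral (cbox t0 t1) (L s)" if "s \<in> U" for s
    unfolding rubber_action_def box_real
  proof (rule integral_cong)
    fix t assume "t \<in> {t0..t1}"
    with T have t: "t \<in> J" by auto
    show "rubber_lagrangian a b \<mu> I (Q s t) (S s t) (vector_derivative (Q s) (at t))
        (vector_derivative (S s) (at t)) = L s t"
      unfolding vector_derivative_at[OF Qt[OF that t]] vector_derivative_at[OF St[OF that t]]
      unfolding St_eq[OF that t] rubber_lagrangian_eq[OF rot[OF that t]] L_def m_def by simp
  qed
  have "((\<lambda>s. integral (cbox t0 t1) (L s)) has_vector_derivative integral (cbox t0 t1) (Ls 0)) (at 0 within U)"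
  proof (rule leibniz_rule_vector_derivative)
    show "((\<lambda>s. L s t) has_vector_derivative Ls s t) (at s within U)" if "s \<in> U" "t \<in> cbox t0 t1" for s t
      by (rule has_vector_derivative_at_within, rule Ls) (use that T in auto)
    show "L s integrable_on cbox t0 t1" if "s \<in> U" for s
      by (rule integrable_continuous, rule continuous_on_slices(2)[OF Lc(1) that]) (use T in auto)
    show "continuous_on (U \<times> cbox t0 t1) (\<lambda>(s, t). Ls s t)"
      by (rule continuous_on_slices(4)[OF Lc(2)]) (use T in auto)
  qed (use U in auto)
  moreover have "at 0 within U = at 0" by (rule at_within_open[OF U(2,1)])
  ultimately have "((\<lambda>s. integral (cbox t0 t1) (L s)) has_vector_derivative integral (cbox t0 t1) (Ls 0)) (at 0)"
    by simp
  then have deriv: "((\<lambda>s. rubber_action a b \<mu> I t0 t1 (Q s) (S s)) has_vector_derivative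
      integral {t0..t1} (Ls 0)) (at 0)"
    unfolding box_real
    by (rule has_vector_derivative_transform_within_open[OF _ U(1,2)]) (simp add: action)
  have Qt0: "Qt 0 t = q1 t" if "t \<in> J" for t
    by (rule has_vector_derivative_cong_on_open[OF J(1) that _ Qt[OF U(2) that] q1[OF that]]) (use base in auto)
  have W0: "W 0 t = \<Omega> t" if "t \<in> J" for t
  proof -
    have "St 0 t = R t ** hat (\<Omega> t)"
      by (rule has_vector_derivative_cong_on_open[OF J(1) that _ St[OF U(2) that] R1[OF that]]) (use base in auto)
    then have "R t ** hat (W 0 t) = R t ** hat (\<Omega> t)" "rotation_matrix (R t)"
      using St_eq[OF U(2) that] base[OF that] rot[OF U(2) that] by simp_all
    then show ?thesis by (simp add: rotation_left_cancel hat_inject)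
  qed
  \<comment> \<open>\<open>K\<close> is the integrand of the claim, and \<open>P\<close> the boundary term of the integration by parts.\<close>
  define K where "K t = m * (q2 t \<bullet> Qs 0 t) +
      (inertia I *v \<Omega>1 t + cross3 (\<Omega> t) (inertia I *v \<Omega> t)) \<bullet> N 0 t" for t
  define P where "P t = m * (q1 t \<bullet> Qs 0 t) + (inertia I *v \<Omega> t) \<bullet> N 0 t" for t
  have P': "(P has_vector_derivative K t + Ls 0 t) (at t)" if "t \<in> J" for t
  proof -
    note d = has_vector_derivative_inner[OF q2[OF that] Qst[OF U(2) that]]
      has_vector_derivative_inner[OF
        bounded_linear.has_vector_derivative[OF matrix_vector_mul_bounded_linear \<Omega>1[OF that]]
        Nt[OF U(2) that], of "inertia I"]
    have "(P has_vector_derivative m * (q1 t \<bullet> Qm 0 t + q2 t \<bullet> Qs 0 t) +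
        ((inertia I *v \<Omega> t) \<bullet> Nt 0 t + (inertia I *v \<Omega>1 t) \<bullet> N 0 t)) (at t)"
      unfolding P_def
      by (intro has_vector_derivative_mult_right has_vector_derivative_add d)
    moreover have "(inertia I *v \<Omega> t) \<bullet> cross3 (\<Omega> t) (N 0 t) =
        - (cross3 (\<Omega> t) (inertia I *v \<Omega> t) \<bullet> N 0 t)"
      by (simp add: cross3_def inner_vec_def sum_3 algebra_simps)
    ultimately show ?thesis
      by (simp add: K_def Ls_def Qt0[OF that] W0[OF that] zero_curvature[OF U(2) that]
          inner_add_right inner_add_left algebra_simps)
  qed
  have Qs_ends: "Qs 0 t = 0" and N_ends: "N 0 t = 0" if "t \<in> {t0, t1}" for t
  proof -
    have t: "t \<in> J" using that J by auto
    show "Qs 0 t = 0"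
      by (rule has_vector_derivative_const_on_open[OF U(1,2) _ Qs[OF U(2) t]]) (use ends that in auto)
    have "Ss 0 t = 0"
      by (rule has_vector_derivative_const_on_open[OF U(1,2) _ Ss[OF U(2) t]]) (use ends that in auto)
    then show "N 0 t = 0"
      by (simp add: N_def bounded_bilinear.zero_right[OF bounded_bilinear_matrix_mult]
          linear_0[OF bounded_linear.linear[OF bounded_linear_vee]])
  qed
  have "((\<lambda>t. K t + Ls 0 t) has_integral P t1 - P t0) {t0..t1}"
  proof (rule fundamental_theorem_of_calculus)
    show "(P has_vector_derivative K t + Ls 0 t) (at t within {t0..t1})" if "t \<in> {t0..t1}" for t
      by (rule has_vector_derivative_at_within, rule P') (use that T in auto)
  qed (use J in auto)
  then have PI: "((\<lambda>t. K t + Ls 0 t) has_integral 0) {t0..t1}"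
    by (simp add: P_def Qs_ends N_ends)
  have "Ls 0 integrable_on {t0..t1}"
    by (rule integrable_continuous_real, rule continuous_on_slices(2)[OF Lc(2) U(2) T])
  then have "(Ls 0 has_integral integral {t0..t1} (Ls 0)) {t0..t1}"
    by (rule integrable_integral)
  from has_integral_diff[OF PI this]
  have "(K has_integral - integral {t0..t1} (Ls 0)) {t0..t1}" by simp
  then have "integral {t0..t1} (Ls 0) = - integral {t0..t1} K"
    by (simp add: integral_unique)
  with deriv have "((\<lambda>s. rubber_action a b \<mu> I t0 t1 (Q s) (S s)) has_real_derivative
      - integral {t0..t1} K) (at 0)"
    by (simp add: has_real_derivative_iff_has_vector_derivative)
  moreover have "((\<lambda>s. S s t) has_vector_derivative R t ** hat (N 0 t)) (at 0)" if "t \<in> J" for t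
    using Ss[OF U(2) that] Ss_eq[OF U(2) that] base[OF that] by simp
  ultimately show ?thesis
    using that[of "Qs 0" "N 0"] Qs[OF U(2)] unfolding K_def m_def by blast
qed

section \<open>The Lagrange--d'Alembert principle\<close>

definition outer :: "real^3 \<Rightarrow> real^3 \<Rightarrow> real^3^3" where
  "outer v w = (\<chi> i j. v $ i * w $ j)"

text \<open>The rotation with the unnormalised quaternion \<open>1 + u\<close>. It is rational in \<open>u\<close>, which makes the
  smoothness of the variations built from it a matter of sums, products and quotients.\<close>

definition cayley :: "real^3 \<Rightarrow> real^3^3" where
  "cayley u = (1 / (1 + u \<bullet> u)) *\<^sub>R ((1 - u \<bullet> u) *\<^sub>R mat 1 + 2 *\<^sub>R outer u u + 2 *\<^sub>R hat u)"

lemma bounded_bilinear_outer: "bounded_bilinear outer"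
  unfolding bilinear_conv_bounded_bilinear[symmetric] bilinear_def linear_iff outer_def
  by (simp add: vec_eq_iff algebra_simps)

lemma one_plus_inner_pos: "1 + u \<bullet> u > 0" for u :: "real^3"
  using inner_ge_zero[of u] by linarith

lemma rotation_matrix_cayley: "rotation_matrix (cayley u)"
proof -
  define n where "n = 1 + u \<bullet> u"
  define M where "M = (1 - u \<bullet> u) *\<^sub>R mat 1 + 2 *\<^sub>R outer u u + 2 *\<^sub>R hat u"
  have n: "n > 0" unfolding n_def by (rule one_plus_inner_pos)
  obtain x y z where u: "u $ 1 = x" "u $ 2 = y" "u $ 3 = z" by blast
  have uu: "u \<bullet> u = x\<^sup>2 + y\<^sup>2 + z\<^sup>2"
    by (simp add: inner_vec_def sum_3 u power2_eq_square)
  have M: "M $ 1 $ 1 = 1 + x\<^sup>2 - y\<^sup>2 - z\<^sup>2" "M $ 1 $ 2 = 2 * x * y - 2 * z" "M $ 1 $ 3 = 2 * x * z + 2 * y"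
    "M $ 2 $ 1 = 2 * x * y + 2 * z" "M $ 2 $ 2 = 1 + y\<^sup>2 - x\<^sup>2 - z\<^sup>2" "M $ 2 $ 3 = 2 * y * z - 2 * x"
    "M $ 3 $ 1 = 2 * x * z - 2 * y" "M $ 3 $ 2 = 2 * y * z + 2 * x" "M $ 3 $ 3 = 1 + z\<^sup>2 - x\<^sup>2 - y\<^sup>2"
    by (simp_all add: M_def outer_def hat_components mat_def uu u power2_eq_square)
  have nn: "n = 1 + x\<^sup>2 + y\<^sup>2 + z\<^sup>2" by (simp add: n_def uu)
  have MtM: "transpose M ** M = n\<^sup>2 *\<^sub>R mat 1"
    unfolding vec_eq_iff forall_3
    by (simp add: matrix_matrix_mult_def sum_3 transpose_def M nn mat_def)
      (intro conjI; algebra)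
  have detM: "det M = n ^ 3"
    unfolding det_3 M nn by algebra
  have C: "cayley u = (1 / n) *\<^sub>R M" by (simp add: cayley_def n_def M_def)
  have "transpose (cayley u) ** cayley u = (1 / n) *\<^sub>R (1 / n) *\<^sub>R (transpose M ** M)"
    unfolding C
    by (simp add: transpose_scalar bounded_bilinear.scaleR_left[OF bounded_bilinear_matrix_mult]
        bounded_bilinear.scaleR_right[OF bounded_bilinear_matrix_mult])
  also have "\<dots> = mat 1"
    unfolding MtM using n by (simp add: power2_eq_square)
  finally have "orthogonal_matrix (cayley u)" by (simp add: orthogonal_matrix)
  moreover have "det (cayley u) = (1 / n) ^ 3 * det M"
    unfolding C det_3 by (simp add: power3_eq_cube algebra_simps)
  then have "det (cayley u) = 1"
    using n by (simp add: detM power_divide)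
  ultimately show ?thesis by (simp add: rotation_matrix_def)
qed

lemma cayley_0: "cayley 0 = mat 1"
  by (simp add: cayley_def bounded_bilinear.zero_right[OF bounded_bilinear_outer]
      linear_0[OF bounded_linear.linear[OF bounded_linear_hat]])

lemma Ck_on_cayley:
  assumes "open S" "Ck_on k f S"
  shows "Ck_on k (\<lambda>x. cayley (f x)) S"
  unfolding cayley_def
  by (intro Ck_on_scaleR Ck_on_divide Ck_on_add Ck_on_diff Ck_on_inner Ck_on_const assms
      less_imp_neq[OF one_plus_inner_pos, symmetric] Ck_on_bilinear_comp[OF bounded_bilinear_outer]
      Ck_on_linear_comp[OF bounded_linear_hat])

lemma cayley_deriv_0: "((\<lambda>s. cayley ((s / 2) *\<^sub>R w)) has_vector_derivative hat w) (at 0)"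
proof -
  have eq: "cayley ((s / 2) *\<^sub>R w) = (1 / (1 + s\<^sup>2 / 4 * (w \<bullet> w))) *\<^sub>R
     ((1 - s\<^sup>2 / 4 * (w \<bullet> w)) *\<^sub>R mat 1 + (s\<^sup>2 / 2) *\<^sub>R outer w w + s *\<^sub>R hat w)" for s
    by (simp add: cayley_def bounded_bilinear.scaleR_left[OF bounded_bilinear_outer]
        bounded_bilinear.scaleR_right[OF bounded_bilinear_outer] power2_eq_square mult.assoc
        linear_scale[OF bounded_linear.linear[OF bounded_linear_hat]])
  have 1: "((\<lambda>s. 1 / (1 + s\<^sup>2 / 4 * (w \<bullet> w))) has_field_derivative 0) (at 0)"
    by (rule derivative_eq_intros refl | simp)+
  have 2: "((\<lambda>s. (1 - s\<^sup>2 / 4 * (w \<bullet> w)) *\<^sub>R mat 1 + (s\<^sup>2 / 2) *\<^sub>R outer w w + s *\<^sub>R hat w)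
      has_vector_derivative hat w) (at 0)"
    by (rule derivative_eq_intros refl | simp)+
  from has_vector_derivative_scaleR[OF 1 2] show ?thesis
    unfolding eq by simp
qed

lemma cross3_triple_self:
  assumes "norm g = 1" "g \<bullet> v = 0"
  shows "cross3 (cross3 g v) g = v" "cross3 (cross3 v g) g = - v"
proof -
  have g: "g \<bullet> g = 1" using assms(1) by (simp add: dot_square_norm)
  have "cross3 (cross3 g v) g = (g \<bullet> g) *\<^sub>R v - (g \<bullet> v) *\<^sub>R g"
    by (simp add: vec_eq_iff forall_3 cross3_def inner_vec_def sum_3 algebra_simps)
  then show 1: "cross3 (cross3 g v) g = v" using g assms(2) by simp
  show "cross3 (cross3 v g) g = - v"
    using 1 by (subst cross_skew[of v g]) simp
qed

text \<open>Here \<open>Z\<close> is the total torque in the body frame. An infinitesimal variation satisfies the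
  constraints iff \<open>\<eta>\<close> is orthogonal to the Poisson vector and \<open>\<xi>\<close> is determined by \<open>\<eta>\<close>, so that the first
  variation is minus the integral of \<open>\<eta> \<bullet> Z\<close>. To recover the pointwise condition from the principle, the attitude is rotated by a
  Cayley transform with axis \<open>v \<times> \<gamma>\<close>, weighted by \<open>(r - t0) * (t1 - r)\<close>. Since varied curves have to agree
  with the given one only at the two end points, and these can be chosen around any
  instant, this weight replaces a bump function.\<close>

lemma lagrange_dalembert_iff:
  fixes a b \<mu> :: real and I :: "real^3" and \<Omega> :: "real \<Rightarrow> real^3" and R :: "real \<Rightarrow> real^3^3"
  assumes J: "open J" "is_interval J" and a: "a > 0" "b \<noteq> - a"
    and C2: "Ck_on 2 q J" "Ck_on 2 R J"
    and conf: "\<And>t. t \<in> J \<Longrightarrow> config a (q t) (R t)"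
    and q1: "\<And>t. t \<in> J \<Longrightarrow> (q has_vector_derivative q1 t) (at t)"
    and q2: "\<And>t. t \<in> J \<Longrightarrow> (q1 has_vector_derivative q2 t) (at t)" "continuous_on J q2"
    and R1: "\<And>t. t \<in> J \<Longrightarrow> (R has_vector_derivative R t ** hat (\<Omega> t)) (at t)"
    and \<Omega>1: "\<And>t. t \<in> J \<Longrightarrow> (\<Omega> has_vector_derivative \<Omega>1 t) (at t)" "continuous_on J \<Omega>1"
  defines "Z \<equiv> \<lambda>t. (\<mu> * (1 + b/a) * (b/a)) *\<^sub>R (transpose (R t) *v cross3 (q t) (q2 t)) +
      (inertia I *v \<Omega>1 t + cross3 (\<Omega> t) (inertia I *v \<Omega> t))"
  shows "lagrange_dalembert a b \<mu> I J q R \<longleftrightarrow>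
    (\<forall>t\<in>J. \<forall>v. cross3 v (poisson a (q t) (R t)) \<bullet> Z t = 0)"
proof -
  define p where "p = 1 + b/a"
  define c where "c = b/a"
  \<comment> \<open>The constraints give the velocity of the contact point as \<open>\<kappa>\<close> times that of a rigid rotation.\<close>
  define \<kappa> where "\<kappa> = c / p"
  have p: "p \<noteq> 0" using a by (auto simp: p_def field_simps)
  have rot: "rotation_matrix (R t)" and nq: "norm (q t) = a" if "t \<in> J" for t
    using conf[OF that] by (auto simp: config_def)
  define g where "g t = poisson a (q t) (R t)" for t
  have q_eq: "q t = a *\<^sub>R (R t *v g t)" if "t \<in> J" for t
    using a rot[OF that]
    by (simp add: g_def poisson_def rotation_matrix_inv matrix_vector_mult_scaleR)
  have ng: "norm (g t) = 1" if "t \<in> J" for t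
  proof -
    have "norm (q t) = a * norm (g t)"
      unfolding q_eq[OF that] using a by (simp add: rotation_norm[OF rot[OF that]])
    then show ?thesis using nq[OF that] a by simp
  qed
  have power: "(\<mu> * p^2) * (q2 t \<bullet> (\<kappa> *\<^sub>R cross3 (R t *v v) (q t))) +
      (inertia I *v \<Omega>1 t + cross3 (\<Omega> t) (inertia I *v \<Omega> t)) \<bullet> v = v \<bullet> Z t" for t v
  proof -
    have "q2 t \<bullet> cross3 (R t *v v) (q t) = (R t *v v) \<bullet> cross3 (q t) (q2 t)"
      by (simp add: cross3_def inner_vec_def sum_3 algebra_simps)
    also have "\<dots> = v \<bullet> (transpose (R t) *v cross3 (q t) (q2 t))"
      by (rule matrix_inner_left)
    finally have "q2 t \<bullet> cross3 (R t *v v) (q t) = v \<bullet> (transpose (R t) *v cross3 (q t) (q2 t))" .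
    moreover have "\<mu> * p^2 * (\<kappa> * x) = \<mu> * p * c * x" for x
      using p by (simp add: \<kappa>_def power2_eq_square)
    moreover have "Z t = (\<mu> * p * c) *\<^sub>R (transpose (R t) *v cross3 (q t) (q2 t)) +
        (inertia I *v \<Omega>1 t + cross3 (\<Omega> t) (inertia I *v \<Omega> t))"
      by (simp add: Z_def p_def c_def)
    ultimately show ?thesis
      by (simp add: inner_add_right inner_commute)
  qed
  have variation: "\<exists>\<eta>. (\<forall>t\<in>{t0..t1}. g t \<bullet> \<eta> t = 0 \<and>
        ((\<lambda>s. S s t) has_vector_derivative R t ** hat (\<eta> t)) (at 0)) \<and>
      ((\<lambda>s. rubber_action a b \<mu> I t0 t1 (Q s) (S s)) has_real_derivative
        - integral {t0..t1} (\<lambda>t. \<eta> t \<bullet> Z t)) (at 0)"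
    if t: "t0 \<in> J" "t1 \<in> J" "t0 < t1" and e: "0 < e"
      and adm': "admissible_variation a b J q R t0 t1 e Q S" for t0 t1 e Q S
  proof -
    have T: "{t0..t1} \<subseteq> J" using J t by (meson atLeastAtMost_iff mem_is_interval_1_I subsetI)
    note adm = adm'[unfolded admissible_variation_def]
    obtain \<xi> \<eta> where \<xi>: "\<And>t. t \<in> J \<Longrightarrow> ((\<lambda>s. Q s t) has_vector_derivative \<xi> t) (at 0)"
      and \<eta>: "\<And>t. t \<in> J \<Longrightarrow> ((\<lambda>s. S s t) has_vector_derivative R t ** hat (\<eta> t)) (at 0)"
      and deriv: "((\<lambda>s. rubber_action a b \<mu> I t0 t1 (Q s) (S s)) has_real_derivative
         - integral {t0..t1} (\<lambda>t. (\<mu> * (1 + b/a)^2) * (q2 t \<bullet> \<xi> t) +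
        (inertia I *v \<Omega>1 t + cross3 (\<Omega> t) (inertia I *v \<Omega> t)) \<bullet> \<eta> t)) (at 0)"
      by (rule first_variation[OF J t e _ _ _ _ _ q1 q2(1) R1 \<Omega>1(1), of Q S])
        (use adm in \<open>auto simp: config_def\<close>)
    have *: "g t \<bullet> \<eta> t = 0 \<and> (\<mu> * (1 + b/a)^2) * (q2 t \<bullet> \<xi> t) +
        (inertia I *v \<Omega>1 t + cross3 (\<Omega> t) (inertia I *v \<Omega> t)) \<bullet> \<eta> t = \<eta> t \<bullet> Z t" if "t \<in> {t0..t1}" for t
    proof -
      have tJ: "t \<in> J" using that T by auto
      have "rubber_constraints a b (q t) (R t) (\<xi> t) (R t ** hat (\<eta> t))"
        using adm that
        unfolding vector_derivative_at[OF \<xi>[OF tJ], symmetric] vector_derivative_at[OF \<eta>[OF tJ], symmetric]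
        by blast
      then have c1: "p *\<^sub>R \<xi> t = c *\<^sub>R cross3 (R t *v \<eta> t) (q t)" and c2: "(R t *v \<eta> t) \<bullet> q t = 0"
        unfolding rubber_constraints_eq[OF rot[OF tJ]] by (auto simp: p_def c_def)
      have "\<xi> t = (1 / p) *\<^sub>R p *\<^sub>R \<xi> t" using p by simp
      also have "\<dots> = \<kappa> *\<^sub>R cross3 (R t *v \<eta> t) (q t)" unfolding c1 by (simp add: \<kappa>_def)
      finally have "\<xi> t = \<kappa> *\<^sub>R cross3 (R t *v \<eta> t) (q t)" .
      moreover have "g t \<bullet> \<eta> t = 0"
        using c2 a unfolding q_eq[OF tJ] by (simp add: rotation_inner[OF rot[OF tJ]] inner_commute)
      ultimately show ?thesis using power[of t "\<eta> t"] by (simp add: p_def)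
    qed
    have "integral {t0..t1} (\<lambda>t. (\<mu> * (1 + b/a)^2) * (q2 t \<bullet> \<xi> t) +
        (inertia I *v \<Omega>1 t + cross3 (\<Omega> t) (inertia I *v \<Omega> t)) \<bullet> \<eta> t) = integral {t0..t1} (\<lambda>t. \<eta> t \<bullet> Z t)"
      by (rule integral_cong) (use * in blast)
    with deriv * \<eta> T show ?thesis by (intro exI[of _ \<eta>]) auto
  qed
  show ?thesis unfolding g_def[symmetric]
  proof
    assume perp: "\<forall>t\<in>J. \<forall>v. cross3 v (g t) \<bullet> Z t = 0"
    show "lagrange_dalembert a b \<mu> I J q R"
      unfolding lagrange_dalembert_def
    proof (intro ballI allI impI)
      fix t0 t1 e :: real and Q S
      assume t: "t0 \<in> J" "t1 \<in> J" and e: "0 < e" and t01: "t0 < t1"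
        and adm: "admissible_variation a b J q R t0 t1 e Q S"
      obtain \<eta> where \<eta>: "\<And>t. t \<in> {t0..t1} \<Longrightarrow> g t \<bullet> \<eta> t = 0"
        and deriv: "((\<lambda>s. rubber_action a b \<mu> I t0 t1 (Q s) (S s)) has_real_derivative
          - integral {t0..t1} (\<lambda>t. \<eta> t \<bullet> Z t)) (at 0)"
        using variation[OF t t01 e adm] by blast
      have "\<eta> t \<bullet> Z t = 0" if "t \<in> {t0..t1}" for t
      proof -
        have "t \<in> J" using that t J by (meson atLeastAtMost_iff mem_is_interval_1_I)
        then show ?thesis
          using perp cross3_triple_self(1)[OF ng \<eta>[OF that]] by metis
      qed
      then have "integral {t0..t1} (\<lambda>t. \<eta> t \<bullet> Z t) = integral {t0..t1} (\<lambda>t. 0)"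
        by (intro integral_cong) simp
      with deriv show "((\<lambda>s. rubber_action a b \<mu> I t0 t1 (Q s) (S s)) has_real_derivative 0) (at 0)"
        by simp
    qed
  next
    assume LdA: "lagrange_dalembert a b \<mu> I J q R"
    have qc: "continuous_on J q" and Rc: "continuous_on J R"
      using C2 Ck_on_imp_continuous_on by blast+
    have \<Omega>c: "continuous_on J \<Omega>"
      using \<Omega>1(1) by (intro continuous_at_imp_continuous_on) (auto dest: has_vector_derivative_continuous)
    have g_eq: "g t = transpose (R t) *v (q t /\<^sub>R a)" if "t \<in> J" for t
      by (simp add: g_def poisson_def rotation_matrix_inv[OF rot[OF that]])
    have Rt2: "Ck_on 2 (\<lambda>t. transpose (R t)) J"
      by (rule Ck_on_linear_comp[OF bounded_linear_transpose C2(2)])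
    have g2: "Ck_on 2 g J"
    proof (rule Ck_on_cong_open[OF J(1) g_eq[symmetric]])
      show "Ck_on 2 (\<lambda>t. transpose (R t) *v (q t /\<^sub>R a)) J"
        by (intro Ck_on_bilinear_comp[OF bounded_bilinear_matrix_vector] Rt2 Ck_on_scaleR Ck_on_const C2)
    qed
    have gc: "continuous_on J g" by (rule Ck_on_imp_continuous_on[OF g2])
    have Zc: "continuous_on J Z"
      unfolding Z_def
      by (intro continuous_on_add continuous_on_scaleR continuous_on_const
          bounded_bilinear.continuous_on[OF bounded_bilinear_matrix_vector]
          bounded_linear.continuous_on[OF bounded_linear_transpose]
          bounded_bilinear.continuous_on[OF bounded_bilinear_cross3]
          qc Rc q2(2) \<Omega>c \<Omega>1(2))
    have nonpos: "cross3 v (g t) \<bullet> Z t \<le> 0" if tJ: "t \<in> J" for t v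
    proof (rule ccontr)
      define G where "G t = cross3 v (g t) \<bullet> Z t" for t
      assume "\<not> cross3 v (g t) \<bullet> Z t \<le> 0"
      then have Gt: "G t > 0" by (simp add: G_def)
      have Gc: "continuous_on J G"
        unfolding G_def
        by (intro continuous_on_inner bounded_bilinear.continuous_on[OF bounded_bilinear_cross3]
            continuous_on_const gc Zc)
      have "open {t \<in> J. G t > 0}"
        using continuous_open_preimage[OF Gc J(1), of "{0<..}"] by (simp add: vimage_def Int_def)
      then obtain d where d: "d > 0" "cball t d \<subseteq> {t \<in> J. G t > 0}"
        using tJ Gt open_contains_cball by (metis (mono_tags, lifting) mem_Collect_eq)
      define t0 where "t0 = t - d"
      define t1 where "t1 = t + d"
      have T: "{t0..t1} \<subseteq> {t \<in> J. G t > 0}"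
        using d by (auto simp: t0_def t1_def dist_real_def subset_eq)
      have "t0 \<in> {t0..t1}" "t1 \<in> {t0..t1}" using d by (auto simp: t0_def t1_def)
      with T have "t0 \<in> J" "t1 \<in> J" by blast+
      moreover have "t0 < t1" using d by (simp add: t0_def t1_def)
      ultimately have t01: "t0 < t1" "t0 \<in> J" "t1 \<in> J" by auto
      define \<phi> where "\<phi> r = (r - t0) * (t1 - r)" for r
      define w where "w r = \<phi> r *\<^sub>R (R r *v cross3 v (g r))" for r
      define Q where "Q s r = cayley ((s / 2) *\<^sub>R (\<kappa> *\<^sub>R w r)) *v q r" for s r
      define S where "S s r = cayley ((s / 2) *\<^sub>R w r) ** R r" for s r
      have S0: "((\<lambda>s. S s r) has_vector_derivative R r ** hat (\<phi> r *\<^sub>R cross3 v (g r))) (at 0)"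
        if r: "r \<in> J" for r
      proof -
        have "hat (w r) ** R r = R r ** hat (\<phi> r *\<^sub>R cross3 v (g r)) ** (transpose (R r) ** R r)"
          unfolding w_def matrix_vector_mult_scaleR[symmetric] rotation_hat_conj[OF rot[OF r], symmetric]
          by (simp add: matrix_mul_assoc)
        then have "hat (w r) ** R r = R r ** hat (\<phi> r *\<^sub>R cross3 v (g r))"
          by (simp add: rotation_matrix_transpose[OF rot[OF r]])
        then show ?thesis
          using has_vector_derivative_matrix_mult[OF cayley_deriv_0[of "w r"] has_vector_derivative_const[of "R r"]]
          by (simp add: S_def bounded_bilinear.zero_right[OF bounded_bilinear_matrix_mult])
      qed
      have Q0: "((\<lambda>s. Q s r) has_vector_derivative \<kappa> *\<^sub>R cross3 (R r *v (\<phi> r *\<^sub>R cross3 v (g r))) (q r)) (at 0)"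
        for r
        using has_vector_derivative_matrix_vector[OF cayley_deriv_0[of "\<kappa> *\<^sub>R w r"] has_vector_derivative_const[of "q r"]]
        by (simp add: Q_def w_def hat_mult cross_mult_left matrix_vector_mult_scaleR)
      have sub: "snd ` ({-1<..<1::real} \<times> J) \<subseteq> J" "open ({-1<..<1::real} \<times> J)"
        by (auto intro: open_Times[OF open_greaterThanLessThan J(1)])
      have w2: "Ck_on 2 w J"
        unfolding w_def \<phi>_def
        by (intro Ck_on_scaleR Ck_on_mult Ck_on_diff Ck_on_const Ck_on_id
            Ck_on_bilinear_comp[OF bounded_bilinear_matrix_vector] C2(2)
            Ck_on_bilinear_comp[OF bounded_bilinear_cross3] g2)
      have lift: "Ck_on 2 (\<lambda>x. f (snd x)) ({-1<..<1::real} \<times> J)" if "Ck_on 2 f J"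
        for f :: "real \<Rightarrow> 'z::real_normed_vector"
        by (rule Ck_on_compose_linear[OF bounded_linear_snd sub(1) that])
      have "admissible_variation a b J q R t0 t1 1 Q S"
        unfolding admissible_variation_def
      proof (intro conjI ballI)
        have half: "Ck_on 2 (\<lambda>x. fst x / 2) ({-1<..<1::real} \<times> J)"
          using Ck_on_mult[OF Ck_on_fst Ck_on_const[of 2 "1/2"]] by simp
        show "Ck_on 2 (\<lambda>(s, t). Q s t) ({- 1<..<1} \<times> J)"
          unfolding Q_def case_prod_beta'
          by (intro Ck_on_bilinear_comp[OF bounded_bilinear_matrix_vector] Ck_on_cayley Ck_on_scaleR
              Ck_on_const sub(2) half lift w2 C2(1))
        show "Ck_on 2 (\<lambda>(s, t). S s t) ({- 1<..<1} \<times> J)"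
          unfolding S_def case_prod_beta'
          by (intro Ck_on_bilinear_comp[OF bounded_bilinear_matrix_mult] Ck_on_cayley Ck_on_scaleR
              Ck_on_const sub(2) half lift w2 C2(2))
        show "config a (Q s r) (S s r)" if "r \<in> J" for s r
          using nq[OF that] rot[OF that] rotation_matrix_cayley[of "(s / 2) *\<^sub>R w r"]
          by (auto simp: config_def Q_def S_def rotation_norm[OF rotation_matrix_cayley] rotation_matrix_def det_mul orthogonal_matrix_mul)
        show "Q 0 r = q r" "S 0 r = R r" for r by (simp_all add: Q_def S_def cayley_0)
        show "Q s r = q r" "S s r = R r" if "r \<in> {t0, t1}" for s r
          using that by (auto simp: Q_def S_def w_def \<phi>_def cayley_0)
        show "rubber_constraints a b (q r) (R r) (vector_derivative (\<lambda>s. Q s r) (at 0))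
            (vector_derivative (\<lambda>s. S s r) (at 0))" if "r \<in> {t0..t1}" for r
        proof -
          have r: "r \<in> J" using that T by auto
          have "(R r *v cross3 v (g r)) \<bullet> (R r *v g r) = 0"
            unfolding rotation_inner[OF rot[OF r]] by (simp add: dot_cross_self)
          then have "(R r *v (\<phi> r *\<^sub>R cross3 v (g r))) \<bullet> q r = 0"
            unfolding q_eq[OF r] by (simp add: matrix_vector_mult_scaleR)
          then show ?thesis
            unfolding vector_derivative_at[OF Q0] vector_derivative_at[OF S0[OF r]]
              rubber_constraints_eq[OF rot[OF r]]
            unfolding p_def[symmetric] unfolding c_def[symmetric]
            using p by (simp add: \<kappa>_def)
        qed
      qed
      note adm = this
      note D0 = LdA[unfolded lagrange_dalembert_def, rule_format, OF t01(2,3) zero_less_one t01(1) adm]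
      obtain \<eta> where \<eta>: "\<And>r. r \<in> {t0..t1} \<Longrightarrow> ((\<lambda>s. S s r) has_vector_derivative R r ** hat (\<eta> r)) (at 0)"
        and deriv: "((\<lambda>s. rubber_action a b \<mu> I t0 t1 (Q s) (S s)) has_real_derivative
          - integral {t0..t1} (\<lambda>t. \<eta> t \<bullet> Z t)) (at 0)"
        using variation[OF t01(2,3,1) zero_less_one adm] by blast
      have "\<eta> r \<bullet> Z r = \<phi> r * G r" if r: "r \<in> {t0..t1}" for r
      proof -
        have rJ: "r \<in> J" using r T by blast
        have "R r ** hat (\<eta> r) = R r ** hat (\<phi> r *\<^sub>R cross3 v (g r))"
          by (rule vector_derivative_unique_at[OF \<eta>[OF r] S0[OF rJ]])
        then show ?thesis
          by (simp add: rotation_left_cancel[OF rot[OF rJ]] hat_inject G_def)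
      qed
      then have "integral {t0..t1} (\<lambda>t. \<eta> t \<bullet> Z t) = integral {t0..t1} (\<lambda>r. \<phi> r * G r)"
        by (rule integral_cong)
      with DERIV_unique[OF D0 deriv] have I0: "integral {t0..t1} (\<lambda>r. \<phi> r * G r) = 0" by simp
      have "continuous_on {t0..t1} G" by (rule continuous_on_subset[OF Gc]) (use T in auto)
      then have c: "continuous_on (cbox t0 t1) (\<lambda>r. \<phi> r * G r)"
        unfolding \<phi>_def by (auto intro!: continuous_intros)
      have "((\<lambda>r. \<phi> r * G r) has_integral 0) (cbox t0 t1)"
        using integrable_integral[OF integrable_continuous[OF c]] I0 by simp
      moreover have "0 \<le> \<phi> r * G r" if "r \<in> cbox t0 t1" for r
      proof -
        have "0 < G r" using that T unfolding box_real by blast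
        then show ?thesis using that by (simp add: \<phi>_def mult_nonneg_nonneg less_imp_le)
      qed
      ultimately have "\<phi> t * G t = 0"
        using c t01 d by (intro has_integral_0_cbox_imp_0[of t0 t1 "\<lambda>r. \<phi> r * G r"])
          (auto simp: t0_def t1_def)
      then show False using d Gt by (simp add: \<phi>_def t0_def t1_def)
    qed
    show "\<forall>t\<in>J. \<forall>v. cross3 v (g t) \<bullet> Z t = 0"
    proof (intro ballI allI)
      fix t v assume "t \<in> J"
      from nonpos[OF this, of v] nonpos[OF this, of "- v"]
      show "cross3 v (g t) \<bullet> Z t = 0" by simp
    qed
  qed
qed

section \<open>Linear differential equations on an open interval\<close>

lemma antiderivative_on_open_interval:
  fixes f :: "real \<Rightarrow> 'a::banach"
  assumes J: "open J" "is_interval J" "t0 \<in> J" and f: "continuous_on J f"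
  shows "\<exists>F. F t0 = 0 \<and> (\<forall>t\<in>J. (F has_vector_derivative f t) (at t))"
proof -
  define F where "F t = (if t0 \<le> t then integral {t0..t} f else - integral {t..t0} f)" for t
  have "(F has_vector_derivative f t) (at t)" if t: "t \<in> J" for t
  proof -
    obtain d where d: "d > 0" "cball t d \<subseteq> J" using J(1) t open_contains_cball by blast
    define u where "u = min t0 (t - d)"
    define v where "v = max t0 (t + d)"
    have "t - d \<in> J" "t + d \<in> J" using d by (auto simp: subset_eq dist_real_def)
    then have "u \<in> J" "v \<in> J" using J(3) by (auto simp: u_def v_def min_def max_def)
    then have uv: "{u..v} \<subseteq> J"
      using J(2) by (meson atLeastAtMost_iff mem_is_interval_1_I subsetI)
    have c: "continuous_on {u..v} f" using f uv continuous_on_subset by blast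
    have tuv: "u < t" "t < v" "u \<le> t0" "t0 \<le> v" using d by (auto simp: u_def v_def)
    have io: "f integrable_on {u..x}" if "x \<in> {u..v}" for x
      by (rule integrable_continuous_real, rule continuous_on_subset[OF c]) (use that in auto)
    have F_eq: "integral {u..x} f - integral {u..t0} f = F x" if x: "x \<in> {u<..<v}" for x
    proof (cases "t0 \<le> x")
      case True
      have "integral {u..t0} f + integral {t0..x} f = integral {u..x} f"
        by (rule Henstock_Kurzweil_Integration.integral_combine) (use True x tuv io in auto)
      with True show ?thesis by (simp add: F_def algebra_simps)
    next
      case False
      have "integral {u..x} f + integral {x..t0} f = integral {u..t0} f"
        by (rule Henstock_Kurzweil_Integration.integral_combine) (use False x tuv io in auto)
      with False show ?thesis by (simp add: F_def algebra_simps)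
    qed
    have "((\<lambda>x. integral {u..x} f) has_vector_derivative f t) (at t within {u..v})"
      by (rule integral_has_vector_derivative[OF c]) (use tuv in auto)
    then have "((\<lambda>x. integral {u..x} f) has_vector_derivative f t) (at t)"
      using tuv at_within_Icc_at by metis
    from has_vector_derivative_diff[OF this has_vector_derivative_const]
    have "((\<lambda>x. integral {u..x} f - integral {u..t0} f) has_vector_derivative f t) (at t)" by simp
    then show ?thesis
      by (rule has_vector_derivative_transform_within_open[of _ _ _ "{u<..<v}"])
        (use tuv F_eq in auto)
  qed
  moreover have "F t0 = 0" by (simp add: F_def)
  ultimately show ?thesis by blast
qed

text \<open>Picard iteration. The term \<open>X n\<close> of the resulting series is the \<open>n\<close>-fold iterated integral, which is
  at most \<open>norm x0 * (M * \<bar>t - t0\<bar>) ^ n / fact n\<close> on a compact interval where \<open>M\<close> bounds the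
  coefficient. Hence the series and its derivative converge uniformly on every compact subinterval, and the solution
  exists on the whole of \<open>J\<close>.\<close>

lemma linear_ode_exists:
  fixes prod :: "'a::banach \<Rightarrow> 'b::real_normed_vector \<Rightarrow> 'a"
  assumes bl: "bounded_bilinear prod"
    and J: "open J" "is_interval J" "t0 \<in> J" and A: "continuous_on J A"
  shows "\<exists>X. X t0 = x0 \<and> (\<forall>t\<in>J. (X has_vector_derivative prod (X t) (A t)) (at t))"
proof -
  \<comment> \<open>A choice of antiderivative avoids integrals with a sign.\<close>
  define anti where "anti f = (SOME F. F t0 = 0 \<and> (\<forall>t\<in>J. (F has_vector_derivative f t) (at t)))"
    for f :: "real \<Rightarrow> 'a"
  have anti: "anti f t0 = 0 \<and> (\<forall>t\<in>J. (anti f has_vector_derivative f t) (at t))"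
    if "continuous_on J f" for f :: "real \<Rightarrow> 'a"
    using someI_ex[OF antiderivative_on_open_interval[OF J that]] unfolding anti_def .
  define X where "X = rec_nat (\<lambda>t. x0) (\<lambda>n Y. anti (\<lambda>t. prod (Y t) (A t)))"
  have X_0: "X 0 = (\<lambda>t. x0)" and X_Suc: "X (Suc n) = anti (\<lambda>t. prod (X n t) (A t))" for n
    by (simp_all add: X_def)
  have Xc: "continuous_on J (X n)" for n
  proof (induction n)
    case (Suc n)
    have "continuous_on J (\<lambda>t. prod (X n t) (A t))"
      by (rule bounded_bilinear.continuous_on[OF bl Suc A])
    then have "\<forall>t\<in>J. (X (Suc n) has_vector_derivative prod (X n t) (A t)) (at t)"
      unfolding X_Suc using anti by blast
    then show ?case
      by (intro continuous_at_imp_continuous_on) (auto dest: has_vector_derivative_continuous)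
  qed (simp add: X_0)
  have X': "(X (Suc n) has_vector_derivative prod (X n t) (A t)) (at t)" if "t \<in> J" for n t
    unfolding X_Suc using anti[OF bounded_bilinear.continuous_on[OF bl Xc A]] that by blast
  have Xt0: "X (Suc n) t0 = 0" for n
    unfolding X_Suc using anti[OF bounded_bilinear.continuous_on[OF bl Xc A]] by blast
  obtain K where K: "K > 0" "\<And>x y. norm (prod x y) \<le> norm x * norm y * K"
    using bounded_bilinear.pos_bounded[OF bl] by blast
  define Y where "Y t = (\<Sum>n. X n t)" for t
  have Y: "(Y has_vector_derivative prod (Y t) (A t)) (at t)" if t: "t \<in> J" for t
  proof -
    obtain d where d: "d > 0" "cball t d \<subseteq> J" using J(1) t open_contains_cball by blast
    define u where "u = min t0 (t - d)"
    define v where "v = max t0 (t + d)"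
    have "t - d \<in> J" "t + d \<in> J" using d by (auto simp: subset_eq dist_real_def)
    then have "u \<in> J" "v \<in> J" using J(3) by (auto simp: u_def v_def min_def max_def)
    then have uv: "{u..v} \<subseteq> J"
      using J(2) by (meson atLeastAtMost_iff mem_is_interval_1_I subsetI)
    have tuv: "u < t" "t < v" "u \<le> t0" "t0 \<le> v" using d by (auto simp: u_def v_def)
    have "compact (A ` {u..v})"
      by (rule compact_continuous_image[OF continuous_on_subset[OF A uv]]) simp
    then obtain B where B: "B > 0" "\<And>s. s \<in> {u..v} \<Longrightarrow> norm (A s) \<le> B"
      using compact_imp_bounded bounded_pos by (metis imageI)
    define M where "M = K * B"
    have M: "M > 0" using K B by (simp add: M_def)
    have dnorm: "norm (prod x (A s)) \<le> M * norm x" if "s \<in> {u..v}" for x s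
    proof -
      have "norm (prod x (A s)) \<le> norm x * norm (A s) * K" by (rule K)
      also have "\<dots> \<le> norm x * B * K"
        using B(2)[OF that] K(1) by (intro mult_right_mono mult_left_mono) auto
      finally show ?thesis by (simp add: M_def mult.commute mult.left_commute)
    qed
    have bound: "norm (X n s) \<le> norm x0 * (M * \<bar>s - t0\<bar>) ^ n / fact n" if "s \<in> {u..v}" for n s
      using that
    proof (induction n arbitrary: s)
      case (Suc n)
      define C where "C = norm x0 * M ^ Suc n / fact n"
      have C: "M * (norm x0 * (M * r) ^ n / fact n) = C * r ^ n" for r
        by (simp add: C_def power_mult_distrib)
      have fin: "norm x0 * (M * r) ^ Suc n / fact (Suc n) = C * r ^ Suc n / real (Suc n)" for r
        by (simp add: C_def power_mult_distrib field_simps)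
      have nd: "norm (prod (X n r) (A r)) \<le> C * \<bar>r - t0\<bar> ^ n" if "r \<in> {u..v}" for r
        using dnorm[OF that, of "X n r"] mult_left_mono[OF Suc.IH[OF that], of M] M C[of "\<bar>r - t0\<bar>"]
        by linarith
      have c: "continuous_on {x..y} (X (Suc n))" if "u \<le> x" "y \<le> v" for x y
        by (rule continuous_on_subset[OF Xc]) (use that uv in auto)
      consider "s = t0" | "t0 < s" | "s < t0" by linarith
      then show ?case
      proof cases
        case 1
        then show ?thesis by (simp add: Xt0)
      next
        case 2
        have "norm (X (Suc n) s - X (Suc n) t0) \<le>
            C * (s - t0) ^ Suc n / real (Suc n) - C * (t0 - t0) ^ Suc n / real (Suc n)"
        proof (rule differentiable_bound_general[OF 2])
          show "((\<lambda>r. C * (r - t0) ^ Suc n / real (Suc n)) has_vector_derivative C * (r - t0) ^ n) (at r)" for r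
            unfolding has_real_derivative_iff_has_vector_derivative[symmetric]
            by (rule derivative_eq_intros refl | simp)+
          show "(X (Suc n) has_vector_derivative prod (X n r) (A r)) (at r)" if "t0 < r" "r < s" for r
            by (rule X') (use that Suc.prems tuv uv in auto)
          show "norm (prod (X n r) (A r)) \<le> C * (r - t0) ^ n" if "t0 < r" "r < s" for r
            using nd[of r] that Suc.prems tuv by simp
        qed (use Suc.prems tuv c in \<open>auto intro!: continuous_intros\<close>)
        then show ?thesis using 2 unfolding fin by (simp add: Xt0)
      next
        case 3
        have "norm (X (Suc n) t0 - X (Suc n) s) \<le>
            - (C * (t0 - t0) ^ Suc n / real (Suc n)) - (- (C * (t0 - s) ^ Suc n / real (Suc n)))"
        proof (rule differentiable_bound_general[OF 3])
          show "((\<lambda>r. - (C * (t0 - r) ^ Suc n / real (Suc n))) has_vector_derivative C * (t0 - r) ^ n) (at r)" for r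
            unfolding has_real_derivative_iff_has_vector_derivative[symmetric]
            by (rule derivative_eq_intros refl | simp)+
          show "(X (Suc n) has_vector_derivative prod (X n r) (A r)) (at r)" if "s < r" "r < t0" for r
            by (rule X') (use that Suc.prems tuv uv in auto)
          show "norm (prod (X n r) (A r)) \<le> C * (t0 - r) ^ n" if "s < r" "r < t0" for r
            using nd[of r] that Suc.prems tuv by simp
        qed (use Suc.prems tuv c in \<open>auto intro!: continuous_intros\<close>)
        then show ?thesis using 3 unfolding fin by (simp add: Xt0)
      qed
    qed (simp add: X_0)
    define D where "D = M * (v - u)"
    have unif: "norm (X n s) \<le> norm x0 * (inverse (fact n) * D ^ n)" if "s \<in> {u..v}" for n s
    proof -
      have "M * \<bar>s - t0\<bar> \<le> D"
        unfolding D_def using that tuv M by (intro mult_left_mono) auto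
      then have "(M * \<bar>s - t0\<bar>) ^ n \<le> D ^ n"
        using M by (intro power_mono) auto
      then have "norm x0 * (M * \<bar>s - t0\<bar>) ^ n / fact n \<le> norm x0 * D ^ n / fact n"
        by (intro divide_right_mono mult_left_mono) auto
      with bound[OF that, of n] show ?thesis by (simp add: field_simps)
    qed
    have sD: "summable (\<lambda>n. norm x0 * (inverse (fact n) * D ^ n))"
      by (intro summable_mult summable_exp)
    have lim: "uniform_limit {u..v} (\<lambda>n s. \<Sum>i<n. X i s) Y sequentially"
      unfolding Y_def[abs_def] by (rule Weierstrass_m_test[OF unif sD])
    have sums: "(\<lambda>n. X n s) sums Y s" if "s \<in> {u..v}" for s
      unfolding Y_def by (rule summable_sums, rule summable_comparison_test[OF _ sD]) (use unif[OF that] in auto)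
    \<comment> \<open>The derivatives of the terms are the terms shifted by one, preceded by 0.\<close>
    define d' where "d' n s = (case n of 0 \<Rightarrow> 0 | Suc k \<Rightarrow> prod (X k s) (A s))" for n s
    have sum_d': "(\<Sum>i<Suc n. d' i s) = prod (\<Sum>i<n. X i s) (A s)" for n s
      unfolding sum.lessThan_Suc_shift by (simp add: d'_def bounded_bilinear.sum_left[OF bl])
    have "\<exists>g. \<forall>s\<in>{u..v}. (\<lambda>n. X n s) sums g s \<and>
        (g has_derivative (\<lambda>h. h *\<^sub>R prod (Y s) (A s))) (at s within {u..v})"
    proof (rule has_derivative_series[where f'="\<lambda>n s h. h *\<^sub>R d' n s"])
      show "convex {u..v}" by simp
      show "(X n has_derivative (\<lambda>h. h *\<^sub>R d' n s)) (at s within {u..v})" if "s \<in> {u..v}" for n s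
      proof (cases n)
        case 0
        then show ?thesis by (simp add: X_0 d'_def)
      next
        case (Suc k)
        have "s \<in> J" using that uv by auto
        from has_vector_derivative_at_within[OF X'[OF this]] show ?thesis
          by (simp add: Suc d'_def has_vector_derivative_def)
      qed
      show "\<forall>\<^sub>F n in sequentially. \<forall>s\<in>{u..v}. \<forall>h.
          norm ((\<Sum>i<n. h *\<^sub>R d' i s) - h *\<^sub>R prod (Y s) (A s)) \<le> e * norm h" if e: "e > 0" for e
      proof -
        have "\<forall>\<^sub>F n in sequentially. \<forall>s\<in>{u..v}. dist (\<Sum>i<n. X i s) (Y s) < e / M"
          by (rule uniform_limitD[OF lim]) (use e M in simp)
        then have "\<forall>\<^sub>F n in sequentially. \<forall>s\<in>{u..v}. \<forall>h.
          norm ((\<Sum>i<Suc n. h *\<^sub>R d' i s) - h *\<^sub>R prod (Y s) (A s)) \<le> e * norm h"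
        proof eventually_elim
          case (elim n)
          show ?case
          proof (intro ballI allI)
            fix s :: real and h :: real assume s: "s \<in> {u..v}"
            have "(\<Sum>i<Suc n. h *\<^sub>R d' i s) - h *\<^sub>R prod (Y s) (A s) = h *\<^sub>R prod ((\<Sum>i<n. X i s) - Y s) (A s)"
              by (simp add: scaleR_right.sum[symmetric] sum_d' bounded_bilinear.diff_left[OF bl]
                  scaleR_diff_right del: sum.lessThan_Suc)
            moreover have "norm (prod ((\<Sum>i<n. X i s) - Y s) (A s)) \<le> e"
            proof -
              have "M * norm ((\<Sum>i<n. X i s) - Y s) \<le> M * (e / M)"
                using elim s M by (intro mult_left_mono) (auto simp: dist_norm intro: less_imp_le)
              then show ?thesis using dnorm[OF s, of "(\<Sum>i<n. X i s) - Y s"] M by simp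
            qed
            ultimately show "norm ((\<Sum>i<Suc n. h *\<^sub>R d' i s) - h *\<^sub>R prod (Y s) (A s)) \<le> e * norm h"
              using mult_right_mono[of "norm (prod ((\<Sum>i<n. X i s) - Y s) (A s))" e "\<bar>h\<bar>"]
              by (simp add: mult.commute del: sum.lessThan_Suc)
          qed
        qed
        then show ?thesis by (subst (asm) eventually_sequentially_Suc)
      qed
      show "t \<in> {u..v}" using tuv by simp
      show "(\<lambda>n. X n t) sums Y t" by (rule sums) (use tuv in simp)
    qed
    then obtain g where g: "\<And>s. s \<in> {u..v} \<Longrightarrow> (\<lambda>n. X n s) sums g s"
      "\<And>s. s \<in> {u..v} \<Longrightarrow> (g has_vector_derivative prod (Y s) (A s)) (at s within {u..v})"
      unfolding has_vector_derivative_def by blast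
    have gY: "g s = Y s" if "s \<in> {u..v}" for s
      using sums_unique2[OF g(1) sums] that by blast
    have "(g has_vector_derivative prod (Y t) (A t)) (at t)"
      using g(2)[of t] tuv at_within_Icc_at[of u t v] by simp
    then show ?thesis
      by (rule has_vector_derivative_transform_within_open[of _ _ _ "{u<..<v}"]) (use tuv gY in auto)
  qed
  have "Y t0 = x0"
  proof -
    have "(\<lambda>n. X n t0) sums (\<Sum>n\<in>{0}. X n t0)"
      by (rule sums_finite) (use Xt0 not0_implies_Suc in force)+
    then show ?thesis unfolding Y_def by (simp add: sums_iff X_0)
  qed
  with Y show ?thesis by blast
qed

section \<open>The reduced equation\<close>

lemma unit_curve_orthogonal:
  fixes \<gamma> :: "real \<Rightarrow> 'a::real_inner"
  assumes "open J" "t \<in> J" "\<And>t. t \<in> J \<Longrightarrow> norm (\<gamma> t) = 1" "(\<gamma> has_vector_derivative \<gamma>') (at t)"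
  shows "\<gamma> t \<bullet> \<gamma>' = 0"
proof -
  have "((\<lambda>t. \<gamma> t \<bullet> \<gamma> t) has_vector_derivative \<gamma> t \<bullet> \<gamma>' + \<gamma>' \<bullet> \<gamma> t) (at t)"
    by (rule has_vector_derivative_inner[OF assms(4,4)])
  then have "\<gamma> t \<bullet> \<gamma>' + \<gamma>' \<bullet> \<gamma> t = 0"
    by (rule has_vector_derivative_const_on_open[OF assms(1,2), rotated])
      (use assms(3) in \<open>simp add: dot_square_norm\<close>)
  then show ?thesis by (simp add: inner_commute)
qed

text \<open>The solution of the linear equation stays orthogonal, because \<open>R t ** transpose (R t)\<close> has derivative
  zero for a skew coefficient, and its determinant is continuous with values \<open>1\<close> and \<open>-1\<close>.\<close>

lemma rotation_curve_exists:
  fixes \<Omega> :: "real \<Rightarrow> real^3"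
  assumes J: "open J" "is_interval J" and c: "continuous_on J \<Omega>"
  shows "\<exists>R. (\<forall>t\<in>J. rotation_matrix (R t) \<and> (R has_vector_derivative R t ** hat (\<Omega> t)) (at t))"
proof (cases "J = {}")
  case False
  then obtain t0 where t0: "t0 \<in> J" by blast
  have "continuous_on J (\<lambda>t. hat (\<Omega> t))"
    by (rule bounded_linear.continuous_on[OF bounded_linear_hat c])
  from linear_ode_exists[OF bounded_bilinear_matrix_mult J t0 this, of "mat 1"]
  obtain R where R0: "R t0 = mat 1"
    and R: "\<And>t. t \<in> J \<Longrightarrow> (R has_vector_derivative R t ** hat (\<Omega> t)) (at t)" by blast
  have "((\<lambda>t. R t ** transpose (R t)) has_vector_derivative 0) (at t within J)" if "t \<in> J" for t
  proof -
    have "((\<lambda>t. R t ** transpose (R t)) has_vector_derivative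
        R t ** transpose (R t ** hat (\<Omega> t)) + R t ** hat (\<Omega> t) ** transpose (R t)) (at t)"
      by (intro has_vector_derivative_matrix_mult has_vector_derivative_transpose R that)
    moreover have "R t ** transpose (R t ** hat (\<Omega> t)) = - (R t ** hat (\<Omega> t) ** transpose (R t))"
      by (simp add: matrix_transpose_mul transpose_hat matrix_mul_assoc
          bounded_bilinear.minus_left[OF bounded_bilinear_matrix_mult]
          bounded_bilinear.minus_right[OF bounded_bilinear_matrix_mult])
    ultimately have "((\<lambda>t. R t ** transpose (R t)) has_vector_derivative 0) (at t)" by simp
    then show ?thesis by (rule has_vector_derivative_at_within)
  qed
  moreover have "convex J" using J(2) by (simp add: is_interval_convex)
  ultimately obtain C where C: "\<And>t. t \<in> J \<Longrightarrow> R t ** transpose (R t) = C"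
    using has_vector_derivative_zero_constant[of J "\<lambda>t. R t ** transpose (R t)"] by blast
  have "C = mat 1" using C[OF t0] by (simp add: R0 transpose_mat)
  with C have orth: "orthogonal_matrix (R t)" if "t \<in> J" for t
    using that matrix_left_right_inverse by (metis orthogonal_matrix)
  have Rc: "continuous_on J R"
    using R by (intro continuous_at_imp_continuous_on) (auto dest: has_vector_derivative_continuous)
  have "continuous_on J (\<lambda>t. det (R t))"
    unfolding det_3 by (intro continuous_intros Rc)
  moreover have "connected J" using J(2) by (simp add: is_interval_connected)
  moreover have "finite ((\<lambda>t. det (R t)) ` J)"
    by (rule finite_subset[of _ "{1, -1}"]) (use det_orthogonal_matrix orth in auto)
  ultimately have "(\<lambda>t. det (R t)) constant_on J"
    by (intro continuous_finite_range_constant)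
  then have "det (R t) = det (R t0)" if "t \<in> J" for t
    using t0 that unfolding constant_on_def by metis
  then have "rotation_matrix (R t)" if "t \<in> J" for t
    using orth that by (simp add: rotation_matrix_def R0)
  with R show ?thesis by blast
qed simp

text \<open>The constraints are equivalent to \<open>\<Omega> = p \<gamma>' \<times> \<gamma>\<close>: no twist means \<open>\<Omega> \<bullet> \<gamma> = 0\<close>, and no slip, in the
  body frame, \<open>p \<gamma>' = \<gamma> \<times> \<Omega>\<close>. With this value of \<open>\<Omega>\<close> the velocity of the contact point is \<open>- b R \<gamma>'\<close>,
  and its contribution to the torque is that of the additional moment of inertia \<open>\<mu> b\<^sup>2\<close>.
  Conversely the attitude is recovered from \<open>\<gamma>\<close> by integrating \<open>R' = R ** hat \<Omega>\<close>, and the contact point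
  is then \<open>a R \<gamma>\<close>.\<close>

lemma rubber_motion_iff:
  fixes a b \<mu> :: real and I :: "real^3" and \<gamma> :: "real \<Rightarrow> real^3"
  assumes J: "open J" "is_interval J" and a: "a > 0" "b \<noteq> - a"
    and \<gamma>1: "\<And>t. t \<in> J \<Longrightarrow> (\<gamma> has_vector_derivative \<gamma>1 t) (at t)"
    and \<gamma>2: "\<And>t. t \<in> J \<Longrightarrow> (\<gamma>1 has_vector_derivative \<gamma>2 t) (at t)" "continuous_on J \<gamma>2"
    and n\<gamma>: "\<And>t. t \<in> J \<Longrightarrow> norm (\<gamma> t) = 1"
  defines "p \<equiv> 1 + b/a"
  shows "(\<exists>q R. rubber_motion a b \<mu> I J q R \<and> (\<forall>t\<in>J. \<gamma> t = poisson a (q t) (R t))) \<longleftrightarrow>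
    (\<forall>t\<in>J. \<forall>v. cross3 v (\<gamma> t) \<bullet>
      (p *\<^sub>R (inertia I *v cross3 (\<gamma>2 t) (\<gamma> t) + (\<mu> * b\<^sup>2) *\<^sub>R cross3 (\<gamma>2 t) (\<gamma> t)) +
       p\<^sup>2 *\<^sub>R cross3 (cross3 (\<gamma>1 t) (\<gamma> t)) (inertia I *v cross3 (\<gamma>1 t) (\<gamma> t))) = 0)"
    (is "?L \<longleftrightarrow> (\<forall>t\<in>J. \<forall>v. cross3 v (\<gamma> t) \<bullet> ?E t = 0)")
proof -
  have p: "p \<noteq> 0" using a by (auto simp: p_def field_simps)
  have orth: "\<gamma> t \<bullet> \<gamma>1 t = 0" if "t \<in> J" for t
    by (rule unit_curve_orthogonal[OF J(1) that n\<gamma> \<gamma>1[OF that]])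
  define \<Omega> where "\<Omega> t = p *\<^sub>R cross3 (\<gamma>1 t) (\<gamma> t)" for t
  define \<Omega>1 where "\<Omega>1 t = p *\<^sub>R cross3 (\<gamma>2 t) (\<gamma> t)" for t
  have \<Omega>1: "(\<Omega> has_vector_derivative \<Omega>1 t) (at t)" if "t \<in> J" for t
  proof -
    have "(\<Omega> has_vector_derivative p *\<^sub>R (cross3 (\<gamma>1 t) (\<gamma>1 t) + cross3 (\<gamma>2 t) (\<gamma> t))) (at t)"
      unfolding \<Omega>_def
      by (intro bounded_linear.has_vector_derivative[OF bounded_linear_scaleR_right]
          has_vector_derivative_cross3 \<gamma>1 \<gamma>2 that)
    then show ?thesis by (simp add: \<Omega>1_def)
  qed
  have \<gamma>c: "continuous_on J \<gamma>" "continuous_on J \<gamma>1"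
    using \<gamma>1 \<gamma>2 by (intro continuous_at_imp_continuous_on; auto dest: has_vector_derivative_continuous)+
  have \<Omega>c: "continuous_on J \<Omega>" "continuous_on J \<Omega>1"
    unfolding \<Omega>_def \<Omega>1_def
    by (intro continuous_intros bounded_bilinear.continuous_on[OF bounded_bilinear_cross3] \<gamma>c \<gamma>2(2))+
  have \<Omega>\<gamma>: "cross3 (\<Omega> t) (\<gamma> t) = - p *\<^sub>R \<gamma>1 t" if "t \<in> J" for t
    using cross3_triple_self(2)[OF n\<gamma>[OF that] orth[OF that]]
    by (simp add: \<Omega>_def cross_mult_left)
  \<comment> \<open>Both directions compute with a pair of this form, obtained from a motion in one case and
    constructed in the other.\<close>
  have LdA: "lagrange_dalembert a b \<mu> I J q R \<longleftrightarrow> (\<forall>t\<in>J. \<forall>v. cross3 v (\<gamma> t) \<bullet> ?E t = 0)"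
    and q'': "(q has_vector_derivative (- b) *\<^sub>R (R t *v \<gamma>1 t)) (at t)"
    and C2q: "Ck_on 2 q J" and C2R: "Ck_on 2 R J"
    if t: "t \<in> J"
    and rot: "\<And>t. t \<in> J \<Longrightarrow> rotation_matrix (R t)"
    and R: "\<And>t. t \<in> J \<Longrightarrow> (R has_vector_derivative R t ** hat (\<Omega> t)) (at t)"
    and q: "\<And>t. t \<in> J \<Longrightarrow> q t = a *\<^sub>R (R t *v \<gamma> t)" for q R t
  proof -
    define q1 where "q1 t = (- b) *\<^sub>R (R t *v \<gamma>1 t)" for t
    define q2 where "q2 t = (- b) *\<^sub>R (R t *v (\<gamma>2 t + cross3 (\<Omega> t) (\<gamma>1 t)))" for t
    have RV: "((\<lambda>t. R t *v f t) has_vector_derivative R t *v (f' + cross3 (\<Omega> t) (f t))) (at t)"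
      if "t \<in> J" "(f has_vector_derivative f') (at t)" for f f' t
      using has_vector_derivative_matrix_vector[OF R[OF that(1)] that(2)]
      by (simp add: matrix_vector_mul_assoc[symmetric] hat_mult matrix_vector_right_distrib)
    have q1: "(q has_vector_derivative q1 t) (at t)" if "t \<in> J" for t
    proof -
      have "((\<lambda>t. a *\<^sub>R (R t *v \<gamma> t)) has_vector_derivative
          a *\<^sub>R (R t *v (\<gamma>1 t + cross3 (\<Omega> t) (\<gamma> t)))) (at t)"
        by (intro bounded_linear.has_vector_derivative[OF bounded_linear_scaleR_right] RV \<gamma>1 that)
      moreover have "a *\<^sub>R (R t *v (\<gamma>1 t + cross3 (\<Omega> t) (\<gamma> t))) = q1 t"
      proof -
        have "\<gamma>1 t + cross3 (\<Omega> t) (\<gamma> t) = (- (b/a)) *\<^sub>R \<gamma>1 t"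
          unfolding \<Omega>\<gamma>[OF that] by (simp add: p_def algebra_simps)
        moreover have "a * (- (b/a)) = - b" using a by simp
        ultimately show ?thesis by (simp only: q1_def matrix_vector_mult_scaleR scaleR_scaleR)
      qed
      ultimately have "((\<lambda>t. a *\<^sub>R (R t *v \<gamma> t)) has_vector_derivative q1 t) (at t)" by simp
      then show ?thesis
        by (rule has_vector_derivative_transform_within_open[OF _ J(1) that]) (simp add: q)
    qed
    then show "(q has_vector_derivative (- b) *\<^sub>R (R t *v \<gamma>1 t)) (at t)" using t by (simp add: q1_def)
    have q2: "(q1 has_vector_derivative q2 t) (at t)" if "t \<in> J" for t
      unfolding q1_def q2_def
      by (intro bounded_linear.has_vector_derivative[OF bounded_linear_scaleR_right] RV \<gamma>2 that)
    have Rc: "continuous_on J R"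
      using R by (intro continuous_at_imp_continuous_on) (auto dest: has_vector_derivative_continuous)
    have q2c: "continuous_on J q2"
      unfolding q2_def
      by (intro continuous_on_scaleR continuous_on_const continuous_on_add
          bounded_bilinear.continuous_on[OF bounded_bilinear_matrix_vector]
          bounded_bilinear.continuous_on[OF bounded_bilinear_cross3] Rc \<gamma>2(2) \<gamma>c \<Omega>c)
    show C2q: "Ck_on 2 q J" by (rule C2_curveI[OF q1 q2 q2c])
    have R2: "((\<lambda>t. R t ** hat (\<Omega> t)) has_vector_derivative
        R t ** hat (\<Omega>1 t) + R t ** hat (\<Omega> t) ** hat (\<Omega> t)) (at t)" if "t \<in> J" for t
      by (intro has_vector_derivative_matrix_mult has_vector_derivative_hat R \<Omega>1 that)
    show C2R: "Ck_on 2 R J"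
    proof (rule C2_curveI[OF R R2])
      show "continuous_on J (\<lambda>t. R t ** hat (\<Omega>1 t) + R t ** hat (\<Omega> t) ** hat (\<Omega> t))"
        by (intro continuous_on_add bounded_bilinear.continuous_on[OF bounded_bilinear_matrix_mult]
          bounded_linear.continuous_on[OF bounded_linear_hat] Rc \<Omega>c)
    qed
    have conf: "config a (q t) (R t)" if "t \<in> J" for t
      using n\<gamma>[OF that] a rot[OF that]
      by (simp add: config_def q[OF that] rotation_norm)
    have po: "poisson a (q t) (R t) = \<gamma> t" if "t \<in> J" for t
      using a by (simp add: poisson_def rotation_matrix_inv[OF rot[OF that]] q[OF that] rot[OF that])
    have Z: "(\<mu> * (1 + b/a) * (b/a)) *\<^sub>R (transpose (R t) *v cross3 (q t) (q2 t)) +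
      (inertia I *v \<Omega>1 t + cross3 (\<Omega> t) (inertia I *v \<Omega> t)) = ?E t" if "t \<in> J" for t
    proof -
      have "cross3 (\<gamma> t) (cross3 (\<Omega> t) (\<gamma>1 t)) =
          p *\<^sub>R ((\<gamma>1 t \<bullet> \<gamma>1 t) *\<^sub>R cross3 (\<gamma> t) (\<gamma> t) - (\<gamma> t \<bullet> \<gamma>1 t) *\<^sub>R cross3 (\<gamma> t) (\<gamma>1 t))"
        unfolding \<Omega>_def by (simp add: vec_eq_iff forall_3 cross3_def inner_vec_def sum_3 algebra_simps)
      then have 0: "cross3 (\<gamma> t) (cross3 (\<Omega> t) (\<gamma>1 t)) = 0" by (simp add: orth[OF that])
      have "cross3 (q t) (q2 t) = (a * - b) *\<^sub>R cross3 (R t *v \<gamma> t) (R t *v (\<gamma>2 t + cross3 (\<Omega> t) (\<gamma>1 t)))"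
        by (simp only: q[OF that] q2_def cross_mult_left cross_mult_right scaleR_scaleR mult.commute)
      also have "\<dots> = (a * - b) *\<^sub>R (R t *v cross3 (\<gamma> t) (\<gamma>2 t))"
        unfolding cross_rotation_matrix[OF rot[OF that]] cross_add_right 0 by simp
      finally have "transpose (R t) *v cross3 (q t) (q2 t) = (a * b) *\<^sub>R cross3 (\<gamma>2 t) (\<gamma> t)"
        using rot[OF that] cross_skew[of "\<gamma> t" "\<gamma>2 t"] by (simp add: matrix_vector_mult_scaleR)
      then have "(\<mu> * (1 + b/a) * (b/a)) *\<^sub>R (transpose (R t) *v cross3 (q t) (q2 t)) =
          (p * (\<mu> * b\<^sup>2)) *\<^sub>R cross3 (\<gamma>2 t) (\<gamma> t)"
        using a by (simp add: p_def power2_eq_square)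
      then show ?thesis
        by (simp add: \<Omega>_def \<Omega>1_def matrix_vector_mult_scaleR cross_mult_left cross_mult_right
            scaleR_add_right power2_eq_square add_ac)
    qed
    show "lagrange_dalembert a b \<mu> I J q R \<longleftrightarrow> (\<forall>t\<in>J. \<forall>v. cross3 v (\<gamma> t) \<bullet> ?E t = 0)"
    proof -
      have "lagrange_dalembert a b \<mu> I J q R \<longleftrightarrow> (\<forall>t\<in>J. \<forall>v. cross3 v (poisson a (q t) (R t)) \<bullet>
          ((\<mu> * (1 + b/a) * (b/a)) *\<^sub>R (transpose (R t) *v cross3 (q t) (q2 t)) +
            (inertia I *v \<Omega>1 t + cross3 (\<Omega> t) (inertia I *v \<Omega> t))) = 0)"
        by (rule lagrange_dalembert_iff) (fact J a C2q C2R conf q1 q2 q2c R \<Omega>1 \<Omega>c(2))+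
      also have "\<dots> \<longleftrightarrow> (\<forall>t\<in>J. \<forall>v. cross3 v (\<gamma> t) \<bullet> ?E t = 0)"
        by (intro ball_cong refl) (simp only: Z po)
      finally show ?thesis .
    qed
  qed
  show ?thesis
  proof
    assume ?L
    then obtain q R where mot: "rubber_motion a b \<mu> I J q R" and po: "\<And>t. t \<in> J \<Longrightarrow> \<gamma> t = poisson a (q t) (R t)"
      by blast
    have rot: "rotation_matrix (R t)" if "t \<in> J" for t
      using mot that by (auto simp: rubber_motion_def config_def)
    have q: "q t = a *\<^sub>R (R t *v \<gamma> t)" if "t \<in> J" for t
      using a rot[OF that] by (simp add: po[OF that] poisson_def rotation_matrix_inv matrix_vector_mult_scaleR)
    obtain R1 R2 where R1: "\<And>t. t \<in> J \<Longrightarrow> (R has_vector_derivative R1 t) (at t)"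
      using mot unfolding rubber_motion_def by (metis C2_curve_derivatives)
    have R: "(R has_vector_derivative R t ** hat (\<Omega> t)) (at t)" if t: "t \<in> J" for t
    proof -
      define V where "V = vee (transpose (R t) ** R1 t)"
      have R1V: "R1 t = R t ** hat V"
        unfolding V_def by (rule rotation_velocity[OF J(1) t rot R1[OF t]])
      have "((\<lambda>t. a *\<^sub>R (R t *v \<gamma> t)) has_vector_derivative a *\<^sub>R (R t *v \<gamma>1 t + R1 t *v \<gamma> t)) (at t)"
        by (intro bounded_linear.has_vector_derivative[OF bounded_linear_scaleR_right]
            has_vector_derivative_matrix_vector R1 \<gamma>1 t)
      moreover have "a *\<^sub>R (R t *v \<gamma>1 t + R1 t *v \<gamma> t) = a *\<^sub>R (R t *v (\<gamma>1 t + cross3 V (\<gamma> t)))"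
        unfolding R1V by (simp add: matrix_vector_mul_assoc[symmetric] hat_mult matrix_vector_right_distrib)
      ultimately have "((\<lambda>t. a *\<^sub>R (R t *v \<gamma> t)) has_vector_derivative
          a *\<^sub>R (R t *v (\<gamma>1 t + cross3 V (\<gamma> t)))) (at t)" by simp
      then have "(q has_vector_derivative a *\<^sub>R (R t *v (\<gamma>1 t + cross3 V (\<gamma> t)))) (at t)"
        by (rule has_vector_derivative_transform_within_open[OF _ J(1) t]) (simp add: q)
      from vector_derivative_at[OF this] vector_derivative_at[OF R1[OF t]]
      have "rubber_constraints a b (q t) (R t) (a *\<^sub>R (R t *v (\<gamma>1 t + cross3 V (\<gamma> t)))) (R t ** hat V)"
        using mot t unfolding rubber_motion_def R1V by metis
      then have c1: "p *\<^sub>R a *\<^sub>R (R t *v (\<gamma>1 t + cross3 V (\<gamma> t))) = (b/a) *\<^sub>R cross3 (R t *v V) (q t)"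
        and c2: "(R t *v V) \<bullet> q t = 0"
        unfolding rubber_constraints_eq[OF rot[OF t]] p_def by auto
      have V\<gamma>: "\<gamma> t \<bullet> V = 0"
        using c2 a by (simp add: q[OF t] rotation_inner[OF rot[OF t]] inner_commute)
      have "(b/a) *\<^sub>R cross3 (R t *v V) (q t) = R t *v (b *\<^sub>R cross3 V (\<gamma> t))"
        using a by (simp add: q[OF t] cross_mult_right cross_rotation_matrix[OF rot[OF t]] matrix_vector_mult_scaleR)
      with c1 have "R t *v ((p * a) *\<^sub>R (\<gamma>1 t + cross3 V (\<gamma> t))) = R t *v (b *\<^sub>R cross3 V (\<gamma> t))"
        by (simp add: matrix_vector_mult_scaleR)
      then have "(p * a) *\<^sub>R (\<gamma>1 t + cross3 V (\<gamma> t)) = b *\<^sub>R cross3 V (\<gamma> t)"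
        using rotation_transpose_vector(1)[OF rot[OF t]] by metis
      then have "a *\<^sub>R (p *\<^sub>R \<gamma>1 t + cross3 V (\<gamma> t)) = 0"
        using a by (simp add: p_def algebra_simps)
      then have "p *\<^sub>R \<gamma>1 t = - cross3 V (\<gamma> t)"
        using a by (simp add: eq_neg_iff_add_eq_0)
      then have "\<Omega> t = - cross3 (cross3 V (\<gamma> t)) (\<gamma> t)"
        unfolding \<Omega>_def cross_mult_left[symmetric] by simp
      also have "\<dots> = V" using cross3_triple_self(2)[OF n\<gamma>[OF t] V\<gamma>] by simp
      finally show ?thesis using R1[OF t] R1V by simp
    qed
    have "lagrange_dalembert a b \<mu> I J q R" using mot by (simp add: rubber_motion_def)
    then show "\<forall>t\<in>J. \<forall>v. cross3 v (\<gamma> t) \<bullet> ?E t = 0"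
      using LdA[OF _ rot R q] by blast
  next
    assume E: "\<forall>t\<in>J. \<forall>v. cross3 v (\<gamma> t) \<bullet> ?E t = 0"
    obtain R where rot: "\<And>t. t \<in> J \<Longrightarrow> rotation_matrix (R t)"
      and R: "\<And>t. t \<in> J \<Longrightarrow> (R has_vector_derivative R t ** hat (\<Omega> t)) (at t)"
      using rotation_curve_exists[OF J \<Omega>c(1)] by blast
    define q where "q t = a *\<^sub>R (R t *v \<gamma> t)" for t
    have po: "poisson a (q t) (R t) = \<gamma> t" if "t \<in> J" for t
      using a by (simp add: poisson_def rotation_matrix_inv[OF rot[OF that]] q_def rot[OF that])
    have conf: "config a (q t) (R t)" if "t \<in> J" for t
      using n\<gamma>[OF that] a rot[OF that]
      by (simp add: config_def q_def rotation_norm)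
    show ?L
    proof (cases "J = {}")
      case True
      have "Ck_on 2 q J" "Ck_on 2 R J" by (rule C2_curveI; simp add: True)+
      then have "rubber_motion a b \<mu> I J q R"
        by (simp add: rubber_motion_def lagrange_dalembert_def True)
      with True show ?thesis by blast
    next
      case False
      then obtain t0 where t0: "t0 \<in> J" by blast
      have C2: "Ck_on 2 q J" "Ck_on 2 R J" using C2q[OF t0 rot R q_def] C2R[OF t0 rot R q_def] by auto
      have "rubber_constraints a b (q t) (R t) (vector_derivative q (at t)) (vector_derivative R (at t))"
        if t: "t \<in> J" for t
      proof -
        have "(b/a) *\<^sub>R cross3 (R t *v \<Omega> t) (q t) = b *\<^sub>R (R t *v cross3 (\<Omega> t) (\<gamma> t))"
          using a by (simp add: q_def cross_mult_right cross_rotation_matrix[OF rot[OF t]])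
        also have "\<dots> = p *\<^sub>R ((- b) *\<^sub>R (R t *v \<gamma>1 t))"
          unfolding \<Omega>\<gamma>[OF t]
          by (simp only: matrix_vector_mult_scaleR scaleR_scaleR mult_minus_right mult_minus_left mult.commute)
        finally have "p *\<^sub>R ((- b) *\<^sub>R (R t *v \<gamma>1 t)) = (b/a) *\<^sub>R cross3 (R t *v \<Omega> t) (q t)" ..
        moreover have "(R t *v \<Omega> t) \<bullet> q t = 0"
          by (simp add: q_def rotation_inner[OF rot[OF t]] \<Omega>_def dot_cross_self)
        moreover have "vector_derivative q (at t) = (- b) *\<^sub>R (R t *v \<gamma>1 t)"
          using q''[of t R q, OF t rot R q_def] by (rule vector_derivative_at)
        ultimately show ?thesis
          unfolding vector_derivative_at[OF R[OF t]]
            rubber_constraints_eq[OF rot[OF t]] p_def[symmetric] by simp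
      qed
      moreover have "lagrange_dalembert a b \<mu> I J q R"
        using LdA[OF t0 rot R q_def] E by blast
      ultimately have "rubber_motion a b \<mu> I J q R"
        using C2 conf by (simp add: rubber_motion_def)
      with po show ?thesis by (metis (no_types))
    qed
  qed
qed

section \<open>Rational identities of the sphero-conical coordinates\<close>

text \<open>The coefficients of Lagrange interpolation at three nodes, applied to \<open>1\<close>, to \<open>z\<close>, to \<open>1 / (z - w)\<close> and to
  \<open>1 / (z - w)\<^sup>2\<close>. The inertial terms of the equation of motion in sphero-conical coordinates come down to these four sums.\<close>

lemma lagrange_interpolation_sums:
  fixes i1 i2 i3 w :: real
  assumes "i1 \<noteq> i2" "i1 \<noteq> i3" "i2 \<noteq> i3"
  defines "D1 \<equiv> (i2 - i1) * (i3 - i1)" and "D2 \<equiv> (i1 - i2) * (i3 - i2)" and "D3 \<equiv> (i1 - i3) * (i2 - i3)"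
  shows "1 / D1 + 1 / D2 + 1 / D3 = 0"
    and "i1 / D1 + i2 / D2 + i3 / D3 = 0"
    and "i1 \<noteq> w \<Longrightarrow> i2 \<noteq> w \<Longrightarrow> i3 \<noteq> w \<Longrightarrow>
      1 / ((i1 - w) * D1) + 1 / ((i2 - w) * D2) + 1 / ((i3 - w) * D3) = 1 / ((i1 - w) * (i2 - w) * (i3 - w))"
    and "i1 \<noteq> w \<Longrightarrow> i2 \<noteq> w \<Longrightarrow> i3 \<noteq> w \<Longrightarrow>
      1 / ((i1 - w)\<^sup>2 * D1) + 1 / ((i2 - w)\<^sup>2 * D2) + 1 / ((i3 - w)\<^sup>2 * D3) =
      1 / ((i1 - w) * (i2 - w) * (i3 - w)) * (1 / (i1 - w) + 1 / (i2 - w) + 1 / (i3 - w))"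
proof -
  define e12 e13 e23 where e: "e12 = i1 - i2" "e13 = i1 - i3" "e23 = i2 - i3"
  have nz: "e12 \<noteq> 0" "e13 \<noteq> 0" "e23 \<noteq> 0" using assms(1-3) by (simp_all add: e)
  have D: "D1 = e12 * e13" "D2 = - (e12 * e23)" "D3 = e13 * e23"
    by (simp_all add: D1_def D2_def D3_def e algebra_simps)
  \<comment> \<open>With the Vandermonde product as common denominator each claim becomes a polynomial identity.\<close>
  have common: "f1 / D1 + f2 / D2 + f3 / D3 = (f1 * e23 - f2 * e13 + f3 * e12) / (e12 * e13 * e23)" for f1 f2 f3
    unfolding D using nz by (simp add: add_divide_distrib diff_divide_distrib)
  show "1 / D1 + 1 / D2 + 1 / D3 = 0" "i1 / D1 + i2 / D2 + i3 / D3 = 0"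
    unfolding common by (simp_all add: e algebra_simps)
  assume "i1 \<noteq> w" "i2 \<noteq> w" "i3 \<noteq> w"
  define d1 d2 d3 where d: "d1 = i1 - w" "d2 = i2 - w" "d3 = i3 - w"
  have dnz: "d1 \<noteq> 0" "d2 \<noteq> 0" "d3 \<noteq> 0"
    using \<open>i1 \<noteq> w\<close> \<open>i2 \<noteq> w\<close> \<open>i3 \<noteq> w\<close> by (simp_all add: d)
  have ed: "e12 = d1 - d2" "e13 = d1 - d3" "e23 = d2 - d3" by (simp_all add: e d)
  have "1 / (d1 * D1) + 1 / (d2 * D2) + 1 / (d3 * D3) = (1 / d1) / D1 + (1 / d2) / D2 + (1 / d3) / D3"
    by simp
  also have "\<dots> = (d2 * d3 * e23 - d1 * d3 * e13 + d1 * d2 * e12) / (d1 * d2 * d3) / (e12 * e13 * e23)"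
    unfolding common using dnz by (simp add: add_divide_distrib diff_divide_distrib)
  also have "d2 * d3 * e23 - d1 * d3 * e13 + d1 * d2 * e12 = e12 * e13 * e23"
    unfolding ed by (simp add: algebra_simps)
  finally show "1 / ((i1 - w) * D1) + 1 / ((i2 - w) * D2) + 1 / ((i3 - w) * D3) = 1 / ((i1 - w) * (i2 - w) * (i3 - w))"
    using nz by (simp add: d)
  have "1 / (d1\<^sup>2 * D1) + 1 / (d2\<^sup>2 * D2) + 1 / (d3\<^sup>2 * D3) =
      (1 / d1\<^sup>2) / D1 + (1 / d2\<^sup>2) / D2 + (1 / d3\<^sup>2) / D3"
    by simp
  also have "\<dots> = (d2\<^sup>2 * d3\<^sup>2 * e23 - d1\<^sup>2 * d3\<^sup>2 * e13 + d1\<^sup>2 * d2\<^sup>2 * e12) / (d1\<^sup>2 * d2\<^sup>2 * d3\<^sup>2) / (e12 * e13 * e23)"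
    unfolding common using dnz by (simp add: add_divide_distrib diff_divide_distrib)
  also have "d2\<^sup>2 * d3\<^sup>2 * e23 - d1\<^sup>2 * d3\<^sup>2 * e13 + d1\<^sup>2 * d2\<^sup>2 * e12 =
      (d2 * d3 + d1 * d3 + d1 * d2) * (e12 * e13 * e23)"
    unfolding ed by (simp add: power2_eq_square algebra_simps)
  also have "(d2 * d3 + d1 * d3 + d1 * d2) * (e12 * e13 * e23) / (d1\<^sup>2 * d2\<^sup>2 * d3\<^sup>2) / (e12 * e13 * e23) =
      1 / (d1 * d2 * d3) * (1 / d1 + 1 / d2 + 1 / d3)"
    using nz dnz by (simp add: power2_eq_square add_divide_distrib distrib_right distrib_left mult_ac)
  finally show "1 / ((i1 - w)\<^sup>2 * D1) + 1 / ((i2 - w)\<^sup>2 * D2) + 1 / ((i3 - w)\<^sup>2 * D3) =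
      1 / ((i1 - w) * (i2 - w) * (i3 - w)) * (1 / (i1 - w) + 1 / (i2 - w) + 1 / (i3 - w))"
    by (simp add: d)
qed

text \<open>A point of the sphere with components \<open>g1\<close>, \<open>g2\<close>, \<open>g3\<close> and sphero-conical coordinates \<open>l1\<close>, \<open>l2\<close>.
  The tangent vectors of the coordinate lines have components \<open>- g1 * a1 / 2\<close>, \<dots> and
  \<open>- g1 * b1 / 2\<close>, \<dots>, with the reciprocals \<open>a1\<close>, \<dots> and \<open>b1\<close>, \<dots> defined below. Their cross
  products with the point have components \<open>- g2 * g3 * A1 / 2\<close>, \<dots> and \<open>- g2 * g3 * B1 / 2\<close>, \<dots>;
  this explains the sums \<open>S\<close>, which are inner products of such vectors for the inertia matrix enlarged by
  \<open>m\<close>, and \<open>X\<close>, which are their triple products with a factor \<open>v1\<close>, \<open>v2\<close>, \<open>v3\<close> of differences of moments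
  of inertia. \<open>P1\<close> and \<open>P2\<close> are the values at \<open>l1\<close> and \<open>l2\<close> of the cubic with the roots \<open>i1\<close>, \<open>i2\<close>, \<open>i3\<close>.
  The assumptions are symmetric in the two coordinates, so that each identity also serves with \<open>l1\<close> and \<open>l2\<close> exchanged.\<close>

locale conical_point =
  fixes i1 i2 i3 l1 l2 m g1 g2 g3 :: real
  assumes dist: "i1 \<noteq> i2" "i1 \<noteq> i3" "i2 \<noteq> i3"
    and nz1: "i1 - l1 \<noteq> 0" "i2 - l1 \<noteq> 0" "i3 - l1 \<noteq> 0"
    and nz2: "i1 - l2 \<noteq> 0" "i2 - l2 \<noteq> 0" "i3 - l2 \<noteq> 0"
    and nz: "l1 \<noteq> l2" "l1 + m \<noteq> 0" "l2 + m \<noteq> 0"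
    and gsq: "g1\<^sup>2 = (i1 - l1) * (i1 - l2) / ((i2 - i1) * (i3 - i1))"
      "g2\<^sup>2 = (i2 - l1) * (i2 - l2) / ((i1 - i2) * (i3 - i2))"
      "g3\<^sup>2 = (i3 - l1) * (i3 - l2) / ((i1 - i3) * (i2 - i3))"
begin

definition "D1 = (i2 - i1) * (i3 - i1)"
definition "D2 = (i1 - i2) * (i3 - i2)"
definition "D3 = (i1 - i3) * (i2 - i3)"
definition "P1 = (i1 - l1) * (i2 - l1) * (i3 - l1)"
definition "P2 = (i1 - l2) * (i2 - l2) * (i3 - l2)"
definition "a1 = 1 / (i1 - l1)"
definition "a2 = 1 / (i2 - l1)"
definition "a3 = 1 / (i3 - l1)"
definition "b1 = 1 / (i1 - l2)"
definition "b2 = 1 / (i2 - l2)"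
definition "b3 = 1 / (i3 - l2)"
definition "A1 = a2 - a3"
definition "A2 = a3 - a1"
definition "A3 = a1 - a2"
definition "B1 = b2 - b3"
definition "B2 = b3 - b1"
definition "B3 = b1 - b2"
definition "u1 = g2\<^sup>2 * g3\<^sup>2"
definition "u2 = g3\<^sup>2 * g1\<^sup>2"
definition "u3 = g1\<^sup>2 * g2\<^sup>2"
definition "v1 = i3 - i2"
definition "v2 = i1 - i3"
definition "v3 = i2 - i1"
definition "G = g1\<^sup>2 * g2\<^sup>2 * g3\<^sup>2"
definition "c1 = 1/4 * (l2 - l1) * (l2 + m) / ((l1 - i1) * (i2 - l1) * (i3 - l1))"
definition "c2 = 1/4 * (l1 - l2) * (l1 + m) / ((l2 - i1) * (i2 - l2) * (i3 - l2))"
definition "sa = a1 + a2 + a3"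
definition "sb = b1 + b2 + b3"

definition "J0 f1 f2 f3 = (i1 + m) * f1 / D1 + (i2 + m) * f2 / D2 + (i3 + m) * f3 / D3"
definition "S f1 f2 f3 = (i1 + m) * (u1 * f1) + (i2 + m) * (u2 * f2) + (i3 + m) * (u3 * f3)"
definition "X f1 f2 f3 = G * (f1 * v1 + f2 * v2 + f3 * v3)"

lemmas a_def = a1_def a2_def a3_def
lemmas b_def = b1_def b2_def b3_def
lemmas v_def = v1_def v2_def v3_def

lemma nonzero_factors: "P1 \<noteq> 0" "P2 \<noteq> 0" "D1 \<noteq> 0" "D2 \<noteq> 0" "D3 \<noteq> 0" "v1 \<noteq> 0" "v2 \<noteq> 0" "v3 \<noteq> 0"
  using nz1 nz2 dist by (auto simp: P1_def P2_def D1_def D2_def D3_def v_def)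

lemma interpolate_1: "1 / D1 + 1 / D2 + 1 / D3 = 0" and interpolate_id: "i1 / D1 + i2 / D2 + i3 / D3 = 0"
  unfolding D1_def D2_def D3_def using lagrange_interpolation_sums(1,2)[OF dist] by auto

lemma interpolate_a: "a1 / D1 + a2 / D2 + a3 / D3 = 1 / P1"
  and interpolate_b: "b1 / D1 + b2 / D2 + b3 / D3 = 1 / P2"
  and interpolate_bb: "b1\<^sup>2 / D1 + b2\<^sup>2 / D2 + b3\<^sup>2 / D3 = 1 / P2 * (b1 + b2 + b3)"
  using lagrange_interpolation_sums(3)[OF dist, of l1] lagrange_interpolation_sums(3,4)[OF dist, of l2] nz1 nz2
  by (simp_all add: D1_def D2_def D3_def P1_def P2_def a_def b_def power_one_over)

lemma J0_one: "J0 1 1 1 = 0"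
proof -
  have "J0 1 1 1 = (i1 / D1 + i2 / D2 + i3 / D3) + m * (1 / D1 + 1 / D2 + 1 / D3)"
    by (simp add: J0_def add_divide_distrib algebra_simps)
  then show ?thesis unfolding interpolate_1 interpolate_id by simp
qed

lemma J0_a: "J0 a1 a2 a3 = (l1 + m) / P1"
proof -
  have ia: "(i1 + m) * a1 = 1 + (l1 + m) * a1" "(i2 + m) * a2 = 1 + (l1 + m) * a2" "(i3 + m) * a3 = 1 + (l1 + m) * a3"
    using nz1 by (simp_all add: a_def divide_simps)
  have "J0 a1 a2 a3 = (1 / D1 + 1 / D2 + 1 / D3) + (l1 + m) * (a1 / D1 + a2 / D2 + a3 / D3)"
    unfolding J0_def ia add_divide_distrib distrib_left by simp
  then show ?thesis unfolding interpolate_1 interpolate_a by simp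
qed

lemma shift_b: "(i1 + m) * b1 = 1 + (l2 + m) * b1" "(i2 + m) * b2 = 1 + (l2 + m) * b2" "(i3 + m) * b3 = 1 + (l2 + m) * b3"
  using nz2 by (simp_all add: b_def divide_simps)

lemma J0_b: "J0 b1 b2 b3 = (l2 + m) / P2"
proof -
  have "J0 b1 b2 b3 = (1 / D1 + 1 / D2 + 1 / D3) + (l2 + m) * (b1 / D1 + b2 / D2 + b3 / D3)"
    unfolding J0_def shift_b add_divide_distrib distrib_left by simp
  then show ?thesis unfolding interpolate_1 interpolate_b by simp
qed

lemma J0_bb: "J0 (b1 * b1) (b2 * b2) (b3 * b3) = 1 / P2 + (l2 + m) / P2 * sb"
proof -
  have "J0 (b1 * b1) (b2 * b2) (b3 * b3) = (b1 / D1 + b2 / D2 + b3 / D3) +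
      (l2 + m) * (b1\<^sup>2 / D1 + b2\<^sup>2 / D2 + b3\<^sup>2 / D3)"
    unfolding J0_def mult.assoc[symmetric] shift_b
    unfolding distrib_right mult.assoc
    unfolding add_divide_distrib distrib_left power2_eq_square by simp
  then show ?thesis unfolding interpolate_b interpolate_bb sb_def by simp
qed

lemma differences_eq: "A1 = v1 * (a2 * a3)" "A2 = v2 * (a3 * a1)" "A3 = v3 * (a1 * a2)"
  "B1 = v1 * (b2 * b3)" "B2 = v2 * (b3 * b1)" "B3 = v3 * (b1 * b2)"
  using nz1 nz2 by (simp_all add: A1_def A2_def A3_def B1_def B2_def B3_def a_def b_def v_def divide_simps)

lemma u_eq: "u1 = - ((i2 - l1) * (i2 - l2) * ((i3 - l1) * (i3 - l2)) / (v1\<^sup>2 * D1))"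
  "u2 = - ((i3 - l1) * (i3 - l2) * ((i1 - l1) * (i1 - l2)) / (v2\<^sup>2 * D2))"
  "u3 = - ((i1 - l1) * (i1 - l2) * ((i2 - l1) * (i2 - l2)) / (v3\<^sup>2 * D3))"
proof -
  have DD: "D2 * D3 = - (v1\<^sup>2 * D1)" "D3 * D1 = - (v2\<^sup>2 * D2)" "D1 * D2 = - (v3\<^sup>2 * D3)"
    unfolding D1_def D2_def D3_def v_def by algebra+
  show "u1 = - ((i2 - l1) * (i2 - l2) * ((i3 - l1) * (i3 - l2)) / (v1\<^sup>2 * D1))"
    "u2 = - ((i3 - l1) * (i3 - l2) * ((i1 - l1) * (i1 - l2)) / (v2\<^sup>2 * D2))"
    "u3 = - ((i1 - l1) * (i1 - l2) * ((i2 - l1) * (i2 - l2)) / (v3\<^sup>2 * D3))"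
    unfolding u1_def u2_def u3_def gsq D1_def[symmetric] D2_def[symmetric] D3_def[symmetric]
      times_divide_times_eq DD by simp_all
qed

text \<open>The zeros of \<open>u1\<close> at the two coordinates cancel all poles of \<open>A1 * B1\<close> and half of those of
  \<open>A1 * A1\<close>. This turns \<open>S\<close> into the interpolation sum \<open>J0\<close>.\<close>

lemma weighted_AB: "u1 * (A1 * B1) = - (1 / D1)" "u2 * (A2 * B2) = - (1 / D2)" "u3 * (A3 * B3) = - (1 / D3)"
  unfolding differences_eq u_eq a_def b_def using nz1 nz2 nonzero_factors
  by (simp_all add: power2_eq_square)

lemma weighted_AA: "u1 * (A1 * A1) = - (P2 / P1) * ((1 + (l2 - l1) * b1) / D1)"
  "u2 * (A2 * A2) = - (P2 / P1) * ((1 + (l2 - l1) * b2) / D2)"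
  "u3 * (A3 * A3) = - (P2 / P1) * ((1 + (l2 - l1) * b3) / D3)"
proof -
  have B: "1 + (l2 - l1) * b1 = (i1 - l1) * b1" "1 + (l2 - l1) * b2 = (i2 - l1) * b2" "1 + (l2 - l1) * b3 = (i3 - l1) * b3"
    using nz2 by (simp_all add: b_def divide_simps)
  show "u1 * (A1 * A1) = - (P2 / P1) * ((1 + (l2 - l1) * b1) / D1)"
    "u2 * (A2 * A2) = - (P2 / P1) * ((1 + (l2 - l1) * b2) / D2)"
    "u3 * (A3 * A3) = - (P2 / P1) * ((1 + (l2 - l1) * b3) / D3)"
    unfolding differences_eq u_eq B
    unfolding P1_def P2_def a_def b_def using nz1 nz2 nonzero_factors
    by (simp_all add: power2_eq_square mult_ac)
qed

lemma c1_eq: "c1 = - (1/4) * (l2 - l1) * (l2 + m) / P1"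
proof -
  have "(l1 - i1) * (i2 - l1) * (i3 - l1) = - P1" by (simp add: P1_def algebra_simps)
  then show ?thesis by (simp add: c1_def)
qed

lemma c2_eq: "c2 = - (1/4) * (l1 - l2) * (l1 + m) / P2"
proof -
  have "(l2 - i1) * (i2 - l2) * (i3 - l2) = - P2" by (simp add: P2_def algebra_simps)
  then show ?thesis by (simp add: c2_def)
qed

lemma S_AA: "S (A1 * A1 * f1) (A2 * A2 * f2) (A3 * A3 * f3) =
    - (P2 / P1) * (J0 f1 f2 f3 + (l2 - l1) * J0 (b1 * f1) (b2 * f2) (b3 * f3))"
proof -
  have *: "u * (A * A * f) = u * (A * A) * f" for u A f :: real by simp
  have "S (A1 * A1 * f1) (A2 * A2 * f2) (A3 * A3 * f3) = - (P2 / P1) *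
     ((i1 + m) * ((1 + (l2 - l1) * b1) / D1 * f1) + (i2 + m) * ((1 + (l2 - l1) * b2) / D2 * f2)
      + (i3 + m) * ((1 + (l2 - l1) * b3) / D3 * f3))"
    unfolding S_def * weighted_AA by (simp only: distrib_left mult_ac)
  also have "(i1 + m) * ((1 + (l2 - l1) * b1) / D1 * f1) + (i2 + m) * ((1 + (l2 - l1) * b2) / D2 * f2)
      + (i3 + m) * ((1 + (l2 - l1) * b3) / D3 * f3) = J0 f1 f2 f3 + (l2 - l1) * J0 (b1 * f1) (b2 * f2) (b3 * f3)"
    unfolding J0_def using nonzero_factors(3-5) by (simp add: divide_simps) algebra
  finally show ?thesis .
qed

lemma S_AB: "S (A1 * B1 * f1) (A2 * B2 * f2) (A3 * B3 * f3) = - J0 f1 f2 f3"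
proof -
  have *: "u * (A * B * f) = u * (A * B) * f" for u A B f :: real by simp
  show ?thesis unfolding S_def * weighted_AB J0_def by simp
qed

lemma J0_const_minus: "J0 (r - f1) (r - f2) (r - f3) = r * J0 1 1 1 - J0 f1 f2 f3"
  by (simp add: J0_def add_divide_distrib diff_divide_distrib algebra_simps)

lemma J0_mult_const_minus: "J0 (f1 * (r - h1)) (f2 * (r - h2)) (f3 * (r - h3)) =
    r * J0 f1 f2 f3 - J0 (f1 * h1) (f2 * h2) (f3 * h3)"
  by (simp add: J0_def add_divide_distrib diff_divide_distrib algebra_simps)

lemma J0_ab: "(l2 - l1) * J0 (b1 * a1) (b2 * a2) (b3 * a3) = J0 b1 b2 b3 - J0 a1 a2 a3"
proof -
  have ba: "(l2 - l1) * (b1 * a1) = b1 - a1" "(l2 - l1) * (b2 * a2) = b2 - a2" "(l2 - l1) * (b3 * a3) = b3 - a3"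
    using nz1 nz2 by (simp_all add: a_def b_def divide_simps)
  have "(l2 - l1) * J0 (b1 * a1) (b2 * a2) (b3 * a3) =
      J0 ((l2 - l1) * (b1 * a1)) ((l2 - l1) * (b2 * a2)) ((l2 - l1) * (b3 * a3))"
    unfolding J0_def by (simp add: distrib_left mult_ac)
  also have "\<dots> = J0 b1 b2 b3 - J0 a1 a2 a3"
    unfolding ba by (simp add: J0_def right_diff_distrib diff_divide_distrib)
  finally show ?thesis .
qed

lemma pair_sums: "a2 + a3 = sa - a1" "a3 + a1 = sa - a2" "a1 + a2 = sa - a3"
    "b2 + b3 = sb - b1" "b3 + b1 = sb - b2" "b1 + b2 = sb - b3"
  by (simp_all add: sa_def sb_def)

text \<open>The lemmas \<open>S_metric\<close> and \<open>S_orthogonal\<close> say that the kinetic energy of the reduced system is diagonal in these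
  coordinates, and the lemmas \<open>S_AAa\<close> to \<open>S_ABb\<close> evaluate the terms of \<open>(A + m) W'\<close> that are quadratic in the velocities.\<close>

lemma S_metric: "S (A1 * A1) (A2 * A2) (A3 * A3) = 4 * c1"
  using S_AA[of 1 1 1] nonzero_factors(1,2) by (simp add: J0_one J0_b c1_eq)

lemma S_orthogonal: "S (A1 * B1) (A2 * B2) (A3 * B3) = 0"
  using S_AB[of 1 1 1] by (simp add: J0_one)

lemma S_AAa: "S (A1 * A1 * (a2 + a3)) (A2 * A2 * (a3 + a1)) (A3 * A3 * (a1 + a2)) =
    4 * c1 * (1 / (l1 - l2) + sa)"
proof -
  have "S (A1 * A1 * (a2 + a3)) (A2 * A2 * (a3 + a1)) (A3 * A3 * (a1 + a2)) =
     - (P2 / P1) * (- J0 a1 a2 a3 + (l2 - l1) * (sa * J0 b1 b2 b3) - (l2 - l1) * J0 (b1 * a1) (b2 * a2) (b3 * a3))"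
    unfolding pair_sums S_AA J0_const_minus J0_mult_const_minus J0_one right_diff_distrib[of "l2 - l1"] by simp
  also have "\<dots> = - (P2 / P1) * (((l2 - l1) * sa - 1) * J0 b1 b2 b3)"
    unfolding J0_ab by (rule arg_cong[of _ _ "\<lambda>z. - (P2 / P1) * z"]) (simp add: algebra_simps)
  also have "\<dots> = - (1 / P1) * ((l2 - l1) * sa - 1) * (l2 + m)" unfolding J0_b using nonzero_factors by simp
  also have "(l2 - l1) * sa - 1 = (l2 - l1) * (1 / (l1 - l2) + sa)"
    using nz(1) by (simp add: field_simps)
  finally show ?thesis unfolding c1_eq by simp
qed

lemma S_AAb_ABa: "S (A1 * A1 * (b2 + b3)) (A2 * A2 * (b3 + b1)) (A3 * A3 * (b1 + b2)) +
    S (A1 * B1 * (a2 + a3)) (A2 * B2 * (a3 + a1)) (A3 * B3 * (a1 + a2)) = - 8 * (c1 / (l2 - l1))"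
proof -
  have "S (A1 * A1 * (b2 + b3)) (A2 * A2 * (b3 + b1)) (A3 * A3 * (b1 + b2)) =
     - (P2 / P1) * (- J0 b1 b2 b3 + (l2 - l1) * (sb * J0 b1 b2 b3 - J0 (b1 * b1) (b2 * b2) (b3 * b3)))"
    unfolding pair_sums S_AA J0_const_minus J0_mult_const_minus J0_one by simp
  also have "\<dots> = - (P2 / P1) * ((- (l2 + m) - (l2 - l1)) / P2)"
    unfolding J0_b J0_bb by (simp add: algebra_simps diff_divide_distrib add_divide_distrib)
  also have "\<dots> = (l2 + m + l2 - l1) / P1" using nonzero_factors by (simp add: field_simps)
  finally have 1: "S (A1 * A1 * (b2 + b3)) (A2 * A2 * (b3 + b1)) (A3 * A3 * (b1 + b2)) = (l2 + m + l2 - l1) / P1" .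
  have 2: "S (A1 * B1 * (a2 + a3)) (A2 * B2 * (a3 + a1)) (A3 * B3 * (a1 + a2)) = (l1 + m) / P1"
    unfolding pair_sums S_AB J0_const_minus J0_one by (simp add: J0_a)
  show ?thesis
    unfolding 1 2 c1_eq using nonzero_factors(1) nz(1) by (simp add: field_simps)
qed

lemma S_ABb: "S (A1 * B1 * (b2 + b3)) (A2 * B2 * (b3 + b1)) (A3 * B3 * (b1 + b2)) =
    - 4 * c2 * (1 / (l1 - l2) - 1 / (l1 + m))"
proof -
  have "S (A1 * B1 * (b2 + b3)) (A2 * B2 * (b3 + b1)) (A3 * B3 * (b1 + b2)) = (l2 + m) / P2"
    unfolding pair_sums S_AB J0_const_minus J0_one by (simp add: J0_b)
  moreover have "1 / (l1 - l2) - 1 / (l1 + m) = (l2 + m) / ((l1 - l2) * (l1 + m))"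
    using nz(1,2) by (simp add: divide_simps)
  ultimately show ?thesis unfolding c2_eq using nz(1,2) by simp
qed

text \<open>In a triple product every term carries all three squared components, and their product is, up to sign,
  the quotient of \<open>P1 * P2\<close> by the squared Vandermonde determinant of the moments of inertia.\<close>

lemma G_Vandermonde: "G * (v1 * v2 * v3) * (v1 * v2 * v3) = - P1 * P2"
proof -
  have "D1 * D2 * D3 = - ((v1 * v2 * v3) * (v1 * v2 * v3))"
    unfolding D1_def D2_def D3_def v_def by algebra
  moreover have "G * (D1 * D2 * D3) = P1 * P2"
    unfolding G_def gsq D1_def[symmetric] D2_def[symmetric] D3_def[symmetric] P1_def P2_def
    using nonzero_factors by simp
  ultimately show ?thesis by (simp add: mult.assoc)
qed

lemma pole_products: "a1 * a2 * a3 = 1 / P1" "b1 * b2 * b3 = 1 / P2"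
  by (simp_all add: a_def b_def P1_def P2_def)

lemma X_AAA: "X (A1 * (A2 * A3)) (A2 * (A3 * A1)) (A3 * (A1 * A2)) = 0"
proof -
  have "X (A1 * (A2 * A3)) (A2 * (A3 * A1)) (A3 * (A1 * A2)) = G * (A1 * A2 * A3) * (v1 + v2 + v3)"
    by (simp add: X_def algebra_simps)
  then show ?thesis by (simp add: v_def)
qed

lemma X_AAB: "X (A1 * (A2 * B3 + B2 * A3)) (A2 * (A3 * B1 + B3 * A1)) (A3 * (A1 * B2 + B1 * A2)) =
    - 4 * (c1 / (l2 + m))"
proof -
  have ab: "a3 * b1 * b2 = (i1 - l1) * (i2 - l1) * (i3 - l2) / (P1 * P2)"
    "a2 * b1 * b3 = (i1 - l1) * (i3 - l1) * (i2 - l2) / (P1 * P2)"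
    "a1 * b2 * b3 = (i2 - l1) * (i3 - l1) * (i1 - l2) / (P1 * P2)"
    unfolding a_def b_def P1_def P2_def using nz1 nz2 by simp_all
  have red: "v1 * (a3 * b1 * b2 + a2 * b1 * b3) + v2 * (a1 * b2 * b3 + a3 * b1 * b2) + v3 * (a2 * b1 * b3 + a1 * b2 * b3)
      = - (l2 - l1) * (v1 * v2 * v3) / (P1 * P2)"
    unfolding ab add_divide_distrib[symmetric] times_divide_eq_right
    by (rule arg_cong[of _ _ "\<lambda>z. z / (P1 * P2)"]) (unfold v_def, algebra)
  have "X (A1 * (A2 * B3 + B2 * A3)) (A2 * (A3 * B1 + B3 * A1)) (A3 * (A1 * B2 + B1 * A2)) =
    G * (v1 * v2 * v3) * (a1 * a2 * a3) *
    (v1 * (a3 * b1 * b2 + a2 * b1 * b3) + v2 * (a1 * b2 * b3 + a3 * b1 * b2) + v3 * (a2 * b1 * b3 + a1 * b2 * b3))"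
    unfolding X_def differences_eq by (simp add: algebra_simps)
  also have "\<dots> = - (G * (v1 * v2 * v3) * (v1 * v2 * v3)) * (l2 - l1) / P1 / P1 / P2"
    unfolding red pole_products by (simp add: mult_ac del: minus_diff_eq)
  also have "\<dots> = - 4 * (c1 / (l2 + m))"
    unfolding G_Vandermonde c1_eq using nonzero_factors nz(3) by (simp, simp add: field_simps)
  finally show ?thesis .
qed

lemma X_ABB: "X (A1 * (B2 * B3)) (A2 * (B3 * B1)) (A3 * (B1 * B2)) = 4 * (c2 / (l1 + m))"
proof -
  have ab: "b1 * a2 * a3 = (i1 - l1) * (i2 - l2) * (i3 - l2) / (P1 * P2)"
    "b2 * a3 * a1 = (i2 - l1) * (i1 - l2) * (i3 - l2) / (P1 * P2)"
    "b3 * a1 * a2 = (i3 - l1) * (i1 - l2) * (i2 - l2) / (P1 * P2)"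
    unfolding a_def b_def P1_def P2_def using nz1 nz2 by simp_all
  have red: "v1 * (b1 * a2 * a3) + v2 * (b2 * a3 * a1) + v3 * (b3 * a1 * a2)
      = (l1 - l2) * (v1 * v2 * v3) / (P1 * P2)"
    unfolding ab add_divide_distrib[symmetric] times_divide_eq_right
    by (rule arg_cong[of _ _ "\<lambda>z. z / (P1 * P2)"]) (unfold v_def, algebra)
  have "X (A1 * (B2 * B3)) (A2 * (B3 * B1)) (A3 * (B1 * B2)) =
    G * (v1 * v2 * v3) * (b1 * b2 * b3) *
    (v1 * (b1 * a2 * a3) + v2 * (b2 * a3 * a1) + v3 * (b3 * a1 * a2))"
    unfolding X_def differences_eq by (simp add: algebra_simps)
  also have "\<dots> = (G * (v1 * v2 * v3) * (v1 * v2 * v3)) * (l1 - l2) / P1 / P2 / P2"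
    unfolding red pole_products by (simp add: mult_ac)
  also have "\<dots> = 4 * (c2 / (l1 + m))"
    unfolding G_Vandermonde c2_eq using nonzero_factors nz(2) by (simp, simp add: field_simps)
  finally show ?thesis .
qed

context
  fixes x y x2 y2 p :: real
begin

definition "e1 = 1/4 * (x * a1 + y * b1)\<^sup>2 - 1/2 * (x2 * a1 + y2 * b1 + x\<^sup>2 * a1\<^sup>2 + y\<^sup>2 * b1\<^sup>2)"
definition "e2 = 1/4 * (x * a2 + y * b2)\<^sup>2 - 1/2 * (x2 * a2 + y2 * b2 + x\<^sup>2 * a2\<^sup>2 + y\<^sup>2 * b2\<^sup>2)"
definition "e3 = 1/4 * (x * a3 + y * b3)\<^sup>2 - 1/2 * (x2 * a3 + y2 * b3 + x\<^sup>2 * a3\<^sup>2 + y\<^sup>2 * b3\<^sup>2)"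

text \<open>The values \<open>e1\<close>, \<open>e2\<close>, \<open>e3\<close> are the components of the second derivative of the point, each divided by the
  component of the point itself. The sum is the inertial part of the equation of motion.\<close>

lemma S_acceleration: "S (A1 * (e2 - e3)) (A2 * (e3 - e1)) (A3 * (e1 - e2)) =
    - (2 * c1) * x2 - c1 * (1 / (l1 - l2) + sa) * x\<^sup>2 - 2 * (c1 / (l2 - l1)) * x * y
    + c2 * (1 / (l1 - l2) - 1 / (l1 + m)) * y\<^sup>2"
proof -
  have gen: "(a - a') * ((1/4 * (x * a + y * b)\<^sup>2 - 1/2 * (x2 * a + y2 * b + x\<^sup>2 * a\<^sup>2 + y\<^sup>2 * b\<^sup>2)) -
      (1/4 * (x * a' + y * b')\<^sup>2 - 1/2 * (x2 * a' + y2 * b' + x\<^sup>2 * a'\<^sup>2 + y\<^sup>2 * b'\<^sup>2))) =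
    - (x2 / 2) * ((a - a') * (a - a')) - (y2 / 2) * ((a - a') * (b - b'))
    - (x\<^sup>2 / 4) * ((a - a') * (a - a') * (a + a'))
    + (x * y / 4) * ((a - a') * (a - a') * (b + b')) + (x * y / 4) * ((a - a') * (b - b') * (a + a'))
    - (y\<^sup>2 / 4) * ((a - a') * (b - b') * (b + b'))" for a a' b b'
    by (simp add: power2_eq_square field_simps)
  have lin: "S (r1 * f1 - r2 * h1 - r3 * k1 + r4 * n1 + r4 * o1 - r6 * q1)
     (r1 * f2 - r2 * h2 - r3 * k2 + r4 * n2 + r4 * o2 - r6 * q2)
     (r1 * f3 - r2 * h3 - r3 * k3 + r4 * n3 + r4 * o3 - r6 * q3) =
     r1 * S f1 f2 f3 - r2 * S h1 h2 h3 - r3 * S k1 k2 k3 + r4 * (S n1 n2 n3 + S o1 o2 o3) - r6 * S q1 q2 q3"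
    for r1 r2 r3 r4 r6 f1 f2 f3 h1 h2 h3 k1 k2 k3 n1 n2 n3 o1 o2 o3 q1 q2 q3
    by (simp add: S_def algebra_simps)
  have e: "A1 * (e2 - e3) = - (x2 / 2) * (A1 * A1) - (y2 / 2) * (A1 * B1) - (x\<^sup>2 / 4) * (A1 * A1 * (a2 + a3))
    + (x * y / 4) * (A1 * A1 * (b2 + b3)) + (x * y / 4) * (A1 * B1 * (a2 + a3)) - (y\<^sup>2 / 4) * (A1 * B1 * (b2 + b3))"
    "A2 * (e3 - e1) = - (x2 / 2) * (A2 * A2) - (y2 / 2) * (A2 * B2) - (x\<^sup>2 / 4) * (A2 * A2 * (a3 + a1))
    + (x * y / 4) * (A2 * A2 * (b3 + b1)) + (x * y / 4) * (A2 * B2 * (a3 + a1)) - (y\<^sup>2 / 4) * (A2 * B2 * (b3 + b1))"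
    "A3 * (e1 - e2) = - (x2 / 2) * (A3 * A3) - (y2 / 2) * (A3 * B3) - (x\<^sup>2 / 4) * (A3 * A3 * (a1 + a2))
    + (x * y / 4) * (A3 * A3 * (b1 + b2)) + (x * y / 4) * (A3 * B3 * (a1 + a2)) - (y\<^sup>2 / 4) * (A3 * B3 * (b1 + b2))"
    unfolding A1_def A2_def A3_def B1_def B2_def B3_def e1_def e2_def e3_def by (rule gen)+
  show ?thesis unfolding e lin S_metric S_orthogonal S_AAa S_AAb_ABa S_ABb by (simp add: algebra_simps)
qed

text \<open>The sum is the part of the equation of motion that comes from \<open>W \<times> A W\<close>.\<close>

lemma X_cross_term: "X (A1 * ((x * A2 + y * B2) * (x * A3 + y * B3))) (A2 * ((x * A3 + y * B3) * (x * A1 + y * B1)))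
    (A3 * ((x * A1 + y * B1) * (x * A2 + y * B2))) =
    - 4 * (c1 / (l2 + m)) * x * y + 4 * (c2 / (l1 + m)) * y\<^sup>2"
proof -
  have gen: "A * ((x * A' + y * B') * (x * A'' + y * B'')) =
      x\<^sup>2 * (A * (A' * A'')) + (x * y) * (A * (A' * B'' + B' * A'')) + y\<^sup>2 * (A * (B' * B''))" for A A' A'' B' B''
    by (simp add: power2_eq_square algebra_simps)
  have lin: "X (r1 * f1 + r2 * h1 + r3 * k1) (r1 * f2 + r2 * h2 + r3 * k2) (r1 * f3 + r2 * h3 + r3 * k3) =
      r1 * X f1 f2 f3 + r2 * X h1 h2 h3 + r3 * X k1 k2 k3" for r1 r2 r3 f1 f2 f3 h1 h2 h3 k1 k2 k3
    by (simp add: X_def algebra_simps)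
  show ?thesis unfolding gen lin X_AAA X_AAB X_ABB by (simp add: algebra_simps)
qed

end

end

text \<open>The reduced equation tested against the first coordinate line, as a rational function of the
  coordinates \<open>l1\<close>, \<open>l2\<close>, their velocities \<open>x\<close>, \<open>y\<close> and accelerations \<open>x2\<close>, \<open>y2\<close>. For \<open>p = 2\<close>, that is
  for equal radii, it is the geodesic equation of the metric with coefficients \<open>c1\<close> and \<open>c2\<close>; what
  is added for other values of \<open>p\<close> is the gyroscopic force.\<close>

lemma conical_equation_of_motion:
  fixes I G G1 G2 T :: "real^3" and l1 l2 m p x y x2 y2 :: real
  assumes dist: "I$1 \<noteq> I$2" "I$1 \<noteq> I$3" "I$2 \<noteq> I$3"
    and nz: "\<And>j. I$j \<noteq> l1" "\<And>j. I$j \<noteq> l2" "l1 \<noteq> l2" "l1 + m \<noteq> 0" "l2 + m \<noteq> 0"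
    and G: "(G$1)\<^sup>2 = (I$1 - l1) * (I$1 - l2) / ((I$2 - I$1) * (I$3 - I$1))"
      "(G$2)\<^sup>2 = (I$2 - l1) * (I$2 - l2) / ((I$1 - I$2) * (I$3 - I$2))"
      "(G$3)\<^sup>2 = (I$3 - l1) * (I$3 - l2) / ((I$1 - I$3) * (I$2 - I$3))"
    and G1: "\<And>j. G1$j = - (1/2) * G$j * (x / (I$j - l1) + y / (I$j - l2))"
    and G2: "\<And>j. G2$j = - (1/2) * (G1$j * (x / (I$j - l1) + y / (I$j - l2)) +
        G$j * (x2 / (I$j - l1) + y2 / (I$j - l2) + x\<^sup>2 / (I$j - l1)\<^sup>2 + y\<^sup>2 / (I$j - l2)\<^sup>2))"
    and T: "\<And>j. T$j = - (1/2) * G$j / (I$j - l1)"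
  defines "c1 \<equiv> 1/4 * (l2 - l1) * (l2 + m) / ((l1 - I$1) * (I$2 - l1) * (I$3 - l1))"
    and "c2 \<equiv> 1/4 * (l1 - l2) * (l1 + m) / ((l2 - I$1) * (I$2 - l2) * (I$3 - l2))"
  shows "cross3 T G \<bullet> (p *\<^sub>R (inertia I *v cross3 G2 G + m *\<^sub>R cross3 G2 G) +
      p\<^sup>2 *\<^sub>R cross3 (cross3 G1 G) (inertia I *v cross3 G1 G)) =
    p * (c1 * (x2 + 1/2 * (1 / (l1 - l2) + (1 / (I$1 - l1) + 1 / (I$2 - l1) + 1 / (I$3 - l1))) * x\<^sup>2
           + (1 / (l2 - l1) + p / 2 / (l2 + m)) * x * y)
         - 1/2 * c2 * (1 / (l1 - l2) + (p - 1) / (l1 + m)) * y\<^sup>2)"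
proof -
  interpret C: conical_point "I$1" "I$2" "I$3" l1 l2 m "G$1" "G$2" "G$3"
    by unfold_locales (use dist nz G in auto)
  let ?e1 = "C.e1 x y x2 y2" and ?e2 = "C.e2 x y x2 y2" and ?e3 = "C.e3 x y x2 y2"
  have comp: "G1$1 = - (1/2) * G$1 * (x * C.a1 + y * C.b1)" "G1$2 = - (1/2) * G$2 * (x * C.a2 + y * C.b2)"
      "G1$3 = - (1/2) * G$3 * (x * C.a3 + y * C.b3)" "T$1 = - (1/2) * G$1 * C.a1" "T$2 = - (1/2) * G$2 * C.a2"
      "T$3 = - (1/2) * G$3 * C.a3"
    by (simp_all add: G1 T C.a_def C.b_def)
  have sq: "z / d + w / e + x\<^sup>2 / d\<^sup>2 + y\<^sup>2 / e\<^sup>2 = z * (1/d) + w * (1/e) + x\<^sup>2 * (1/d)\<^sup>2 + y\<^sup>2 * (1/e)\<^sup>2"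
    "x / d + y / e = x * (1/d) + y * (1/e)" for z w d e :: real
    by (simp_all add: power_inverse divide_inverse)
  have sq2: "- (1/2) * (- (1/2) * g * z * z + g * w) = g * (1/4 * z\<^sup>2 - 1/2 * w)" for g z w :: real
    by (simp add: power2_eq_square algebra_simps)
  have comp2: "G2$1 = G$1 * ?e1" "G2$2 = G$2 * ?e2" "G2$3 = G$3 * ?e3"
    unfolding G2 G1 sq sq2 C.e1_def C.e2_def C.e3_def C.a_def C.b_def by simp_all
  have cT: "cross3 T G $ 1 = - (1/2) * (G$2 * G$3) * C.A1" "cross3 T G $ 2 = - (1/2) * (G$3 * G$1) * C.A2"
      "cross3 T G $ 3 = - (1/2) * (G$1 * G$2) * C.A3"
    by (simp_all add: cross3_def comp C.A1_def C.A2_def C.A3_def field_simps)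
  have cG1: "cross3 G1 G $ 1 = - (1/2) * (G$2 * G$3) * (x * C.A1 + y * C.B1)"
      "cross3 G1 G $ 2 = - (1/2) * (G$3 * G$1) * (x * C.A2 + y * C.B2)"
      "cross3 G1 G $ 3 = - (1/2) * (G$1 * G$2) * (x * C.A3 + y * C.B3)"
    by (simp_all add: cross3_def comp C.A1_def C.A2_def C.A3_def C.B1_def C.B2_def C.B3_def field_simps)
  have cG2: "cross3 G2 G $ 1 = (G$2 * G$3) * (?e2 - ?e3)" "cross3 G2 G $ 2 = (G$3 * G$1) * (?e3 - ?e1)"
      "cross3 G2 G $ 3 = (G$1 * G$2) * (?e1 - ?e2)"
    by (simp_all add: cross3_def comp2 algebra_simps)
  have quad: "cross3 W (inertia I *v W) $ 1 = W$2 * W$3 * C.v1"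
    "cross3 W (inertia I *v W) $ 2 = W$3 * W$1 * C.v2" "cross3 W (inertia I *v W) $ 3 = W$1 * W$2 * C.v3" for W
    by (simp_all add: cross3_def inertia_mult C.v_def algebra_simps)
  have lin: "cross3 T G \<bullet> (inertia I *v cross3 G2 G + m *\<^sub>R cross3 G2 G) =
     - (1/2) * C.S (C.A1 * (?e2 - ?e3)) (C.A2 * (?e3 - ?e1)) (C.A3 * (?e1 - ?e2))"
    unfolding C.S_def C.u1_def C.u2_def C.u3_def inner_vec_def sum_3 vector_add_component vector_scaleR_component
      inertia_mult cT cG2 inner_real_def
    by (simp add: power2_eq_square algebra_simps)
  define W1 W2 W3 where W: "W1 = x * C.A1 + y * C.B1" "W2 = x * C.A2 + y * C.B2" "W3 = x * C.A3 + y * C.B3"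
  have qua: "cross3 T G \<bullet> cross3 (cross3 G1 G) (inertia I *v cross3 G1 G) =
     - (1/8) * C.X (C.A1 * (W2 * W3)) (C.A2 * (W3 * W1)) (C.A3 * (W1 * W2))"
    unfolding C.X_def C.G_def inner_vec_def sum_3 quad cT cG1 W[symmetric] inner_real_def
    by (simp add: power2_eq_square algebra_simps)
  have sa: "1 / (I$1 - l1) + 1 / (I$2 - l1) + 1 / (I$3 - l1) = C.sa"
    by (simp add: C.sa_def C.a_def)
  have cc: "c1 = C.c1" "c2 = C.c2" by (simp_all add: c1_def c2_def C.c1_def C.c2_def)
  \<comment> \<open>In terms of these reciprocals the claim is a polynomial identity.\<close>
  define r0 r1 r2 where r_def: "r0 = 1 / (l1 - l2)" "r1 = 1 / (l1 + m)" "r2 = 1 / (l2 + m)"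
  have r: "z / (l1 - l2) = z * r0" "z / (l2 - l1) = - (z * r0)" "z / (l1 + m) = z * r1" "z / (l2 + m) = z * r2" for z
    using minus_divide_right[of z "l1 - l2"] by (simp_all add: r_def)
  show ?thesis
    unfolding inner_add_right[of _ "p *\<^sub>R _"] inner_scaleR_right lin qua W C.S_acceleration C.X_cross_term sa cc r
    by (simp add: power2_eq_square field_simps)
qed

section \<open>The reduced equation in sphero-conical coordinates\<close>

definition conical_sum :: "real^3 \<Rightarrow> real^3 \<Rightarrow> real" where
  "conical_sum I \<gamma> = (\<gamma>$1)\<^sup>2 * (I$2 + I$3) + (\<gamma>$2)\<^sup>2 * (I$1 + I$3) + (\<gamma>$3)\<^sup>2 * (I$1 + I$2)"

definition conical_discriminant :: "real^3 \<Rightarrow> real^3 \<Rightarrow> real" where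
  "conical_discriminant I \<gamma> = (conical_sum I \<gamma>)\<^sup>2 -
     4 * ((\<gamma>$1)\<^sup>2 * (I$2 * I$3) + (\<gamma>$2)\<^sup>2 * (I$1 * I$3) + (\<gamma>$3)\<^sup>2 * (I$1 * I$2))"

text \<open>Clearing denominators in \<open>\<Sum>j. \<gamma>$j\<^sup>2 / (I$j - l) = 0\<close> leaves a quadratic polynomial \<open>q\<close>, which is monic because
  \<open>\<gamma>\<close> is a unit vector. It is positive at \<open>I$1\<close> and \<open>I$3\<close> and negative at \<open>I$2\<close>, which separates its
  roots; and evaluating it at \<open>I$j\<close>, where only one summand survives, expresses \<open>(\<gamma>$j)\<^sup>2\<close> through the roots.\<close>

lemma sphero_conical_roots:
  fixes I \<gamma> :: "real^3"
  assumes I: "I$1 < I$2" "I$2 < I$3" and \<gamma>: "\<gamma> \<in> open_octants"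
  defines "l1 \<equiv> fst (sphero_conical I \<gamma>)" and "l2 \<equiv> snd (sphero_conical I \<gamma>)"
  shows "conical_discriminant I \<gamma> > 0"
    and "l1 = (conical_sum I \<gamma> - sqrt (conical_discriminant I \<gamma>)) / 2"
    and "l2 = (conical_sum I \<gamma> + sqrt (conical_discriminant I \<gamma>)) / 2"
    and "I$1 < l1" "l1 < I$2" "I$2 < l2" "l2 < I$3"
    and "(\<gamma>$1)\<^sup>2 = (I$1 - l1) * (I$1 - l2) / ((I$2 - I$1) * (I$3 - I$1))"
      "(\<gamma>$2)\<^sup>2 = (I$2 - l1) * (I$2 - l2) / ((I$1 - I$2) * (I$3 - I$2))"
      "(\<gamma>$3)\<^sup>2 = (I$3 - l1) * (I$3 - l2) / ((I$1 - I$3) * (I$2 - I$3))"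
proof -
  define s where "s = conical_sum I \<gamma>"
  define D where "D = conical_discriminant I \<gamma>"
  define r1 where "r1 = (s - sqrt D) / 2"
  define r2 where "r2 = (s + sqrt D) / 2"
  define q where "q l = (\<gamma>$1)\<^sup>2 * ((I$2 - l) * (I$3 - l)) + (\<gamma>$2)\<^sup>2 * ((I$1 - l) * (I$3 - l)) + (\<gamma>$3)\<^sup>2 * ((I$1 - l) * (I$2 - l))" for l
  have "norm \<gamma> = 1" and nz: "\<And>j. \<gamma>$j \<noteq> 0" using \<gamma> by (auto simp: open_octants_def)
  then have "\<gamma> \<bullet> \<gamma> = 1" by (simp add: dot_square_norm)
  then have unit: "(\<gamma>$1)\<^sup>2 + (\<gamma>$2)\<^sup>2 + (\<gamma>$3)\<^sup>2 = 1"
    by (simp add: inner_vec_def sum_3 power2_eq_square)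
  have sq: "(\<gamma>$1)\<^sup>2 > 0" "(\<gamma>$2)\<^sup>2 > 0" "(\<gamma>$3)\<^sup>2 > 0" using nz by simp_all
  have q_disc: "4 * q l = (2 * l - s)\<^sup>2 - D" for l
  proof -
    have "4 * q l = 4 * ((\<gamma>$1)\<^sup>2 + (\<gamma>$2)\<^sup>2 + (\<gamma>$3)\<^sup>2) * l\<^sup>2 - 4 * s * l + s\<^sup>2 - D"
      unfolding q_def s_def D_def conical_discriminant_def conical_sum_def
      by (simp add: power2_eq_square algebra_simps)
    then show ?thesis unfolding unit by (simp add: power2_eq_square algebra_simps)
  qed
  have q2: "q (I$2) < 0"
    unfolding q_def using mult_pos_neg[OF sq(2) mult_neg_pos[of "I$1 - I$2" "I$3 - I$2"]] I by simp
  then have "D > (2 * I$2 - s)\<^sup>2" using q_disc[of "I$2"] by linarith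
  then have D: "D > 0" using zero_le_power2 le_less_trans by blast
  then show "conical_discriminant I \<gamma> > 0" by (simp add: D_def)
  have q_roots: "q l = (l - r1) * (l - r2)" for l
  proof -
    have "4 * ((l - r1) * (l - r2)) = (2 * l - s)\<^sup>2 - (sqrt D)\<^sup>2"
      unfolding r1_def r2_def by (simp add: power2_eq_square field_simps)
    then show ?thesis using q_disc[of l] D by simp
  qed
  have r12: "r1 < r2" using D by (simp add: r1_def r2_def)
  have r: "r1 < I$2" "I$2 < r2"
    using q2 r12 unfolding q_roots by (auto simp: mult_less_0_iff)
  have q1: "q (I$1) > 0" and q3: "q (I$3) > 0"
    unfolding q_def using I sq by (simp_all add: mult_neg_neg)
  have r1: "I$1 < r1" using q1 r I unfolding q_roots by (auto simp: zero_less_mult_iff)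
  have r2: "r2 < I$3" using q3 r I unfolding q_roots by (auto simp: zero_less_mult_iff)
  have sum: "(\<Sum>j\<in>UNIV. (\<gamma>$j)\<^sup>2 / (I$j - l)) = 0 \<longleftrightarrow> l = r1 \<or> l = r2"
    if "I$1 \<noteq> l" "I$2 \<noteq> l" "I$3 \<noteq> l" for l
  proof -
    have "(\<Sum>j\<in>UNIV. (\<gamma>$j)\<^sup>2 / (I$j - l)) = q l / ((I$1 - l) * (I$2 - l) * (I$3 - l))"
      unfolding sum_3 q_def using that by (simp add: add_divide_distrib)
    then show ?thesis using that by (simp add: q_roots)
  qed
  have sc: "sphero_conical I \<gamma> = (r1, r2)"
    unfolding sphero_conical_def
  proof (rule the_equality)
    show "case (r1, r2) of (l1, l2) \<Rightarrow> (l1, l2) \<in> sphero_conical_chart I \<and>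
       (\<Sum>j\<in>UNIV. (\<gamma> $ j)\<^sup>2 / (I $ j - l1)) = 0 \<and> (\<Sum>j\<in>UNIV. (\<gamma> $ j)\<^sup>2 / (I $ j - l2)) = 0"
      using r r1 r2 I sum[of r1] sum[of r2] by (simp add: sphero_conical_chart_def)
    show "x = (r1, r2)" if "case x of (l1, l2) \<Rightarrow> (l1, l2) \<in> sphero_conical_chart I \<and>
       (\<Sum>j\<in>UNIV. (\<gamma> $ j)\<^sup>2 / (I $ j - l1)) = 0 \<and> (\<Sum>j\<in>UNIV. (\<gamma> $ j)\<^sup>2 / (I $ j - l2)) = 0" for x
    proof (cases x)
      case (Pair l1 l2)
      with that have l: "I$1 < l1" "l1 < I$2" "I$2 < l2" "l2 < I$3"
        and 0: "(\<Sum>j\<in>UNIV. (\<gamma> $ j)\<^sup>2 / (I $ j - l1)) = 0" "(\<Sum>j\<in>UNIV. (\<gamma> $ j)\<^sup>2 / (I $ j - l2)) = 0"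
        by (auto simp: sphero_conical_chart_def)
      have "l1 = r1 \<or> l1 = r2" using sum[of l1] 0(1) l by simp
      moreover have "l2 = r1 \<or> l2 = r2" using sum[of l2] 0(2) l by simp
      ultimately show ?thesis using l r Pair by auto
    qed
  qed
  then have l: "l1 = r1" "l2 = r2" by (simp_all add: l1_def l2_def)
  show "l1 = (conical_sum I \<gamma> - sqrt (conical_discriminant I \<gamma>)) / 2"
    "l2 = (conical_sum I \<gamma> + sqrt (conical_discriminant I \<gamma>)) / 2"
    unfolding l r1_def r2_def s_def D_def by auto
  show "I$1 < l1" "l1 < I$2" "I$2 < l2" "l2 < I$3" using r r1 r2 l by auto
  have "(I$1 - l1) * (I$1 - l2) = (\<gamma>$1)\<^sup>2 * ((I$2 - I$1) * (I$3 - I$1))"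
    "(I$2 - l1) * (I$2 - l2) = (\<gamma>$2)\<^sup>2 * ((I$1 - I$2) * (I$3 - I$2))"
    "(I$3 - l1) * (I$3 - l2) = (\<gamma>$3)\<^sup>2 * ((I$1 - I$3) * (I$2 - I$3))"
    unfolding l q_roots[symmetric] q_def by simp_all
  with I show "(\<gamma>$1)\<^sup>2 = (I$1 - l1) * (I$1 - l2) / ((I$2 - I$1) * (I$3 - I$1))"
      "(\<gamma>$2)\<^sup>2 = (I$2 - l1) * (I$2 - l2) / ((I$1 - I$2) * (I$3 - I$2))"
      "(\<gamma>$3)\<^sup>2 = (I$3 - l1) * (I$3 - l2) / ((I$1 - I$3) * (I$2 - I$3))"
    by simp_all
qed

lemma sphero_conical_C2:
  fixes I :: "real^3" and \<gamma> :: "real \<Rightarrow> real^3"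
  assumes I: "I$1 < I$2" "I$2 < I$3" and J: "open J" and \<gamma>: "Ck_on 2 \<gamma> J" "\<gamma> ` J \<subseteq> open_octants"
  shows "Ck_on 2 (\<lambda>t. sphero_conical I (\<gamma> t)) J"
proof -
  have oct: "\<gamma> t \<in> open_octants" if "t \<in> J" for t using \<gamma>(2) that by blast
  have s: "Ck_on 2 (\<lambda>t. conical_sum I (\<gamma> t)) J"
    unfolding conical_sum_def by (intro Ck_on_add Ck_on_mult Ck_on_power2 Ck_on_nth Ck_on_const \<gamma>(1))
  then have D: "Ck_on 2 (\<lambda>t. conical_discriminant I (\<gamma> t)) J"
    unfolding conical_discriminant_def
    by (intro Ck_on_add Ck_on_diff Ck_on_mult Ck_on_power2 Ck_on_nth Ck_on_const \<gamma>(1))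
  have r: "Ck_on 2 (\<lambda>t. conical_discriminant I (\<gamma> t) powr (1/2)) J"
    by (rule Ck_on_powr[OF _ D]) (use sphero_conical_roots(1)[OF I oct] in auto)
  show ?thesis
  proof (rule Ck_on_cong_open[OF J])
    show "Ck_on 2 (\<lambda>t. ((conical_sum I (\<gamma> t) - conical_discriminant I (\<gamma> t) powr (1/2)) * (1/2),
        (conical_sum I (\<gamma> t) + conical_discriminant I (\<gamma> t) powr (1/2)) * (1/2))) J"
      by (intro Ck_on_Pair Ck_on_mult Ck_on_add Ck_on_diff Ck_on_const s r)
    show "((conical_sum I (\<gamma> t) - conical_discriminant I (\<gamma> t) powr (1/2)) * (1/2),
        (conical_sum I (\<gamma> t) + conical_discriminant I (\<gamma> t) powr (1/2)) * (1/2)) =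
        sphero_conical I (\<gamma> t)" if "t \<in> J" for t
      using sphero_conical_roots(1-3)[OF I oct[OF that]]
      by (simp add: powr_half_sqrt prod_eq_iff)
  qed
qed

text \<open>The logarithmic derivative of the formula for the squared component.\<close>

lemma conical_velocity:
  fixes g l1 l2 :: "real \<Rightarrow> real"
  assumes J: "open J" "t \<in> J" and k: "k \<noteq> 0"
    and sq: "\<And>t. t \<in> J \<Longrightarrow> (g t)\<^sup>2 = (c - l1 t) * (c - l2 t) / k"
    and nz: "g t \<noteq> 0" "c \<noteq> l1 t" "c \<noteq> l2 t"
    and d: "(g has_real_derivative g') (at t)" "(l1 has_real_derivative x) (at t)" "(l2 has_real_derivative y) (at t)"
  shows "g' = - (1/2) * g t * (x / (c - l1 t) + y / (c - l2 t))"
proof -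
  have "((\<lambda>t. (g t)\<^sup>2) has_real_derivative 2 * g t * g') (at t)"
    by (rule derivative_eq_intros d refl | simp)+
  moreover have "((\<lambda>t. (c - l1 t) * (c - l2 t) / k) has_real_derivative
      ((- x) * (c - l2 t) + (- y) * (c - l1 t)) / k) (at t)"
    by (rule derivative_eq_intros d refl | simp add: k)+
  then have "((\<lambda>t. (g t)\<^sup>2) has_real_derivative ((- x) * (c - l2 t) + (- y) * (c - l1 t)) / k) (at t)"
    by (rule has_field_derivative_transform_within_open[OF _ J]) (simp add: sq)
  ultimately have "2 * g t * g' = ((- x) * (c - l2 t) + (- y) * (c - l1 t)) / k"
    by (rule DERIV_unique)
  also have "\<dots> = - ((c - l1 t) * (c - l2 t) / k * (x / (c - l1 t) + y / (c - l2 t)))"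
    using nz k by (simp add: add_divide_distrib distrib_left distrib_right) (simp add: field_simps)
  also have "\<dots> = 2 * g t * (- (1/2) * g t * (x / (c - l1 t) + y / (c - l2 t)))"
    unfolding sq[OF J(2), symmetric] by (simp add: power2_eq_square)
  finally have "2 * g t * g' = 2 * g t * (- (1/2) * g t * (x / (c - l1 t) + y / (c - l2 t)))" .
  moreover have "2 * g t \<noteq> 0" using nz(1) by simp
  ultimately show ?thesis using mult_left_cancel by blast
qed

lemma conical_acceleration:
  fixes g l1 l2 :: "real \<Rightarrow> real"
  assumes J: "open J" "t \<in> J"
    and g1: "\<And>t. t \<in> J \<Longrightarrow> g1 t = - (1/2) * g t * (x t / (c - l1 t) + y t / (c - l2 t))"
    and nz: "c \<noteq> l1 t" "c \<noteq> l2 t"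
    and d: "(g has_real_derivative g1 t) (at t)" "(g1 has_real_derivative g2) (at t)"
      "(l1 has_real_derivative x t) (at t)" "(l2 has_real_derivative y t) (at t)"
      "(x has_real_derivative x2) (at t)" "(y has_real_derivative y2) (at t)"
  shows "g2 = - (1/2) * (g1 t * (x t / (c - l1 t) + y t / (c - l2 t)) +
     g t * (x2 / (c - l1 t) + y2 / (c - l2 t) + (x t)\<^sup>2 / (c - l1 t)\<^sup>2 + (y t)\<^sup>2 / (c - l2 t)\<^sup>2))"
proof -
  have q: "((\<lambda>t. f t / (c - l t)) has_real_derivative f2 / (c - l t) + (f t)\<^sup>2 / (c - l t)\<^sup>2) (at t)"
    if "c \<noteq> l t" "(l has_real_derivative f t) (at t)" "(f has_real_derivative f2) (at t)" for f f2 l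
  proof -
    have "((\<lambda>t. f t / (c - l t)) has_real_derivative (f2 * (c - l t) - f t * (0 - f t)) / ((c - l t) * (c - l t))) (at t)"
      by (intro DERIV_divide DERIV_diff DERIV_const that) (use that in simp)
    moreover have "(f2 * (c - l t) - f t * (0 - f t)) / ((c - l t) * (c - l t)) = f2 / (c - l t) + (f t)\<^sup>2 / (c - l t)\<^sup>2"
      using that(1) by (simp add: add_divide_distrib power2_eq_square)
    ultimately show ?thesis by simp
  qed
  have "((\<lambda>t. - (1/2) * g t * (x t / (c - l1 t) + y t / (c - l2 t))) has_real_derivative
     (- (1/2) * g1 t) * (x t / (c - l1 t) + y t / (c - l2 t)) +
     ((x2 / (c - l1 t) + (x t)\<^sup>2 / (c - l1 t)\<^sup>2) + (y2 / (c - l2 t) + (y t)\<^sup>2 / (c - l2 t)\<^sup>2)) * (- (1/2) * g t)) (at t)"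
    by (intro DERIV_mult DERIV_cmult DERIV_add q d nz)
  then have "(g1 has_real_derivative
     (- (1/2) * g1 t) * (x t / (c - l1 t) + y t / (c - l2 t)) +
     ((x2 / (c - l1 t) + (x t)\<^sup>2 / (c - l1 t)\<^sup>2) + (y2 / (c - l2 t) + (y t)\<^sup>2 / (c - l2 t)\<^sup>2)) * (- (1/2) * g t)) (at t)"
    by (rule has_field_derivative_transform_within_open[OF _ J]) (simp add: g1)
  from DERIV_unique[OF d(2) this] show ?thesis by (simp add: algebra_simps)
qed

text \<open>The cross product of \<open>T1 \<times> g\<close> and \<open>T2 \<times> g\<close> is a non-zero multiple of \<open>g\<close>. A vector orthogonal to both
  factors is therefore parallel to \<open>g\<close>.\<close>

lemma tangent_test_vectors:
  fixes g E T1 T2 :: "real^3"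
  assumes "g \<bullet> cross3 T1 T2 \<noteq> 0"
  shows "(\<forall>v. cross3 v g \<bullet> E = 0) \<longleftrightarrow> cross3 T1 g \<bullet> E = 0 \<and> cross3 T2 g \<bullet> E = 0"
proof
  assume 0: "cross3 T1 g \<bullet> E = 0 \<and> cross3 T2 g \<bullet> E = 0"
  show "\<forall>v. cross3 v g \<bullet> E = 0"
  proof
    fix v
    have "(g \<bullet> cross3 T1 T2) *\<^sub>R cross3 E g = cross3 E (cross3 (cross3 T1 g) (cross3 T2 g))"
      by (simp add: vec_eq_iff forall_3 cross3_def inner_vec_def sum_3 algebra_simps)
    also have "\<dots> = (cross3 T2 g \<bullet> E) *\<^sub>R cross3 T1 g - (cross3 T1 g \<bullet> E) *\<^sub>R cross3 T2 g"
      by (simp add: vec_eq_iff forall_3 cross3_def inner_vec_def sum_3 algebra_simps)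
    finally have "cross3 E g = 0" using 0 assms by simp
    moreover have "cross3 v g \<bullet> E = - (v \<bullet> cross3 E g)"
      by (simp add: cross3_def inner_vec_def sum_3 algebra_simps)
    ultimately show "cross3 v g \<bullet> E = 0" by simp
  qed
qed simp

text \<open>The coefficients of the metric on the sphere, up to the factor \<open>p\<^sup>2\<close>. Exchanging \<open>u\<close> and \<open>w\<close> changes the
  sign of the numerator and of the denominator, so that one formula serves for both coordinates.\<close>

definition conical_mass :: "real^3 \<Rightarrow> real \<Rightarrow> real \<Rightarrow> real \<Rightarrow> real" where
  "conical_mass I m u w = 1/4 * (w - u) * (w + m) / ((u - I$1) * (I$2 - u) * (I$3 - u))"

text \<open>The cofactor of \<open>p\<close> in \<open>conical_equation_of_motion\<close>. Exchanging the coordinates and their velocities gives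
  the equation along the second coordinate line.\<close>

definition conical_EL :: "real^3 \<Rightarrow> real \<Rightarrow> real \<Rightarrow> real \<Rightarrow> real \<Rightarrow> real \<Rightarrow> real \<Rightarrow> real \<Rightarrow> real" where
  "conical_EL I m p u w x y x2 =
     conical_mass I m u w * (x2 + 1/2 * (1 / (u - w) + (1 / (I$1 - u) + 1 / (I$2 - u) + 1 / (I$3 - u))) * x\<^sup>2
           + (1 / (w - u) + p / 2 / (w + m)) * x * y)
     - 1/2 * conical_mass I m w u * (1 / (u - w) + (p - 1) / (u + m)) * y\<^sup>2"

text \<open>The cross products of \<open>\<gamma>\<close> with the two coordinate vectors span its orthogonal complement, since the
  determinant of these three vectors is a non-zero multiple of \<open>\<gamma>$1 * \<gamma>$2 * \<gamma>$3 * (l1 - l2)\<close>. Hence two scalar equations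
  suffice, and they arise from one another by exchanging the coordinates.\<close>

lemma reduced_equation_iff:
  fixes I :: "real^3" and \<gamma> \<gamma>1 \<gamma>2 :: "real \<Rightarrow> real^3"
  assumes I: "0 < I$1" "I$1 < I$2" "I$2 < I$3" and m: "0 < m" and p: "p \<noteq> 0"
    and J: "open J" "t \<in> J" and oct: "\<And>t. t \<in> J \<Longrightarrow> \<gamma> t \<in> open_octants"
    and \<gamma>1: "\<And>t. t \<in> J \<Longrightarrow> (\<gamma> has_vector_derivative \<gamma>1 t) (at t)"
    and \<gamma>2: "\<And>t. t \<in> J \<Longrightarrow> (\<gamma>1 has_vector_derivative \<gamma>2 t) (at t)"
    and l: "\<And>t. t \<in> J \<Longrightarrow> l1 t = fst (sphero_conical I (\<gamma> t))" "\<And>t. t \<in> J \<Longrightarrow> l2 t = snd (sphero_conical I (\<gamma> t))"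
    and l': "\<And>t. t \<in> J \<Longrightarrow> (l1 has_real_derivative x t) (at t)" "\<And>t. t \<in> J \<Longrightarrow> (l2 has_real_derivative y t) (at t)"
      "(x has_real_derivative x2) (at t)" "(y has_real_derivative y2) (at t)"
  shows "(\<forall>v. cross3 v (\<gamma> t) \<bullet>
      (p *\<^sub>R (inertia I *v cross3 (\<gamma>2 t) (\<gamma> t) + m *\<^sub>R cross3 (\<gamma>2 t) (\<gamma> t)) +
       p\<^sup>2 *\<^sub>R cross3 (cross3 (\<gamma>1 t) (\<gamma> t)) (inertia I *v cross3 (\<gamma>1 t) (\<gamma> t))) = 0) \<longleftrightarrow>
     conical_EL I m p (l1 t) (l2 t) (x t) (y t) x2 = 0 \<and> conical_EL I m p (l2 t) (l1 t) (y t) (x t) y2 = 0"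
proof -
  have root: "I$1 < l1 t" "l1 t < I$2" "I$2 < l2 t" "l2 t < I$3"
    and G: "(\<gamma> t$1)\<^sup>2 = (I$1 - l1 t) * (I$1 - l2 t) / ((I$2 - I$1) * (I$3 - I$1))"
      "(\<gamma> t$2)\<^sup>2 = (I$2 - l1 t) * (I$2 - l2 t) / ((I$1 - I$2) * (I$3 - I$2))"
      "(\<gamma> t$3)\<^sup>2 = (I$3 - l1 t) * (I$3 - l2 t) / ((I$1 - I$3) * (I$2 - I$3))"
    if "t \<in> J" for t
    using sphero_conical_roots[OF I(2,3) oct[OF that]] l[OF that] by auto
  have nz: "I$j \<noteq> l1 t" "I$j \<noteq> l2 t" if "t \<in> J" for t j
  proof -
    have "\<forall>j. I$j \<noteq> l1 t \<and> I$j \<noteq> l2 t" unfolding forall_3 using root[OF that] by auto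
    then show "I$j \<noteq> l1 t" "I$j \<noteq> l2 t" by auto
  qed
  have g1: "((\<lambda>t. \<gamma> t$j) has_real_derivative \<gamma>1 t$j) (at t)"
    and g2: "((\<lambda>t. \<gamma>1 t$j) has_real_derivative \<gamma>2 t$j) (at t)" if "t \<in> J" for t j
    using bounded_linear.has_vector_derivative[OF bounded_linear_vec_nth \<gamma>1[OF that]]
      bounded_linear.has_vector_derivative[OF bounded_linear_vec_nth \<gamma>2[OF that]]
    by (simp_all add: has_real_derivative_iff_has_vector_derivative)
  have gnz: "\<gamma> t$j \<noteq> 0" if "t \<in> J" for t j using oct[OF that] by (simp add: open_octants_def)
  have G1: "\<gamma>1 t$j = - (1/2) * \<gamma> t$j * (x t / (I$j - l1 t) + y t / (I$j - l2 t))" if t: "t \<in> J" for t j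
  proof -
    have k: "(I$2 - I$1) * (I$3 - I$1) \<noteq> 0" "(I$1 - I$2) * (I$3 - I$2) \<noteq> 0" "(I$1 - I$3) * (I$2 - I$3) \<noteq> 0"
      using I by auto
    have "\<forall>j. \<gamma>1 t$j = - (1/2) * \<gamma> t$j * (x t / (I$j - l1 t) + y t / (I$j - l2 t))"
      unfolding forall_3
      using conical_velocity[OF J(1) t k(1) G(1) gnz[OF t] nz[OF t] g1[OF t] l'(1)[OF t] l'(2)[OF t]]
        conical_velocity[OF J(1) t k(2) G(2) gnz[OF t] nz[OF t] g1[OF t] l'(1)[OF t] l'(2)[OF t]]
        conical_velocity[OF J(1) t k(3) G(3) gnz[OF t] nz[OF t] g1[OF t] l'(1)[OF t] l'(2)[OF t]]
      by blast
    then show ?thesis by blast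
  qed
  have G2: "\<gamma>2 t$j = - (1/2) * (\<gamma>1 t$j * (x t / (I$j - l1 t) + y t / (I$j - l2 t)) +
        \<gamma> t$j * (x2 / (I$j - l1 t) + y2 / (I$j - l2 t) + (x t)\<^sup>2 / (I$j - l1 t)\<^sup>2 + (y t)\<^sup>2 / (I$j - l2 t)\<^sup>2))" for j
    by (rule conical_acceleration[OF J G1 nz[OF J(2)] g1[OF J(2)] g2[OF J(2)] l'(1)[OF J(2)] l'(2)[OF J(2)] l'(3,4)])
  define T1 where "T1 = (\<chi> j. - (1/2) * \<gamma> t$j / (I$j - l1 t))"
  define T2 where "T2 = (\<chi> j. - (1/2) * \<gamma> t$j / (I$j - l2 t))"
  have T: "T1$j = - (1/2) * \<gamma> t$j / (I$j - l1 t)" "T2$j = - (1/2) * \<gamma> t$j / (I$j - l2 t)" for j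
    by (simp_all add: T1_def T2_def)
  have dist: "I$1 \<noteq> I$2" "I$1 \<noteq> I$3" "I$2 \<noteq> I$3" using I by auto
  have lnz: "l1 t \<noteq> l2 t" "l1 t + m \<noteq> 0" "l2 t + m \<noteq> 0" using root[OF J(2)] I m by auto
  note GJ = G[OF J(2)] and nzJ = nz[OF J(2)]
  let ?E = "p *\<^sub>R (inertia I *v cross3 (\<gamma>2 t) (\<gamma> t) + m *\<^sub>R cross3 (\<gamma>2 t) (\<gamma> t)) +
       p\<^sup>2 *\<^sub>R cross3 (cross3 (\<gamma>1 t) (\<gamma> t)) (inertia I *v cross3 (\<gamma>1 t) (\<gamma> t))"
  have 1: "cross3 T1 (\<gamma> t) \<bullet> ?E = p * conical_EL I m p (l1 t) (l2 t) (x t) (y t) x2"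
    unfolding conical_EL_def conical_mass_def
    by (rule conical_equation_of_motion[OF dist nzJ lnz GJ G1[OF J(2)] G2 T(1)])
  have 2: "cross3 T2 (\<gamma> t) \<bullet> ?E = p * conical_EL I m p (l2 t) (l1 t) (y t) (x t) y2"
    unfolding conical_EL_def conical_mass_def
  proof (rule conical_equation_of_motion[OF dist nzJ(2,1) lnz(1)[symmetric] lnz(3,2) _ _ _ _ _ T(2)])
    show "\<gamma>1 t$j = - (1/2) * \<gamma> t$j * (y t / (I$j - l2 t) + x t / (I$j - l1 t))" for j
      using G1[OF J(2), of j] by (simp add: add.commute)
    show "\<gamma>2 t$j = - (1/2) * (\<gamma>1 t$j * (y t / (I$j - l2 t) + x t / (I$j - l1 t)) +
        \<gamma> t$j * (y2 / (I$j - l2 t) + x2 / (I$j - l1 t) + (y t)\<^sup>2 / (I$j - l2 t)\<^sup>2 + (x t)\<^sup>2 / (I$j - l1 t)\<^sup>2))" for j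
      unfolding G2[of j] by (simp add: add_ac)
  qed (use GJ in \<open>simp_all add: mult.commute mult.left_commute\<close>)
  have "\<gamma> t \<bullet> cross3 T1 T2 \<noteq> 0"
  proof -
    define n1 n2 n3 where n_def: "n1 = I$1 - l1 t" "n2 = I$2 - l1 t" "n3 = I$3 - l1 t"
    define k1 k2 k3 where k_def: "k1 = I$1 - l2 t" "k2 = I$2 - l2 t" "k3 = I$3 - l2 t"
    have nk: "n1 \<noteq> 0" "n2 \<noteq> 0" "n3 \<noteq> 0" "k1 \<noteq> 0" "k2 \<noteq> 0" "k3 \<noteq> 0"
      using nzJ by (auto simp: n_def k_def)
    have TT: "T1$1 = - (1/2) * \<gamma> t$1 / n1" "T1$2 = - (1/2) * \<gamma> t$2 / n2" "T1$3 = - (1/2) * \<gamma> t$3 / n3"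
      "T2$1 = - (1/2) * \<gamma> t$1 / k1" "T2$2 = - (1/2) * \<gamma> t$2 / k2" "T2$3 = - (1/2) * \<gamma> t$3 / k3"
      by (simp_all add: T n_def k_def)
    have "\<gamma> t \<bullet> cross3 T1 T2 = 1/4 * (\<gamma> t$1 * \<gamma> t$2 * \<gamma> t$3) *
        ((1 / (n2 * k3) - 1 / (n3 * k2)) + (1 / (n3 * k1) - 1 / (n1 * k3)) + (1 / (n1 * k2) - 1 / (n2 * k1)))"
      unfolding inner_vec_def sum_3 cross3_def TT by (simp add: algebra_simps)
    also have "(1 / (n2 * k3) - 1 / (n3 * k2)) + (1 / (n3 * k1) - 1 / (n1 * k3)) + (1 / (n1 * k2) - 1 / (n2 * k1)) =
        (n1 * n3 * k1 * k2 - n1 * n2 * k1 * k3 + (n1 * n2 * k2 * k3 - n2 * n3 * k1 * k2) + (n2 * n3 * k1 * k3 - n1 * n3 * k2 * k3))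
        / (n1 * n2 * n3 * k1 * k2 * k3)"
      using nk by (simp add: add_divide_distrib diff_divide_distrib)
    also have "n1 * n3 * k1 * k2 - n1 * n2 * k1 * k3 + (n1 * n2 * k2 * k3 - n2 * n3 * k1 * k2) + (n2 * n3 * k1 * k3 - n1 * n3 * k2 * k3) =
        (l1 t - l2 t) * (I$1 - I$2) * (I$2 - I$3) * (I$3 - I$1)"
      unfolding n_def k_def by (simp add: algebra_simps)
    finally show ?thesis using nk gnz[OF J(2)] dist lnz(1) by simp
  qed
  from tangent_test_vectors[OF this, of ?E] show ?thesis
    unfolding 1 2 using p by simp
qed

section \<open>The Hamiltonian system\<close>

text \<open>Metric coefficients and time factor are products of powers of linear functions, and for these the
  logarithmic derivative \<open>\<phi>\<close> is just a sum.\<close>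

definition has_logderiv :: "(real \<Rightarrow> real) \<Rightarrow> real \<Rightarrow> real \<Rightarrow> bool" where
  "has_logderiv f \<phi> t \<longleftrightarrow> (f has_real_derivative f t * \<phi>) (at t)"

lemma has_logderivI: "(f has_real_derivative f') (at t) \<Longrightarrow> f t \<noteq> 0 \<Longrightarrow> has_logderiv f (f' / f t) t"
  by (simp add: has_logderiv_def)

lemma has_logderiv_mult:
  "has_logderiv f \<phi> t \<Longrightarrow> has_logderiv g \<psi> t \<Longrightarrow> has_logderiv (\<lambda>t. f t * g t) (\<phi> + \<psi>) t"
  unfolding has_logderiv_def by (drule (1) DERIV_mult) (simp add: algebra_simps)

lemma has_logderiv_inverse:
  assumes "has_logderiv f \<phi> t" "f t \<noteq> 0"
  shows "has_logderiv (\<lambda>t. inverse (f t)) (- \<phi>) t"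
proof -
  have "((\<lambda>t. inverse (f t)) has_real_derivative - (f t * \<phi> * inverse ((f t)\<^sup>2))) (at t)"
    using DERIV_inverse_fun[of f "f t * \<phi>" t UNIV] assms by (simp add: has_logderiv_def power2_eq_square)
  moreover have "- (f t * \<phi> * inverse ((f t)\<^sup>2)) = inverse (f t) * - \<phi>"
    using assms(2) by (simp add: power2_eq_square)
  ultimately show ?thesis by (simp only: has_logderiv_def)
qed

lemma has_logderiv_divide:
  "has_logderiv f \<phi> t \<Longrightarrow> has_logderiv g \<psi> t \<Longrightarrow> g t \<noteq> 0 \<Longrightarrow> has_logderiv (\<lambda>t. f t / g t) (\<phi> - \<psi>) t"
  using has_logderiv_mult[OF _ has_logderiv_inverse] by (simp add: divide_inverse)

lemma has_logderiv_powr: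
  assumes "has_logderiv f \<phi> t" "f t > 0"
  shows "has_logderiv (\<lambda>t. f t powr r) (r * \<phi>) t"
proof -
  have "((\<lambda>t. f t powr r) has_real_derivative r * f t powr (r - of_nat 1) * (f t * \<phi>)) (at t)"
    using assms by (intro DERIV_fun_powr) (auto simp: has_logderiv_def)
  moreover have "f t powr (r - 1) = f t powr r / f t"
    using assms(2) by (simp add: powr_diff)
  ultimately show ?thesis using assms(2) by (simp add: has_logderiv_def mult_ac)
qed

lemma has_logderiv_const: "has_logderiv (\<lambda>t. c) 0 t"
  by (simp add: has_logderiv_def)

text \<open>The metric coefficients of the Hamiltonian: the exponent \<open>(b - a) / a\<close> is \<open>p - 2\<close>.\<close>

definition scaled_mass :: "real^3 \<Rightarrow> real \<Rightarrow> real \<Rightarrow> real \<Rightarrow> real \<Rightarrow> real" where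
  "scaled_mass I m p u w = ((u + m) * (w + m)) powr (p - 2) * (p\<^sup>2 * conical_mass I m u w)"

text \<open>The logarithmic derivative of \<open>scaled_mass\<close> in the direction \<open>(x, y)\<close>; the directions \<open>(1, 0)\<close> and
  \<open>(0, 1)\<close> give the partial derivatives in the Hamiltonian vector field.\<close>

definition mass_logderiv :: "real^3 \<Rightarrow> real \<Rightarrow> real \<Rightarrow> real \<Rightarrow> real \<Rightarrow> real \<Rightarrow> real \<Rightarrow> real" where
  "mass_logderiv I m p u w x y =
     ((p - 2) / (u + m) + 1 / (u - w) + (1 / (I$1 - u) + 1 / (I$2 - u) + 1 / (I$3 - u))) * x
     + ((p - 1) / (w + m) + 1 / (w - u)) * y"

lemma scaled_mass_logderiv:
  assumes d: "(u has_real_derivative x) (at t)" "(w has_real_derivative y) (at t)"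
    and nz: "u t + m > 0" "w t + m > 0" "u t \<noteq> w t" "I$1 \<noteq> u t" "I$2 \<noteq> u t" "I$3 \<noteq> u t"
  shows "has_logderiv (\<lambda>t. scaled_mass I m p (u t) (w t)) (mass_logderiv I m p (u t) (w t) x y) t"
proof -
  have lin: "has_logderiv (\<lambda>t. u t + m) (x / (u t + m)) t" "has_logderiv (\<lambda>t. w t + m) (y / (w t + m)) t"
    "has_logderiv (\<lambda>t. w t - u t) ((y - x) / (w t - u t)) t"
    "has_logderiv (\<lambda>t. u t - I$1) (x / (u t - I$1)) t"
    "has_logderiv (\<lambda>t. I$2 - u t) (- x / (I$2 - u t)) t"
    "has_logderiv (\<lambda>t. I$3 - u t) (- x / (I$3 - u t)) t"
    by (rule has_logderivI; (rule derivative_eq_intros d refl | use nz in simp)+)+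
  have "has_logderiv (\<lambda>t. scaled_mass I m p (u t) (w t))
     ((p - 2) * (x / (u t + m) + y / (w t + m)) +
      (0 + (0 + (y - x) / (w t - u t) + y / (w t + m) -
        (x / (u t - I$1) + - x / (I$2 - u t) + - x / (I$3 - u t))))) t"
    unfolding scaled_mass_def conical_mass_def
    by (intro has_logderiv_mult has_logderiv_powr has_logderiv_divide has_logderiv_const lin)
      (use nz in \<open>auto intro: mult_pos_pos\<close>)
  moreover have "(p - 2) * (x / (u t + m) + y / (w t + m)) +
      (0 + (0 + (y - x) / (w t - u t) + y / (w t + m) -
        (x / (u t - I$1) + - x / (I$2 - u t) + - x / (I$3 - u t)))) = mass_logderiv I m p (u t) (w t) x y"
  proof -
    have e: "z / (w t - u t) = - (z / (u t - w t))" "z / (u t - I$1) = - (z / (I$1 - u t))" for z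
      using minus_divide_right[of z "u t - w t"] minus_divide_right[of z "I$1 - u t"] by simp_all
    show ?thesis
      unfolding mass_logderiv_def e
      by (simp add: diff_divide_distrib algebra_simps)
  qed
  ultimately show ?thesis by simp
qed

definition time_factor :: "real \<Rightarrow> real \<Rightarrow> real \<Rightarrow> real \<Rightarrow> real" where
  "time_factor m p u w = (p\<^sup>2 * (u + m) * (w + m)) powr ((p - 2) / 2)"

lemma time_factor_logderiv:
  assumes d: "(u has_real_derivative x) (at t)" "(w has_real_derivative y) (at t)"
    and nz: "u t + m > 0" "w t + m > 0" "p \<noteq> 0"
  shows "has_logderiv (\<lambda>t. time_factor m p (u t) (w t)) ((p - 2) / 2 * (x / (u t + m) + y / (w t + m))) t"
proof -
  have lin: "has_logderiv (\<lambda>t. u t + m) (x / (u t + m)) t" "has_logderiv (\<lambda>t. w t + m) (y / (w t + m)) t"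
    by (rule has_logderivI; (rule derivative_eq_intros d refl | use nz in simp)+)+
  have "has_logderiv (\<lambda>t. time_factor m p (u t) (w t)) ((p - 2) / 2 * (0 + x / (u t + m) + y / (w t + m))) t"
    unfolding time_factor_def
    by (intro has_logderiv_mult has_logderiv_powr has_logderiv_const lin) (use nz in simp)
  then show ?thesis by simp
qed

lemma hamiltonian_vf_diagonal:
  assumes H: "\<And>u w P Q. H ((u, w), (P, Q)) = 1/2 * (P\<^sup>2 / M u w + Q\<^sup>2 / M w u)"
    and nz: "M u w \<noteq> 0" "M w u \<noteq> 0"
    and d1: "has_logderiv (\<lambda>u. M u w) \<phi>1 u" "has_logderiv (\<lambda>u. M w u) \<psi>1 u"
    and d2: "has_logderiv (\<lambda>w. M u w) \<phi>2 w" "has_logderiv (\<lambda>w. M w u) \<psi>2 w"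
  shows "hamiltonian_vf H ((u, w), (P, Q)) =
    ((P / M u w, Q / M w u),
     (1/2 * (P\<^sup>2 / M u w * \<phi>1 + Q\<^sup>2 / M w u * \<psi>1), 1/2 * (P\<^sup>2 / M u w * \<phi>2 + Q\<^sup>2 / M w u * \<psi>2)))"
proof -
  have p1: "deriv (\<lambda>p. H ((u, w), (p, Q))) P = P / M u w"
    unfolding H by (rule DERIV_imp_deriv) (rule derivative_eq_intros refl | use nz in simp)+
  have p2: "deriv (\<lambda>p. H ((u, w), (P, p))) Q = Q / M w u"
    unfolding H by (rule DERIV_imp_deriv) (rule derivative_eq_intros refl | use nz in simp)+
  have inv: "((\<lambda>v. z / f v) has_real_derivative - (z / f v * \<phi>)) (at v)"
    if "has_logderiv f \<phi> v" "f v \<noteq> 0" for z \<phi> v and f :: "real \<Rightarrow> real"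
    using has_logderiv_divide[OF has_logderiv_const[of z] that] by (simp add: has_logderiv_def)
  have x: "deriv (\<lambda>v. 1/2 * (P\<^sup>2 / f v + Q\<^sup>2 / g v)) v = - (1/2 * (P\<^sup>2 / f v * \<phi> + Q\<^sup>2 / g v * \<psi>))"
    if "has_logderiv f \<phi> v" "f v \<noteq> 0" "has_logderiv g \<psi> v" "g v \<noteq> 0" for f g v \<phi> \<psi>
  proof (rule DERIV_imp_deriv)
    show "((\<lambda>v. 1/2 * (P\<^sup>2 / f v + Q\<^sup>2 / g v)) has_real_derivative
        - (1/2 * (P\<^sup>2 / f v * \<phi> + Q\<^sup>2 / g v * \<psi>))) (at v)"
    proof -
      have "1/2 * (- A + - B) = - (1/2 * (A + B))" for A B :: real
        by (simp only: distrib_left mult_minus_right minus_add_distrib)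
      then show ?thesis
        using DERIV_cmult[OF DERIV_add[OF inv[OF that(1,2), of "P\<^sup>2"] inv[OF that(3,4), of "Q\<^sup>2"]], of "1/2"]
        by (simp only:)
    qed
  qed
  have x1: "- deriv (\<lambda>x. H ((x, w), (P, Q))) u = 1/2 * (P\<^sup>2 / M u w * \<phi>1 + Q\<^sup>2 / M w u * \<psi>1)"
    unfolding H x[OF d1(1) nz(1) d1(2) nz(2)] by simp
  have x2: "- deriv (\<lambda>x. H ((u, x), (P, Q))) w = 1/2 * (P\<^sup>2 / M u w * \<phi>2 + Q\<^sup>2 / M w u * \<psi>2)"
    unfolding H x[OF d2(1) nz(1) d2(2) nz(2)] by simp
  show ?thesis
    unfolding hamiltonian_vf_def prod.case p1 p2 x1 x2 ..
qed

text \<open>The heart of the Hamiltonization. Both sides of Hamilton's equation for the first momentum contain the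
  conformal factor \<open>((u + m) * (w + m)) powr (p - 2)\<close> divided by \<open>N\<close>. Once this is
  cancelled, the rate of change of the conformal factor is left on one side and its gradient on the other. The difference is a quadratic form in the velocities, and it equals the
  gyroscopic terms in \<open>conical_EL\<close> precisely because \<open>M\<close> contains the power \<open>p - 2\<close> and the time factor \<open>N\<close> the power
  \<open>(p - 2) / 2\<close> of the same function.\<close>

lemma momentum_equation_iff:
  assumes d: "(u has_real_derivative x t) (at t)" "(w has_real_derivative y t) (at t)"
    "(x has_real_derivative x2) (at t)"
    and nz: "u t + m > 0" "w t + m > 0" "u t \<noteq> w t" "I$1 \<noteq> u t" "I$2 \<noteq> u t" "I$3 \<noteq> u t" "p \<noteq> 0"
  defines "M \<equiv> scaled_mass I m p" and "N \<equiv> time_factor m p"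
  shows "\<exists>P'. ((\<lambda>t. M (u t) (w t) * x t / N (u t) (w t)) has_real_derivative P') (at t) \<and>
     (P' = N (u t) (w t) * (1/2 * ((M (u t) (w t) * x t / N (u t) (w t))\<^sup>2 / M (u t) (w t) * mass_logderiv I m p (u t) (w t) 1 0
        + (M (w t) (u t) * y t / N (u t) (w t))\<^sup>2 / M (w t) (u t) * mass_logderiv I m p (w t) (u t) 0 1))
      \<longleftrightarrow> conical_EL I m p (u t) (w t) (x t) (y t) x2 = 0)"
proof -
  define n where "n = N (u t) (w t)"
  define G where "G = ((u t + m) * (w t + m)) powr (p - 2)"
  define c1 where "c1 = conical_mass I m (u t) (w t)"
  define c2 where "c2 = conical_mass I m (w t) (u t)"
  define L where "L = mass_logderiv I m p (u t) (w t) (x t) (y t) - (p - 2) / 2 * (x t / (u t + m) + y t / (w t + m))"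
  have npos: "n > 0" using nz by (simp add: n_def N_def time_factor_def)
  have Gpos: "G > 0" using nz by (simp add: G_def)
  have M1: "M (u t) (w t) = G * (p\<^sup>2 * c1)" and M2: "M (w t) (u t) = G * (p\<^sup>2 * c2)"
    by (simp_all add: M_def scaled_mass_def G_def c1_def c2_def mult.commute)
  have "has_logderiv (\<lambda>t. M (u t) (w t) / N (u t) (w t)) L t"
    unfolding L_def M_def N_def
    by (intro has_logderiv_divide scaled_mass_logderiv time_factor_logderiv d nz)
      (use npos in \<open>simp add: n_def N_def\<close>)
  then have "((\<lambda>t. M (u t) (w t) / N (u t) (w t)) has_real_derivative M (u t) (w t) / n * L) (at t)"
    by (simp add: has_logderiv_def n_def)
  from DERIV_mult[OF this d(3)]
  have deriv: "((\<lambda>t. M (u t) (w t) * x t / N (u t) (w t)) has_real_derivative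
      M (u t) (w t) / n * L * x t + x2 * (M (u t) (w t) / n)) (at t)"
    by (simp add: n_def)
  have sq: "n * (1/2 * ((A * x t / n)\<^sup>2 / A * r + (B * y t / n)\<^sup>2 / B * s)) =
      (1/2 * (A * (x t)\<^sup>2 * r + B * (y t)\<^sup>2 * s)) / n" for A B r s
    using npos by (simp add: power2_eq_square field_simps)
  have "M (u t) (w t) / n * L * x t + x2 * (M (u t) (w t) / n) -
      (1/2 * (M (u t) (w t) * (x t)\<^sup>2 * mass_logderiv I m p (u t) (w t) 1 0
        + M (w t) (u t) * (y t)\<^sup>2 * mass_logderiv I m p (w t) (u t) 0 1)) / n =
    (G * p\<^sup>2 / n) * (c1 * (L * x t + x2) - 1/2 * (c1 * (x t)\<^sup>2 * mass_logderiv I m p (u t) (w t) 1 0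
        + c2 * (y t)\<^sup>2 * mass_logderiv I m p (w t) (u t) 0 1))"
    unfolding M1 M2 using npos by (simp add: field_simps)
  also have "c1 * (L * x t + x2) - 1/2 * (c1 * (x t)\<^sup>2 * mass_logderiv I m p (u t) (w t) 1 0
        + c2 * (y t)\<^sup>2 * mass_logderiv I m p (w t) (u t) 0 1) =
      conical_EL I m p (u t) (w t) (x t) (y t) x2"
  proof -
    \<comment> \<open>In terms of these reciprocals the claim is a polynomial identity.\<close>
    define r0 r1 r2 s where r_def: "r0 = 1 / (u t - w t)" "r1 = 1 / (u t + m)" "r2 = 1 / (w t + m)"
      "s = 1 / (I$1 - u t) + 1 / (I$2 - u t) + 1 / (I$3 - u t)"
    have r: "z / (u t - w t) = z * r0" "z / (w t - u t) = - (z * r0)" "z / (u t + m) = z * r1" "z / (w t + m) = z * r2" for z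
      using minus_divide_right[of z "u t - w t"] by (simp_all add: r_def)
    show ?thesis
      unfolding L_def mass_logderiv_def conical_EL_def c1_def[symmetric] c2_def[symmetric] r_def(4)[symmetric] r
      by (simp add: power2_eq_square field_simps)
  qed
  finally have eq: "M (u t) (w t) / n * L * x t + x2 * (M (u t) (w t) / n) -
      (1/2 * (M (u t) (w t) * (x t)\<^sup>2 * mass_logderiv I m p (u t) (w t) 1 0
        + M (w t) (u t) * (y t)\<^sup>2 * mass_logderiv I m p (w t) (u t) 0 1)) / n =
    (G * p\<^sup>2 / n) * conical_EL I m p (u t) (w t) (x t) (y t) x2" .
  have "G * p\<^sup>2 / n \<noteq> 0" using Gpos npos nz by simp
  with eq have "M (u t) (w t) / n * L * x t + x2 * (M (u t) (w t) / n) =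
      (1/2 * (M (u t) (w t) * (x t)\<^sup>2 * mass_logderiv I m p (u t) (w t) 1 0
        + M (w t) (u t) * (y t)\<^sup>2 * mass_logderiv I m p (w t) (u t) 0 1)) / n \<longleftrightarrow>
      conical_EL I m p (u t) (w t) (x t) (y t) x2 = 0"
    by (metis mult_eq_0_iff right_minus_eq)
  with deriv show ?thesis unfolding n_def[symmetric] sq by blast
qed

section \<open>Change of time\<close>

text \<open>The new time is strictly increasing, so that it has a differentiable inverse and the chain rule
  applies in both directions.\<close>

lemma integral_curve_time_change:
  fixes X :: "'a::real_normed_vector \<Rightarrow> 'a" and z :: "real \<Rightarrow> 'a" and \<tau> n :: "real \<Rightarrow> real"
  assumes J: "open J" "is_interval J"
    and \<tau>: "\<And>t. t \<in> J \<Longrightarrow> (\<tau> has_real_derivative n t) (at t)" and n: "\<And>t. t \<in> J \<Longrightarrow> n t > 0"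
  shows "(\<forall>t\<in>J. (z has_vector_derivative n t *\<^sub>R X (z t)) (at t)) \<longleftrightarrow>
    integral_curve X (\<lambda>s. z (inv_into J \<tau> s)) (\<tau> ` J)"
proof -
  have less: "\<tau> s < \<tau> t" if "s \<in> J" "t \<in> J" "s < t" for s t
  proof -
    have "{s..t} \<subseteq> J" using J(2) that by (meson atLeastAtMost_iff mem_is_interval_1_I subsetI)
    then show ?thesis
      using that(3) \<tau> n by (intro DERIV_pos_imp_increasing[OF that(3)]) (metis atLeastAtMost_iff subsetD)
  qed
  have inj: "inj_on \<tau> J"
    using less by (intro inj_onI) (metis less_irrefl linorder_neqE_linordered_idom)
  define \<sigma> where "\<sigma> = inv_into J \<tau>"
  have \<sigma>: "\<sigma> (\<tau> t) = t" if "t \<in> J" for t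
    unfolding \<sigma>_def by (rule inv_into_f_f[OF inj that])
  have \<tau>c: "continuous_on J \<tau>"
    using \<tau> by (intro continuous_at_imp_continuous_on) (auto dest: DERIV_isCont)
  have \<sigma>': "(\<sigma> has_real_derivative inverse (n t)) (at (\<tau> t))" if "t \<in> J" for t
    unfolding has_field_derivative_def
    by (rule has_derivative_inverse_strong[OF J(1) that \<tau>c \<sigma> \<tau>[OF that, unfolded has_field_derivative_def]])
      (use n[OF that] in \<open>auto simp: fun_eq_iff\<close>)
  show ?thesis
    unfolding integral_curve_def \<sigma>_def[symmetric]
  proof
    assume z: "\<forall>t\<in>J. (z has_vector_derivative n t *\<^sub>R X (z t)) (at t)"
    show "\<forall>s\<in>\<tau> ` J. ((\<lambda>s. z (\<sigma> s)) has_vector_derivative X (z (\<sigma> s))) (at s)"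
    proof
      fix s assume "s \<in> \<tau> ` J"
      then obtain t where t: "t \<in> J" "s = \<tau> t" by blast
      have "(\<sigma> has_vector_derivative inverse (n t)) (at (\<tau> t))"
        using \<sigma>'[OF t(1)] by (simp add: has_real_derivative_iff_has_vector_derivative)
      moreover have "(z has_vector_derivative n t *\<^sub>R X (z t)) (at (\<sigma> (\<tau> t)))"
        using z t(1) by (simp add: \<sigma>)
      ultimately have "(z \<circ> \<sigma> has_vector_derivative inverse (n t) *\<^sub>R n t *\<^sub>R X (z t)) (at (\<tau> t))"
        by (rule vector_diff_chain_at)
      then show "((\<lambda>s. z (\<sigma> s)) has_vector_derivative X (z (\<sigma> s))) (at s)"
        using n[OF t(1)] by (simp add: o_def t \<sigma>)
    qed
  next
    assume z: "\<forall>s\<in>\<tau> ` J. ((\<lambda>s. z (\<sigma> s)) has_vector_derivative X (z (\<sigma> s))) (at s)"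
    show "\<forall>t\<in>J. (z has_vector_derivative n t *\<^sub>R X (z t)) (at t)"
    proof
      fix t assume t: "t \<in> J"
      have "(\<tau> has_vector_derivative n t) (at t)"
        using \<tau>[OF t] by (simp add: has_real_derivative_iff_has_vector_derivative)
      moreover have "((\<lambda>s. z (\<sigma> s)) has_vector_derivative X (z t)) (at (\<tau> t))"
        using z t \<sigma>[OF t] by force
      ultimately have "((\<lambda>s. z (\<sigma> s)) \<circ> \<tau> has_vector_derivative n t *\<^sub>R X (z t)) (at t)"
        by (rule vector_diff_chain_at)
      then show "(z has_vector_derivative n t *\<^sub>R X (z t)) (at t)"
        by (rule has_vector_derivative_transform_within_open[OF _ J(1) t]) (simp add: \<sigma>)
    qed
  qed
qed

section \<open>Hamiltonization\<close>

text \<open>By Hamilton's first equation the momenta are the metric coefficients times the velocities in the new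
  time, and these are the velocities in the old time divided by the time factor.\<close>

definition rubber_momentum ::
  "real \<Rightarrow> real \<Rightarrow> real \<Rightarrow> real^3 \<Rightarrow> real \<times> real \<Rightarrow> real \<times> real \<Rightarrow> real \<times> real" where
  "rubber_momentum a b \<mu> I = (\<lambda>(u, w) (x, y).
     let m = \<mu> * b\<^sup>2; p = 1 + b/a; N = time_factor m p u w
     in (scaled_mass I m p u w * x / N, scaled_mass I m p w u * y / N))"

locale rubber_rolling =
  fixes a b \<mu> :: real and I :: "real^3"
  assumes a: "a > 0" "b \<noteq> 0" "b \<noteq> - a" and \<mu>: "\<mu> > 0"
    and I: "0 < I $ 1" "I $ 1 < I $ 2" "I $ 2 < I $ 3"
begin

definition "m = \<mu> * b\<^sup>2"
definition "p = 1 + b / a"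

lemma parameter_facts: "m > 0" "p \<noteq> 0" "(b - a) / a = p - 2" "(b - a) / (2 * a) = (p - 2) / 2"
  using a \<mu> by (auto simp: m_def p_def field_simps)

lemma chart_bounds:
  assumes "(u, w) \<in> sphero_conical_chart I"
  shows "u + m > 0" "w + m > 0" "u \<noteq> w" "u < w" "I$1 < u" "u < I$2" "I$2 < w" "w < I$3"
    "time_factor m p u w > 0" "time_factor m p w u > 0" "scaled_mass I m p u w > 0" "scaled_mass I m p w u > 0"
proof -
  show c: "I$1 < u" "u < I$2" "I$2 < w" "w < I$3"
    using assms by (auto simp: sphero_conical_chart_def)
  show um: "u + m > 0" "w + m > 0" "u \<noteq> w" "u < w" using c I parameter_facts(1) by auto
  show "time_factor m p u w > 0" "time_factor m p w u > 0"
    using um parameter_facts(2) by (auto simp: time_factor_def)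
  have "conical_mass I m u w > 0" using um c by (simp add: conical_mass_def)
  moreover have "conical_mass I m w u > 0"
  proof -
    have "(u - w) * (u + m) < 0" using um by (simp add: mult_neg_pos)
    moreover have "(w - I$1) * (I$2 - w) < 0" using c by (simp add: mult_pos_neg)
    then have "(w - I$1) * (I$2 - w) * (I$3 - w) < 0" using c by (simp add: mult_neg_pos)
    ultimately have "(u - w) * (u + m) / ((w - I$1) * (I$2 - w) * (I$3 - w)) > 0" by (rule divide_neg_neg)
    then have "1/4 * ((u - w) * (u + m) / ((w - I$1) * (I$2 - w) * (I$3 - w))) > 0"
      by (rule mult_pos_pos[rotated]) simp
    then show ?thesis by (simp only: conical_mass_def mult.assoc times_divide_eq_right)
  qed
  moreover have "((u + m) * (w + m)) powr (p - 2) > 0" "((w + m) * (u + m)) powr (p - 2) > 0"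
    using um by auto
  ultimately show "scaled_mass I m p u w > 0" "scaled_mass I m p w u > 0"
    using parameter_facts(2) by (auto simp: scaled_mass_def)
qed

lemma momentum_eq:
  "rubber_momentum a b \<mu> I (u, w) (x, y) =
    (scaled_mass I m p u w * x / time_factor m p u w, scaled_mass I m p w u * y / time_factor m p u w)"
  by (simp add: rubber_momentum_def Let_def m_def p_def)

lemma conformal_eq: "conformal_F a b \<mu> (u, w) powr ((b - a) / (2 * a)) = time_factor m p u w"
  unfolding parameter_facts by (simp add: conformal_F_def time_factor_def m_def p_def)

lemma hamiltonian_eq:
  "rubber_hamiltonian a b \<mu> I ((u, w), (P, Q)) =
    1/2 * (P\<^sup>2 / scaled_mass I m p u w + Q\<^sup>2 / scaled_mass I m p w u)"
proof -
  have "(w - u) * ((u + m) / ((w - I$1) * (w - I$2) * (I$3 - w))) =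
      (u - w) * (u + m) / ((w - I$1) * (I$2 - w) * (I$3 - w))"
  proof -
    have "(w - I$1) * (w - I$2) * (I$3 - w) = - ((w - I$1) * (I$2 - w) * (I$3 - w))"
      by (simp add: algebra_simps)
    moreover have "(w - u) * (u + m) = - ((u - w) * (u + m))" by (simp add: algebra_simps)
    ultimately show ?thesis by (simp del: minus_mult_left)
  qed
  note swap = this
  have "1/4 * p\<^sup>2 * (w - u) * ((u + m) / ((w - I$1) * (w - I$2) * (I$3 - w))) =
      p\<^sup>2 * (1/4 * ((w - u) * ((u + m) / ((w - I$1) * (w - I$2) * (I$3 - w)))))" by simp
  also have "\<dots> = p\<^sup>2 * conical_mass I m w u"
    unfolding swap by (simp add: conical_mass_def)
  finally have c2: "1/4 * p\<^sup>2 * (w - u) * ((u + m) / ((w - I$1) * (w - I$2) * (I$3 - w))) =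
      p\<^sup>2 * conical_mass I m w u" .
  have c1: "1/4 * p\<^sup>2 * (w - u) * ((w + m) / ((u - I$1) * (I$2 - u) * (I$3 - u))) = p\<^sup>2 * conical_mass I m u w"
    by (simp add: conical_mass_def)
  show ?thesis
    unfolding rubber_hamiltonian_def prod.case Let_def parameter_facts(3) m_def[symmetric] p_def[symmetric] c1 c2 scaled_mass_def
    by (simp add: mult.commute)
qed

lemma momentum_coordinates_rubber: "momentum_coordinates I (rubber_momentum a b \<mu> I)"
  unfolding momentum_coordinates_def
proof (intro conjI ballI allI)
  fix l assume "l \<in> sphero_conical_chart I"
  then obtain u w where l: "l = (u, w)" "(u, w) \<in> sphero_conical_chart I" by (cases l) auto
  define k1 where "k1 = scaled_mass I m p u w / time_factor m p u w"
  define k2 where "k2 = scaled_mass I m p w u / time_factor m p u w"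
  have k: "k1 \<noteq> 0" "k2 \<noteq> 0" using chart_bounds[OF l(2)] by (auto simp: k1_def k2_def)
  have eq: "rubber_momentum a b \<mu> I l = (\<lambda>v. (k1 * fst v, k2 * snd v))"
    by (auto simp: l momentum_eq k1_def k2_def)
  show "linear (rubber_momentum a b \<mu> I l)"
    unfolding eq by (auto simp: linear_iff algebra_simps)
  show "bij (rubber_momentum a b \<mu> I l)"
    unfolding eq by (rule o_bij[of "\<lambda>v. (fst v / k1, snd v / k2)"]) (use k in \<open>auto simp: fun_eq_iff\<close>)
next
  fix v :: "real \<times> real"
  let ?C = "sphero_conical_chart I"
  have open_C: "open ?C" unfolding sphero_conical_chart_def by (intro open_Times) auto
  have C: "fst l + m > 0" "snd l + m > 0" "I$1 < fst l" "fst l < I$2" "I$2 < snd l" "snd l < I$3"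
    "time_factor m p (fst l) (snd l) \<noteq> 0" if "l \<in> ?C" for l
    using chart_bounds[of "fst l" "snd l"] that by auto
  note sm = Ck_on_add Ck_on_diff Ck_on_mult Ck_on_const Ck_on_fst Ck_on_snd
  have pos: "(fst l + m) * (snd l + m) > 0" "(snd l + m) * (fst l + m) > 0"
    "p\<^sup>2 * (fst l + m) * (snd l + m) > 0" if "l \<in> ?C" for l
    using C[OF that] parameter_facts(2) by auto
  have "Ck_on k (\<lambda>l. rubber_momentum a b \<mu> I l v) ?C" for k
  proof -
    have N: "Ck_on k (\<lambda>l. time_factor m p (fst l) (snd l)) ?C"
      unfolding time_factor_def by (intro Ck_on_powr sm pos)
    have nz: "(fst l - I$1) * (I$2 - fst l) * (I$3 - fst l) \<noteq> 0"
      "(snd l - I$1) * (I$2 - snd l) * (I$3 - snd l) \<noteq> 0" if "l \<in> ?C" for l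
      using C(3-6)[OF that] by auto
    have M1: "Ck_on k (\<lambda>l. scaled_mass I m p (fst l) (snd l)) ?C"
      unfolding scaled_mass_def conical_mass_def
      by (intro Ck_on_divide Ck_on_powr sm pos open_C nz)
    have M2: "Ck_on k (\<lambda>l. scaled_mass I m p (snd l) (fst l)) ?C"
      unfolding scaled_mass_def conical_mass_def
      by (intro Ck_on_divide Ck_on_powr sm pos open_C nz)
    have "(\<lambda>l. rubber_momentum a b \<mu> I l v) = (\<lambda>l.
        (scaled_mass I m p (fst l) (snd l) * fst v / time_factor m p (fst l) (snd l),
         scaled_mass I m p (snd l) (fst l) * snd v / time_factor m p (fst l) (snd l)))"
      by (auto simp: fun_eq_iff momentum_eq split: prod.split)
        (metis momentum_eq prod.collapse)+
    then show ?thesis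
      by (simp only:) (intro Ck_on_Pair Ck_on_divide sm M1 M2 N open_C C(7))
  qed
  then show "smooth_on (\<lambda>l. rubber_momentum a b \<mu> I l v) ?C"
    by (simp add: smooth_on_def)
qed

lemma hamiltonian_vf_eq:
  assumes "(u, w) \<in> sphero_conical_chart I"
  shows "hamiltonian_vf (rubber_hamiltonian a b \<mu> I) ((u, w), (P, Q)) =
    ((P / scaled_mass I m p u w, Q / scaled_mass I m p w u),
     (1/2 * (P\<^sup>2 / scaled_mass I m p u w * mass_logderiv I m p u w 1 0 + Q\<^sup>2 / scaled_mass I m p w u * mass_logderiv I m p w u 0 1),
      1/2 * (P\<^sup>2 / scaled_mass I m p u w * mass_logderiv I m p u w 0 1 + Q\<^sup>2 / scaled_mass I m p w u * mass_logderiv I m p w u 1 0)))"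
proof (rule hamiltonian_vf_diagonal[where M="scaled_mass I m p"])
  note c = chart_bounds[OF assms]
  have nz: "I$1 \<noteq> u" "I$2 \<noteq> u" "I$3 \<noteq> u" "I$1 \<noteq> w" "I$2 \<noteq> w" "I$3 \<noteq> w" using c by auto
  show "rubber_hamiltonian a b \<mu> I ((u, w), (P, Q)) =
    1/2 * (P\<^sup>2 / scaled_mass I m p u w + Q\<^sup>2 / scaled_mass I m p w u)" for u w P Q
    by (rule hamiltonian_eq)
  show "scaled_mass I m p u w \<noteq> 0" "scaled_mass I m p w u \<noteq> 0" using c by auto
  show "has_logderiv (\<lambda>u. scaled_mass I m p u w) (mass_logderiv I m p u w 1 0) u"
    using scaled_mass_logderiv[OF DERIV_ident DERIV_const[of w], of u m I p] c nz by simp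
  show "has_logderiv (\<lambda>u. scaled_mass I m p w u) (mass_logderiv I m p w u 0 1) u"
    using scaled_mass_logderiv[OF DERIV_const[of w] DERIV_ident, of m u I p] c nz by simp
  show "has_logderiv (\<lambda>w. scaled_mass I m p u w) (mass_logderiv I m p u w 0 1) w"
    using scaled_mass_logderiv[OF DERIV_const[of u] DERIV_ident, of m w I p] c nz by simp
  show "has_logderiv (\<lambda>w. scaled_mass I m p w u) (mass_logderiv I m p w u 1 0) w"
    using scaled_mass_logderiv[OF DERIV_ident DERIV_const[of u], of w m I p] c nz by simp
qed

text \<open>The first pair of Hamilton's equations holds by the choice of the momenta. Only the second pair carries
  information about the curve.\<close>

lemma integral_curve_iff:
  fixes l1 l2 x y :: "real \<Rightarrow> real"
  assumes J: "open J" "t \<in> J"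
    and chart_J: "\<And>t. t \<in> J \<Longrightarrow> (l1 t, l2 t) \<in> sphero_conical_chart I"
    and z: "\<And>t. t \<in> J \<Longrightarrow> z t = ((l1 t, l2 t), rubber_momentum a b \<mu> I (l1 t, l2 t) (x t, y t))"
    and d: "(l1 has_real_derivative x t) (at t)" "(l2 has_real_derivative y t) (at t)"
      "(x has_real_derivative x2) (at t)" "(y has_real_derivative y2) (at t)"
  shows "(z has_vector_derivative time_factor m p (l1 t) (l2 t) *\<^sub>R
       hamiltonian_vf (rubber_hamiltonian a b \<mu> I) (z t)) (at t) \<longleftrightarrow>
     conical_EL I m p (l1 t) (l2 t) (x t) (y t) x2 = 0 \<and> conical_EL I m p (l2 t) (l1 t) (y t) (x t) y2 = 0"
proof -
  note c = chart_bounds[OF chart_J[OF J(2)]]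
  define N where "N = time_factor m p (l1 t) (l2 t)"
  define M1 where "M1 = scaled_mass I m p (l1 t) (l2 t)"
  define M2 where "M2 = scaled_mass I m p (l2 t) (l1 t)"
  have N: "N > 0" and M: "M1 > 0" "M2 > 0" using c by (auto simp: N_def M1_def M2_def)
  have nz: "I$1 \<noteq> l1 t" "I$2 \<noteq> l1 t" "I$3 \<noteq> l1 t" "I$1 \<noteq> l2 t" "I$2 \<noteq> l2 t" "I$3 \<noteq> l2 t" using c by auto
  have sym: "time_factor m p w u = time_factor m p u w" for u w
    by (simp add: time_factor_def mult_ac)
  define F1 where "F1 = 1/2 * ((M1 * x t / N)\<^sup>2 / M1 * mass_logderiv I m p (l1 t) (l2 t) 1 0
        + (M2 * y t / N)\<^sup>2 / M2 * mass_logderiv I m p (l2 t) (l1 t) 0 1)"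
  define F2 where "F2 = 1/2 * ((M1 * x t / N)\<^sup>2 / M1 * mass_logderiv I m p (l1 t) (l2 t) 0 1
        + (M2 * y t / N)\<^sup>2 / M2 * mass_logderiv I m p (l2 t) (l1 t) 1 0)"
  obtain P' where P': "((\<lambda>t. scaled_mass I m p (l1 t) (l2 t) * x t / time_factor m p (l1 t) (l2 t))
      has_real_derivative P') (at t)" "P' = N * F1 \<longleftrightarrow> conical_EL I m p (l1 t) (l2 t) (x t) (y t) x2 = 0"
    using momentum_equation_iff[of l1 x t l2 y x2, OF d(1,2,3) c(1,2,3) nz(1-3) parameter_facts(2)]
    unfolding F1_def N_def M1_def M2_def by blast
  obtain Q' where Q': "((\<lambda>t. scaled_mass I m p (l2 t) (l1 t) * y t / time_factor m p (l1 t) (l2 t))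
      has_real_derivative Q') (at t)" "Q' = N * F2 \<longleftrightarrow> conical_EL I m p (l2 t) (l1 t) (y t) (x t) y2 = 0"
    using momentum_equation_iff[of l2 y t l1 x y2, OF d(2,1,4) c(2,1) c(3)[symmetric] nz(4-6) parameter_facts(2)]
    unfolding F2_def N_def M1_def M2_def sym[of "l2 _" "l1 _"] add.commute[of "_ * mass_logderiv I m p (l2 t) (l1 t) 1 0"]
    by blast
  have "(z has_vector_derivative ((x t, y t), (P', Q'))) (at t)"
  proof (rule has_vector_derivative_transform_within_open[OF _ J])
    show "((\<lambda>t. ((l1 t, l2 t), (scaled_mass I m p (l1 t) (l2 t) * x t / time_factor m p (l1 t) (l2 t),
        scaled_mass I m p (l2 t) (l1 t) * y t / time_factor m p (l1 t) (l2 t))))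
        has_vector_derivative ((x t, y t), (P', Q'))) (at t)"
      using d(1,2) P'(1) Q'(1)
      by (intro has_vector_derivative_Pair) (simp_all add: has_real_derivative_iff_has_vector_derivative)
  qed (simp add: z momentum_eq)
  then have "(z has_vector_derivative D) (at t) \<longleftrightarrow> D = ((x t, y t), (P', Q'))" for D
    using vector_derivative_unique_at by blast
  moreover have "N *\<^sub>R hamiltonian_vf (rubber_hamiltonian a b \<mu> I) (z t) = ((x t, y t), (N * F1, N * F2))"
    unfolding z[OF J(2)] momentum_eq hamiltonian_vf_eq[OF chart_J[OF J(2)]] F1_def F2_def N_def[symmetric]
      M1_def[symmetric] M2_def[symmetric]
    using N M by simp
  ultimately show ?thesis
    unfolding N_def[symmetric] using P'(2) Q'(2) by auto
qed

theorem rubber_motion_iff_integral_curve: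
  fixes \<gamma> :: "real \<Rightarrow> real^3"
  assumes J: "open J" "is_interval J" and C2: "Ck_on 2 \<gamma> J" and octants: "\<gamma> ` J \<subseteq> open_octants"
  defines "motion \<equiv> \<exists>q R. rubber_motion a b \<mu> I J q R \<and> (\<forall>t\<in>J. \<gamma> t = poisson a (q t) (R t))"
    and "N \<equiv> \<lambda>l. conformal_F a b \<mu> l powr ((b - a) / (2 * a))"
    and "X \<equiv> hamiltonian_vf (rubber_hamiltonian a b \<mu> I)"
    and "z \<equiv> phase_curve I (rubber_momentum a b \<mu> I) \<gamma>"
  shows "motion \<longleftrightarrow> integral_curve (\<lambda>(l, p). N l *\<^sub>R X (l, p)) z J"
    and "\<forall>t\<in>J. (\<tau> has_real_derivative N (sphero_conical I (\<gamma> t))) (at t) \<Longrightarrow>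
      motion \<longleftrightarrow> integral_curve X (\<lambda>s. z (inv_into J \<tau> s)) (\<tau> ` J)"
proof -
  have oct: "\<And>t. t \<in> J \<Longrightarrow> \<gamma> t \<in> open_octants" using octants by auto
  obtain \<gamma>1 \<gamma>2 where \<gamma>: "\<And>t. t \<in> J \<Longrightarrow> (\<gamma> has_vector_derivative \<gamma>1 t) (at t)"
    "\<And>t. t \<in> J \<Longrightarrow> (\<gamma>1 has_vector_derivative \<gamma>2 t) (at t)" "continuous_on J \<gamma>2"
    by (rule C2_curve_derivatives[OF C2]) (rule that)
  have "Ck_on 2 (\<lambda>t. sphero_conical I (\<gamma> t)) J"
    by (rule sphero_conical_C2[OF I(2,3) J(1) C2 octants])
  then obtain l' l'' where l': "\<And>t. t \<in> J \<Longrightarrow> ((\<lambda>t. sphero_conical I (\<gamma> t)) has_vector_derivative l' t) (at t)"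
    "\<And>t. t \<in> J \<Longrightarrow> (l' has_vector_derivative l'' t) (at t)" "continuous_on J l''"
    by (rule C2_curve_derivatives) (rule that)
  define l1 where "l1 t = fst (sphero_conical I (\<gamma> t))" for t
  define l2 where "l2 t = snd (sphero_conical I (\<gamma> t))" for t
  have l_eq: "sphero_conical I (\<gamma> t) = (l1 t, l2 t)" for t by (simp add: l1_def l2_def)
  have d: "(l1 has_real_derivative fst (l' t)) (at t)" "(l2 has_real_derivative snd (l' t)) (at t)"
    "((\<lambda>t. fst (l' t)) has_real_derivative fst (l'' t)) (at t)"
    "((\<lambda>t. snd (l' t)) has_real_derivative snd (l'' t)) (at t)" if "t \<in> J" for t
    unfolding l1_def l2_def has_real_derivative_iff_has_vector_derivative
    by (intro bounded_linear.has_vector_derivative[OF bounded_linear_fst]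
        bounded_linear.has_vector_derivative[OF bounded_linear_snd] l'(1,2)[OF that])+
  have chart_J: "(l1 t, l2 t) \<in> sphero_conical_chart I" if "t \<in> J" for t
    using sphero_conical_roots(4-7)[OF I(2,3) oct[OF that]]
    by (simp add: sphero_conical_chart_def l1_def l2_def del: prod.collapse)
  have z_eq: "z t = ((l1 t, l2 t), rubber_momentum a b \<mu> I (l1 t, l2 t) (fst (l' t), snd (l' t)))" if "t \<in> J" for t
    unfolding z_def phase_curve_def vector_derivative_at[OF l'(1)[OF that]] unfolding l_eq by simp
  have N_eq: "N (sphero_conical I (\<gamma> t)) = time_factor m p (l1 t) (l2 t)" for t
    unfolding N_def l_eq by (rule conformal_eq)
  have n\<gamma>: "norm (\<gamma> t) = 1" if "t \<in> J" for t using oct[OF that] by (simp add: open_octants_def)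
  define E where "E t = p *\<^sub>R (inertia I *v cross3 (\<gamma>2 t) (\<gamma> t) + m *\<^sub>R cross3 (\<gamma>2 t) (\<gamma> t)) +
      p\<^sup>2 *\<^sub>R cross3 (cross3 (\<gamma>1 t) (\<gamma> t)) (inertia I *v cross3 (\<gamma>1 t) (\<gamma> t))" for t
  have "motion \<longleftrightarrow> (\<forall>t\<in>J. \<forall>v. cross3 v (\<gamma> t) \<bullet> E t = 0)"
    unfolding motion_def E_def m_def p_def by (rule rubber_motion_iff[OF J a(1,3) \<gamma> n\<gamma>])
  also have "\<dots> \<longleftrightarrow> (\<forall>t\<in>J. (z has_vector_derivative N (sphero_conical I (\<gamma> t)) *\<^sub>R X (z t)) (at t))"
  proof (rule ball_cong[OF refl])
    fix t assume t: "t \<in> J"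
    have "(\<forall>v. cross3 v (\<gamma> t) \<bullet> E t = 0) \<longleftrightarrow>
      conical_EL I m p (l1 t) (l2 t) (fst (l' t)) (snd (l' t)) (fst (l'' t)) = 0 \<and>
      conical_EL I m p (l2 t) (l1 t) (snd (l' t)) (fst (l' t)) (snd (l'' t)) = 0"
      unfolding E_def
      using reduced_equation_iff[where x="\<lambda>t. fst (l' t)" and y="\<lambda>t. snd (l' t)",
            OF I parameter_facts(1,2) J(1) t oct \<gamma>(1,2) l1_def l2_def d(1,2) d(3)[OF t] d(4)[OF t]] .
    also have "\<dots> \<longleftrightarrow> (z has_vector_derivative N (sphero_conical I (\<gamma> t)) *\<^sub>R X (z t)) (at t)"
      unfolding N_eq X_def
      using integral_curve_iff[symmetric, where x="\<lambda>t. fst (l' t)" and y="\<lambda>t. snd (l' t)",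
            OF J(1) t chart_J z_eq d[OF t]] .
    finally show "(\<forall>v. cross3 v (\<gamma> t) \<bullet> E t = 0) \<longleftrightarrow>
      (z has_vector_derivative N (sphero_conical I (\<gamma> t)) *\<^sub>R X (z t)) (at t)" .
  qed
  finally have motion_iff: "motion \<longleftrightarrow> (\<forall>t\<in>J. (z has_vector_derivative N (sphero_conical I (\<gamma> t)) *\<^sub>R X (z t)) (at t))" .
  have "integral_curve (\<lambda>(l, p). N l *\<^sub>R X (l, p)) z J \<longleftrightarrow>
      (\<forall>t\<in>J. (z has_vector_derivative N (sphero_conical I (\<gamma> t)) *\<^sub>R X (z t)) (at t))"
    unfolding integral_curve_def by (intro ball_cong refl) (simp add: z_eq l_eq case_prod_beta)
  with motion_iff show "motion \<longleftrightarrow> integral_curve (\<lambda>(l, p). N l *\<^sub>R X (l, p)) z J" by simp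
  show "motion \<longleftrightarrow> integral_curve X (\<lambda>s. z (inv_into J \<tau> s)) (\<tau> ` J)"
    if "\<forall>t\<in>J. (\<tau> has_real_derivative N (sphero_conical I (\<gamma> t))) (at t)"
    unfolding motion_iff
    by (rule integral_curve_time_change[OF J]) (use that chart_bounds(9)[OF chart_J] N_eq in auto)
qed

end

theorem theorem1:
  fixes a b \<mu> :: real and I :: "real^3"
  assumes "a > 0" and "b \<noteq> 0" and "b \<noteq> - a" and "\<mu> > 0"
    and "0 < I $ 1" and "I $ 1 < I $ 2" and "I $ 2 < I $ 3"
  shows "\<exists>P. momentum_coordinates I P \<and>
    (\<forall>J \<gamma>. open J \<and> is_interval J \<and> Ck_on 2 \<gamma> J \<and> \<gamma> ` J \<subseteq> open_octants \<longrightarrow>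
      (let motion = (\<exists>q R. rubber_motion a b \<mu> I J q R \<and> (\<forall>t\<in>J. \<gamma> t = poisson a (q t) (R t)));
           N = (\<lambda>l. conformal_F a b \<mu> l powr ((b - a) / (2 * a)));
           X_H = hamiltonian_vf (rubber_hamiltonian a b \<mu> I);
           z = phase_curve I P \<gamma>
       in (motion \<longleftrightarrow> integral_curve (\<lambda>(l, p). N l *\<^sub>R X_H (l, p)) z J) \<and>
          (\<forall>\<tau>. (\<forall>t\<in>J. (\<tau> has_real_derivative N (sphero_conical I (\<gamma> t))) (at t)) \<longrightarrow>
             (motion \<longleftrightarrow> integral_curve X_H (\<lambda>s. z (inv_into J \<tau> s)) (\<tau> ` J)))))"
proof -
  interpret rubber_rolling a b \<mu> I by unfold_locales (fact assms)+
  show ?thesis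
    unfolding Let_def
    by (rule exI[of _ "rubber_momentum a b \<mu> I"])
      (intro conjI allI impI momentum_coordinates_rubber rubber_motion_iff_integral_curve; elim conjE; assumption)
qed

end
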